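(* Let $\lambda=(\lambda_1,\dots,\lambda_k,\underbrace{0,\dots,0}_{m},-\lambda_{k+m+1},\dots,-\lambda_n)\in\Lambda^+$ be a dominant integral weight of $\mathfrak q(n)$, where all $\lambda_i>0$ and $m\geq 0$ is the number of zero coordinates. Then $$\operatorname{Ext}^1_{\mathfrak q(n)}(L(\lambda),\Pi L(\lambda))=\begin{cases}\mathbb C&\text{if }m>0,\\0&\text{if }m=0.\end{cases}$$ If $L(\lambda)\not\cong\Pi L(\lambda)$, then $\operatorname{Ext}^1_{\mathfrak q(n)}(L(\lambda),L(\lambda))=0$.
   Context: Ground field $\mathbb C$. $\mathfrak q(n)$ is the Lie superalgebra of matrices $\begin{pmatrix}A&B\\ B&A\end{pmatrix}$, $A,B\in\mathfrak{gl}_n(\mathbb C)$ (even part $B=0$, odd part $A=0$). The Cartan subsuperalgebra $\mathfrak h$ consists of the elements with $A,B$ diagonal; weights are $\lambda=(\lambda_1,\dots,\lambda_n)\in\mathfrak h_{\bar0}^*$, where the $i$-th coordinate is the value on the even diagonal element with $A=E_{ii}$. The set of dominant integral weights is $\Lambda^+=\{\lambda:\lambda_i-\lambda_{i+1}\in\mathbb Z_{\ge0},\ \lambda_i=\lambda_j\ (i\neq j)\Rightarrow\lambda_i=\lambda_j=0\}$. $L(\lambda)$ is the simple finite-dimensional $\mathfrak q(n)$-supermodule of highest weight $\lambda$ (with respect to upper triangular $A,B$), determined up to the parity change functor $\Pi$. $\operatorname{Ext}^1_{\mathfrak q(n)}$ is taken in the category of finite-dimensional $\mathfrak q(n)$-supermodules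 semisimple over $\mathfrak q(n)_{\bar0}$, with parity-preserving morphisms. *)

theory Defs
  imports
    "Jordan_Normal_Form.Matrix"
    "HOL-Library.Z2"
    "HOL-Library.Function_Algebras"
    "HOL-Library.Product_Plus"
begin

section \<open>The Lie superalgebra q(n)\<close>

text \<open>Parities are elements of the type \<^typ>\<open>bit\<close> (the field with two elements): 0 is even, 1 is odd.
  Row and column indices of matrices, and the coordinates of weights, run over 0, ..., n - 1.\<close>

definition queer_mat :: "complex mat \<Rightarrow> complex mat \<Rightarrow> complex mat" where
  "queer_mat A B = four_block_mat A B B A"

definition queer :: "nat \<Rightarrow> complex mat set" where
  "queer n = {queer_mat A B | A B. A \<in> carrier_mat n n \<and> B \<in> carrier_mat n n}"

definition queer_part :: "nat \<Rightarrow> bit \<Rightarrow> complex mat set" where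
  "queer_part n a = (if a = 0 then {queer_mat A (0\<^sub>m n n) | A. A \<in> carrier_mat n n}
                     else {queer_mat (0\<^sub>m n n) B | B. B \<in> carrier_mat n n})"

definition koszul_sign :: "bit \<Rightarrow> bit \<Rightarrow> complex" where
  "koszul_sign a b = (if a = 1 \<and> b = 1 then -1 else 1)"

text \<open>The bracket of homogeneous elements x, y of parities a, b, inside gl(n|n).\<close>

definition super_bracket :: "bit \<Rightarrow> bit \<Rightarrow> complex mat \<Rightarrow> complex mat \<Rightarrow> complex mat" where
  "super_bracket a b x y = x * y - koszul_sign a b \<cdot>\<^sub>m (y * x)"

definition unit_diag :: "nat \<Rightarrow> nat \<Rightarrow> complex mat" where
  "unit_diag n i = mat n n (\<lambda>(r, c). if r = i \<and> c = i then 1 else 0)"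

definition strictly_upper :: "nat \<Rightarrow> complex mat set" where
  "strictly_upper n = {A \<in> carrier_mat n n. \<forall>i<n. \<forall>j\<le>i. A $$ (i, j) = 0}"

section \<open>Supermodules\<close>

text \<open>A supermodule lives on the subspace spanned by its two homogeneous parts inside the vector
  space given by the type \<^typ>\<open>'v\<close> with the scalar multiplication \<open>smul\<close>. Values of maps and
  of actions outside the respective subspaces are irrelevant.\<close>

record 'v supermodule =
  smul :: "complex \<Rightarrow> 'v \<Rightarrow> 'v"
  part :: "bit \<Rightarrow> 'v set"
  act :: "complex mat \<Rightarrow> 'v \<Rightarrow> 'v"

definition sm_space :: "'v::ab_group_add supermodule \<Rightarrow> 'v set" where
  "sm_space V = {u + w | u w. u \<in> part V 0 \<and> w \<in> part V 1}"

definition is_supermodule :: "nat \<Rightarrow> 'v::ab_group_add supermodule \<Rightarrow> bool" where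
  "is_supermodule n V \<longleftrightarrow>
     vector_space (smul V) \<and>
     (\<forall>a. module.subspace (smul V) (part V a)) \<and>
     part V 0 \<inter> part V 1 = {0} \<and>
     (\<forall>a b. \<forall>x\<in>queer_part n a. \<forall>v\<in>part V b. act V x v \<in> part V (a + b)) \<and>
     (\<forall>x\<in>queer n. \<forall>u\<in>sm_space V. \<forall>v\<in>sm_space V. act V x (u + v) = act V x u + act V x v) \<and>
     (\<forall>x\<in>queer n. \<forall>c. \<forall>v\<in>sm_space V. act V x (smul V c v) = smul V c (act V x v)) \<and>
     (\<forall>x\<in>queer n. \<forall>y\<in>queer n. \<forall>v\<in>sm_space V. act V (x + y) v = act V x v + act V y v) \<and>
     (\<forall>x\<in>queer n. \<forall>c. \<forall>v\<in>sm_space V. act V (c \<cdot>\<^sub>m x) v = smul V c (act V x v)) \<and>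
     (\<forall>a b. \<forall>x\<in>queer_part n a. \<forall>y\<in>queer_part n b. \<forall>v\<in>sm_space V.
        act V (super_bracket a b x y) v
          = act V x (act V y v) - smul V (koszul_sign a b) (act V y (act V x v)))"

definition finite_dimensional :: "'v::ab_group_add supermodule \<Rightarrow> bool" where
  "finite_dimensional V \<longleftrightarrow> (\<exists>B. finite B \<and> module.span (smul V) B = sm_space V)"

definition invariant_subspace ::
    "complex mat set \<Rightarrow> 'v::ab_group_add supermodule \<Rightarrow> 'v set \<Rightarrow> bool" where
  "invariant_subspace X V W \<longleftrightarrow>
     module.subspace (smul V) W \<and> W \<subseteq> sm_space V \<and> (\<forall>x\<in>X. \<forall>w\<in>W. act V x w \<in> W)"

definition semisimple_over_even :: "nat \<Rightarrow> 'v::ab_group_add supermodule \<Rightarrow> bool" where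
  "semisimple_over_even n V \<longleftrightarrow>
     (\<forall>W. invariant_subspace (queer_part n 0) V W \<longrightarrow>
        (\<exists>W'. invariant_subspace (queer_part n 0) V W' \<and> W \<inter> W' = {0} \<and>
              {w + w' | w w'. w \<in> W \<and> w' \<in> W'} = sm_space V))"

text \<open>The objects of the category in which Ext is taken.\<close>

definition queer_category_obj :: "nat \<Rightarrow> 'v::ab_group_add supermodule \<Rightarrow> bool" where
  "queer_category_obj n V \<longleftrightarrow>
     is_supermodule n V \<and> finite_dimensional V \<and> semisimple_over_even n V"

text \<open>Parity-preserving homomorphisms.\<close>

definition sm_hom ::
    "nat \<Rightarrow> 'v::ab_group_add supermodule \<Rightarrow> 'w::ab_group_add supermodule \<Rightarrow> ('v \<Rightarrow> 'w) set" where
  "sm_hom n V W = {f.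
     (\<forall>u\<in>sm_space V. \<forall>v\<in>sm_space V. f (u + v) = f u + f v) \<and>
     (\<forall>c. \<forall>v\<in>sm_space V. f (smul V c v) = smul W c (f v)) \<and>
     (\<forall>a. \<forall>v\<in>part V a. f v \<in> part W a) \<and>
     (\<forall>x\<in>queer n. \<forall>v\<in>sm_space V. f (act V x v) = act W x (f v))}"

definition sm_isomorphic ::
    "nat \<Rightarrow> 'v::ab_group_add supermodule \<Rightarrow> 'w::ab_group_add supermodule \<Rightarrow> bool" where
  "sm_isomorphic n V W \<longleftrightarrow> (\<exists>f\<in>sm_hom n V W. bij_betw f (sm_space V) (sm_space W))"

text \<open>The parity change functor. Another convention lets an odd x act by -x on the shifted module;
  the map multiplying even vectors by 1 and odd vectors by -1 is a parity-preserving isomorphism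
  between the two versions.\<close>

definition parity_change :: "'v supermodule \<Rightarrow> 'v supermodule" where
  "parity_change V = V\<lparr>part := \<lambda>a. part V (a + 1)\<rparr>"

definition graded :: "'v::ab_group_add supermodule \<Rightarrow> 'v set \<Rightarrow> bool" where
  "graded V W \<longleftrightarrow> W = {u + w | u w. u \<in> W \<inter> part V 0 \<and> w \<in> W \<inter> part V 1}"

definition simple_supermodule :: "nat \<Rightarrow> 'v::ab_group_add supermodule \<Rightarrow> bool" where
  "simple_supermodule n V \<longleftrightarrow> is_supermodule n V \<and> sm_space V \<noteq> {0} \<and>
     (\<forall>W. invariant_subspace (queer n) V W \<and> graded V W \<longrightarrow> W = {0} \<or> W = sm_space V)"

section \<open>Weights\<close>

definition dominant_weights :: "nat \<Rightarrow> (nat \<Rightarrow> complex) set" where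
  "dominant_weights n = {lam.
     (\<forall>i. Suc i < n \<longrightarrow> lam i - lam (Suc i) \<in> \<nat>) \<and>
     (\<forall>i<n. \<forall>j<n. i \<noteq> j \<and> lam i = lam j \<longrightarrow> lam i = 0 \<and> lam j = 0)}"

definition has_highest_weight ::
    "nat \<Rightarrow> (nat \<Rightarrow> complex) \<Rightarrow> 'v::ab_group_add supermodule \<Rightarrow> bool" where
  "has_highest_weight n lam V \<longleftrightarrow>
     (\<exists>v\<in>sm_space V. v \<noteq> 0 \<and>
        (\<forall>i<n. act V (queer_mat (unit_diag n i) (0\<^sub>m n n)) v = smul V (lam i) v) \<and>
        (\<forall>A\<in>strictly_upper n. \<forall>B\<in>strictly_upper n. act V (queer_mat A B) v = 0))"

text \<open>\<open>is_L n lam V\<close> says that V is a version of the simple supermodule usually denoted by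
  L of \<open>lam\<close>, which is defined only up to parity change (and isomorphism).\<close>

definition is_L :: "nat \<Rightarrow> (nat \<Rightarrow> complex) \<Rightarrow> 'v::ab_group_add supermodule \<Rightarrow> bool" where
  "is_L n lam V \<longleftrightarrow>
     finite_dimensional V \<and> simple_supermodule n V \<and> has_highest_weight n lam V"

section \<open>Yoneda Ext\<close>

text \<open>Extensions of M by N, that is, short exact sequences from N to the middle term to M. The middle
  terms are subspaces of \<^typ>\<open>nat \<Rightarrow> complex\<close>; every finite-dimensional supermodule is isomorphic
  to one of this form.\<close>

record ('m, 'n) extension =
  mid :: "(nat \<Rightarrow> complex) supermodule"
  inc :: "'n \<Rightarrow> nat \<Rightarrow> complex"
  prj :: "(nat \<Rightarrow> complex) \<Rightarrow> 'm"

definition extensions ::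
    "nat \<Rightarrow> 'm::ab_group_add supermodule \<Rightarrow> 'n::ab_group_add supermodule
       \<Rightarrow> ('m, 'n) extension set" where
  "extensions n M N = {e.
     queer_category_obj n (mid e) \<and>
     inc e \<in> sm_hom n N (mid e) \<and> prj e \<in> sm_hom n (mid e) M \<and>
     inj_on (inc e) (sm_space N) \<and>
     inc e ` sm_space N = {v \<in> sm_space (mid e). prj e v = 0} \<and>
     prj e ` sm_space (mid e) = sm_space M}"

definition ext_rel ::
    "nat \<Rightarrow> 'm::ab_group_add supermodule \<Rightarrow> 'n::ab_group_add supermodule
       \<Rightarrow> (('m, 'n) extension \<times> ('m, 'n) extension) set" where
  "ext_rel n M N = {(e, e'). e \<in> extensions n M N \<and> e' \<in> extensions n M N \<and>
     (\<exists>f\<in>sm_hom n (mid e) (mid e').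
        (\<forall>y\<in>sm_space N. f (inc e y) = inc e' y) \<and>
        (\<forall>v\<in>sm_space (mid e). prj e' (f v) = prj e v))}"

definition pullback ::
    "('a \<Rightarrow> 'm) \<Rightarrow> ('b \<Rightarrow> 'm) \<Rightarrow> 'a supermodule \<Rightarrow> 'b supermodule \<Rightarrow> ('a \<times> 'b) supermodule" where
  "pullback p q V W = \<lparr>
     smul = \<lambda>c (v, w). (smul V c v, smul W c w),
     part = \<lambda>a. {(v, w). v \<in> part V a \<and> w \<in> part W a \<and> p v = q w},
     act = \<lambda>x (v, w). (act V x v, act W x w)\<rparr>"

text \<open>Baer sum: pull back the direct sum of two extensions along the diagonal of M, then push out
  along the codiagonal of N. A pushout of an extension along a map g out of N is, up to equivalence, an
  extension receiving a morphism of extensions that is g on N and the identity on M; this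
  describes the class of the Baer sum without forming quotients. The scalar c acts by pushout along
  multiplication by c on N.\<close>

definition baer_sum ::
    "nat \<Rightarrow> 'm::ab_group_add supermodule \<Rightarrow> 'n::ab_group_add supermodule
       \<Rightarrow> ('m, 'n) extension set \<Rightarrow> ('m, 'n) extension set \<Rightarrow> ('m, 'n) extension set" where
  "baer_sum n M N X Y = {e \<in> extensions n M N. \<exists>e1\<in>X. \<exists>e2\<in>Y.
     \<exists>f\<in>sm_hom n (pullback (prj e1) (prj e2) (mid e1) (mid e2)) (mid e).
       (\<forall>y\<in>sm_space N. \<forall>z\<in>sm_space N. f (inc e1 y, inc e2 z) = inc e (y + z)) \<and>
       (\<forall>(v, w)\<in>sm_space (pullback (prj e1) (prj e2) (mid e1) (mid e2)). prj e (f (v, w)) = prj e1 v)}"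

definition ext_smult ::
    "nat \<Rightarrow> 'm::ab_group_add supermodule \<Rightarrow> 'n::ab_group_add supermodule
       \<Rightarrow> complex \<Rightarrow> ('m, 'n) extension set \<Rightarrow> ('m, 'n) extension set" where
  "ext_smult n M N c X = {e \<in> extensions n M N. \<exists>e1\<in>X.
     \<exists>f\<in>sm_hom n (mid e1) (mid e).
       (\<forall>y\<in>sm_space N. f (inc e1 y) = inc e (smul N c y)) \<and>
       (\<forall>v\<in>sm_space (mid e1). prj e (f v) = prj e1 v)}"

definition split_extensions ::
    "nat \<Rightarrow> 'm::ab_group_add supermodule \<Rightarrow> 'n::ab_group_add supermodule
       \<Rightarrow> ('m, 'n) extension set" where
  "split_extensions n M N = {e \<in> extensions n M N.
     \<exists>s\<in>sm_hom n M (mid e). \<forall>x\<in>sm_space M. prj e (s x) = x}"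

text \<open>As for \<^const>\<open>module_vec\<close>, the multiplicative fields of the record carry no information.\<close>

definition Ext1 ::
    "nat \<Rightarrow> 'm::ab_group_add supermodule \<Rightarrow> 'n::ab_group_add supermodule
       \<Rightarrow> (complex, ('m, 'n) extension set) module" where
  "Ext1 n M N = \<lparr>
     carrier = extensions n M N // ext_rel n M N,
     mult = undefined,
     one = undefined,
     zero = split_extensions n M N,
     add = baer_sum n M N,
     smult = ext_smult n M N\<rparr>"

definition complex_line :: "(complex, complex) module" where
  "complex_line = \<lparr>carrier = UNIV, mult = (*), one = 1, zero = 0, add = (+), smult = (*)\<rparr>"

definition linear_isomorphic :: "(complex, 'a) module \<Rightarrow> (complex, 'b) module \<Rightarrow> bool" where
  "linear_isomorphic V W \<longleftrightarrow> (\<exists>\<phi>. bij_betw \<phi> (carrier V) (carrier W) \<and>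
     (\<forall>x\<in>carrier V. \<forall>y\<in>carrier V. \<phi> (x \<oplus>\<^bsub>V\<^esub> y) = \<phi> x \<oplus>\<^bsub>W\<^esub> \<phi> y) \<and>
     (\<forall>c. \<forall>x\<in>carrier V. \<phi> (c \<odot>\<^bsub>V\<^esub> x) = c \<odot>\<^bsub>W\<^esub> \<phi> x))"

end

theory Submission
  imports Defs "HOL-Computational_Algebra.Fundamental_Theorem_Algebra"
begin

text \<open>
  The weight space \<open>T(V)\<close> of weight \<open>lam\<close> controls everything: it is a module over the Cartan
  subsuperalgebra, it generates \<open>L\<close> and every self-extension, and every non-zero submodule of one of
  these meets it. Therefore a Cartan-equivariant map between such weight spaces extends to a
  homomorphism of modules. The odd element \<open>h\<^sub>j\<close> of the Cartan subsuperalgebra squares to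
  \<open>lam j\<close> on the weight space. Averaging over the \<open>h\<^sub>j\<close> with \<open>lam j \<noteq> 0\<close> gives a section
  \<open>T(L) \<rightarrow> T(V)\<close> commuting with these. For \<open>lam j = 0\<close> the element \<open>h\<^sub>j\<close> kills \<open>T(L)\<close>, and on
  \<open>T(V)\<close> all these \<open>h\<^sub>j\<close> coincide by an \<open>sl\<^sub>2\<close> argument; by Schur's lemma they act as a scalar
  multiple of the parity sign from \<open>T(L)\<close> to the kernel. This scalar determines the class of the
  extension. Every scalar occurs: let \<open>x\<close> act on \<open>L \<oplus> \<Pi> L\<close> with the additional term odd trace of \<open>x\<close>
  times parity sign.
\<close>

section \<open>Matrix units of q(n)\<close>

text \<open>A section on the weight space can be repaired for \<open>h\<^sub>j\<close> with
  \<open>lam j\<close> non-zero because the square of \<open>h\<^sub>j\<close> is then invertible;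
  for \<open>lam j = 0\<close> no averaging exists, and what is left there is the only obstruction
  to splitting. Without zero coordinates nothing is left, and every extension by \<Pi> L splits. The
  parity sign enters because \<open>h\<^sub>j\<close> anticommutes with the other odd diagonal
  elements, while Schur's lemma concerns maps that commute with them: composed with the sign, the
  obstruction becomes a parity-preserving map from T(L) to T(L) for extensions of L by \<Pi> L, and
  from T(L) to \<Pi> T(L) for extensions of L by L. The latter must vanish when L and \<Pi> L are
  not isomorphic. The same sign repairs the bracket relation in the converse construction, where the
  odd trace is used because it is an odd functional that vanishes on all brackets. Weight theory and
  ordered monomials are replaced by the eigenvalues of a single diagonal element: the weight
  \<open>lam\<close> sits in the highest degree, so vectors above it vanish and a submodule
  generated from it gains no new vectors of weight \<open>lam\<close>.\<close>

declare add_bit_eq_xor [simp del]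

lemma koszul_sign_simps [simp]:
  "koszul_sign 0 a = 1" "koszul_sign a 0 = 1" "koszul_sign 1 1 = -1"
  by (auto simp: koszul_sign_def)

lemma bit_add_self [simp]: "(a::bit) + a = 0" "(a::bit) + (a + b) = b" "(a::bit) + b + b = a"
  by (cases a; cases b; simp add: one_add_one)+

definition munit :: "nat \<Rightarrow> nat \<Rightarrow> nat \<Rightarrow> complex mat" where
  "munit n i j = mat n n (\<lambda>(r, c). if r = i \<and> c = j then 1 else 0)"

text \<open>The parity is an argument so that even and odd units share one multiplication rule and
  one bracket rule.\<close>

definition qunit :: "nat \<Rightarrow> bit \<Rightarrow> nat \<Rightarrow> nat \<Rightarrow> complex mat" where
  "qunit n a i j = (if a = 0 then queer_mat (munit n i j) (0\<^sub>m n n)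
                    else queer_mat (0\<^sub>m n n) (munit n i j))"

lemma munit_carrier [simp]: "munit n i j \<in> carrier_mat n n"
  by (simp add: munit_def)

lemma munit_mult:
  assumes "i < n" "j < n" "k < n" "l < n"
  shows "munit n i j * munit n k l = (if j = k then munit n i l else 0\<^sub>m n n)"
proof (rule eq_matI)
  fix r c
  assume "r < dim_row (if j = k then munit n i l else 0\<^sub>m n n)"
    "c < dim_col (if j = k then munit n i l else 0\<^sub>m n n)"
  then have rc: "r < n" "c < n" by (auto simp: munit_def split: if_splits)
  have "(munit n i j * munit n k l) $$ (r, c)
      = (\<Sum>q<n. (if r = i \<and> q = j then 1 else 0) * (if q = k \<and> c = l then 1 else 0))"
    using rc by (simp add: munit_def scalar_prod_def lessThan_atLeast0)
  also have "\<dots> = (\<Sum>q<n. if q = j then (if r = i \<and> j = k \<and> c = l then 1 else 0) else 0)"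
    by (rule sum.cong) auto
  finally show "(munit n i j * munit n k l) $$ (r, c)
      = (if j = k then munit n i l else 0\<^sub>m n n) $$ (r, c)"
    using rc assms by (simp add: munit_def)
qed (use assms in \<open>auto simp: munit_def\<close>)

lemma queer_mat_carrier [simp]:
  "A \<in> carrier_mat n n \<Longrightarrow> B \<in> carrier_mat n n \<Longrightarrow> queer_mat A B \<in> carrier_mat (n + n) (n + n)"
  by (auto simp: queer_mat_def)

lemma queer_mat_mult:
  assumes "A \<in> carrier_mat n n" "B \<in> carrier_mat n n" "A' \<in> carrier_mat n n" "B' \<in> carrier_mat n n"
  shows "queer_mat A B * queer_mat A' B' = queer_mat (A * A' + B * B') (A * B' + B * A')"
proof -
  have "B * A' + A * B' = A * B' + B * A'" "B * B' + A * A' = A * A' + B * B'"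
    using assms by (auto intro!: comm_add_mat[of _ n n])
  then show ?thesis
    unfolding queer_mat_def
    by (subst mult_four_block_mat[OF assms(1,2,2,1) assms(3,4,4,3)]) simp
qed

lemma queer_mat_add:
  assumes "A \<in> carrier_mat n n" "B \<in> carrier_mat n n" "A' \<in> carrier_mat n n" "B' \<in> carrier_mat n n"
  shows "queer_mat A B + queer_mat A' B' = queer_mat (A + A') (B + B')"
  unfolding queer_mat_def
  by (rule add_four_block_mat[OF assms(1,2,2,1) assms(3,4,4,3)])

lemma queer_mat_smult:
  assumes "A \<in> carrier_mat n n" "B \<in> carrier_mat n n"
  shows "c \<cdot>\<^sub>m queer_mat A B = queer_mat (c \<cdot>\<^sub>m A) (c \<cdot>\<^sub>m B)"
  unfolding queer_mat_def
  by (rule smult_four_block_mat[OF assms(1,2,2,1)])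

lemma queer_matI: "A \<in> carrier_mat n n \<Longrightarrow> B \<in> carrier_mat n n \<Longrightarrow> queer_mat A B \<in> queer n"
  by (auto simp: queer_def)

lemma queer_carrier: "x \<in> queer n \<Longrightarrow> x \<in> carrier_mat (n + n) (n + n)"
  by (auto simp: queer_def)

lemma queer_add: "x \<in> queer n \<Longrightarrow> y \<in> queer n \<Longrightarrow> x + y \<in> queer n"
proof -
  assume "x \<in> queer n" "y \<in> queer n"
  then obtain A B C D where "x = queer_mat A B" "y = queer_mat C D" "A \<in> carrier_mat n n"
    "B \<in> carrier_mat n n" "C \<in> carrier_mat n n" "D \<in> carrier_mat n n"
    by (auto simp: queer_def)
  then show ?thesis by (simp add: queer_mat_add[of _ n] queer_matI)
qed

lemma queer_smult: "x \<in> queer n \<Longrightarrow> c \<cdot>\<^sub>m x \<in> queer n"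
proof -
  assume "x \<in> queer n"
  then obtain A B where "x = queer_mat A B" "A \<in> carrier_mat n n" "B \<in> carrier_mat n n"
    by (auto simp: queer_def)
  then show ?thesis by (simp add: queer_mat_smult[of _ n] queer_matI)
qed

lemma queer_zero: "0\<^sub>m (n + n) (n + n) \<in> queer n"
  using queer_matI[of "0\<^sub>m n n" n "0\<^sub>m n n"] by (simp add: queer_mat_def)

lemma queer_part_subset: "queer_part n a \<subseteq> queer n"
  by (auto simp: queer_part_def intro: queer_matI)

lemma qunit_part [simp]: "qunit n a i j \<in> queer_part n a"
  by (auto simp: qunit_def queer_part_def)

lemma qunit_queer [simp]: "qunit n a i j \<in> queer n"
  using queer_part_subset qunit_part by blast

lemma qunit_carrier [simp]: "qunit n a i j \<in> carrier_mat (n + n) (n + n)"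
  by (simp add: queer_carrier)

lemma unit_diag_qunit: "queer_mat (unit_diag n i) (0\<^sub>m n n) = qunit n 0 i i"
  by (simp add: unit_diag_def qunit_def munit_def)

text \<open>q(n) is the tensor product of gl_n with the algebra of one odd generator of square 1;
  hence it is closed under the associative product, parities add and no sign appears.\<close>

lemma qunit_mult:
  assumes "i < n" "j < n" "k < n" "l < n"
  shows "qunit n a i j * qunit n b k l = of_bool (j = k) \<cdot>\<^sub>m qunit n (a + b) i l"
proof -
  have z: "munit n i j * 0\<^sub>m n n = 0\<^sub>m n n" "0\<^sub>m n n * munit n i j = 0\<^sub>m n n" for i j
    by (rule right_mult_zero_mat left_mult_zero_mat, simp)+
  have s: "of_bool p \<cdot>\<^sub>m A = (if p then A else 0\<^sub>m n n)" if "A \<in> carrier_mat n n" for p and A :: "complex mat"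
    using that by (cases p) auto
  show ?thesis
    using assms by (cases a; cases b)
      (simp_all add: qunit_def queer_mat_mult[of _ n] munit_mult queer_mat_smult[of _ n] z s)
qed

text \<open>The result is a sum of scalar multiples, since the module axioms speak of sums and
  scalar multiples of matrices and not of differences.\<close>

lemma bracket_qunit:
  assumes "i < n" "j < n" "k < n" "l < n"
  shows "super_bracket a b (qunit n a i j) (qunit n b k l)
    = of_bool (j = k) \<cdot>\<^sub>m qunit n (a + b) i l
      + (- (koszul_sign a b * of_bool (l = i))) \<cdot>\<^sub>m qunit n (a + b) k j"
proof -
  have c: "qunit n (a + b) i l \<in> carrier_mat (n + n) (n + n)"
    "qunit n (a + b) k j \<in> carrier_mat (n + n) (n + n)"
    by simp_all
  show ?thesis
    unfolding super_bracket_def qunit_mult[OF assms] qunit_mult[OF assms(3,4,1,2)] add.commute[of b a]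
    using c by (intro eq_matI) auto
qed

text \<open>Reduces statements that are linear in the matrix to matrix units.\<close>

lemma queer_induct [consumes 1, case_names unit zero add smult]:
  assumes x: "x \<in> queer n"
    and unit: "\<And>a i j. i < n \<Longrightarrow> j < n \<Longrightarrow> P (qunit n a i j)"
    and zero: "P (0\<^sub>m (n + n) (n + n))"
    and add: "\<And>x y. x \<in> queer n \<Longrightarrow> y \<in> queer n \<Longrightarrow> P x \<Longrightarrow> P y \<Longrightarrow> P (x + y)"
    and smult: "\<And>c x. x \<in> queer n \<Longrightarrow> P x \<Longrightarrow> P (c \<cdot>\<^sub>m x)"
  shows "P x"
proof -
  obtain A B where AB: "A \<in> carrier_mat n n" "B \<in> carrier_mat n n" "x = queer_mat A B"
    using x by (auto simp: queer_def)
  \<comment> \<open>\<open>r S A\<close> keeps the entries at positions in \<open>S\<close>. The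
    matrix is built up entry by entry, separately for the even and the odd part
    \<open>h a\<close>.\<close>
  define r where "r S A = mat n n (\<lambda>p. if p \<in> S then A $$ p else 0)" for S and A :: "complex mat"
  define h where "h a A = (if a = 0 then queer_mat A (0\<^sub>m n n) else queer_mat (0\<^sub>m n n) A)"
    for a :: bit and A
  have z: "queer_mat (0\<^sub>m n n) (0\<^sub>m n n) = 0\<^sub>m (n + n) (n + n)"
    by (simp add: queer_mat_def)
  have rc: "r S A \<in> carrier_mat n n" for S A by (simp add: r_def)
  have hq: "A \<in> carrier_mat n n \<Longrightarrow> h a A \<in> queer n" for a A by (auto simp: h_def intro!: queer_matI)
  have key: "P (h a (r S A))" if "finite S" "S \<subseteq> {..<n} \<times> {..<n}" for S A a
    using that
  proof (induction S rule: finite_induct)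
    case empty
    have "r {} A = 0\<^sub>m n n" by (auto simp: r_def)
    then show ?case using zero by (simp add: h_def z)
  next
    case (insert p S)
    obtain i j where p: "p = (i, j)" "i < n" "j < n" using insert.prems by auto
    have "r (insert p S) A = r S A + (A $$ p) \<cdot>\<^sub>m munit n i j"
      using insert.hyps p by (intro eq_matI) (auto simp: r_def munit_def)
    then have "h a (r (insert p S) A) = h a (r S A) + (A $$ p) \<cdot>\<^sub>m qunit n a i j"
      using rc[of S A] by (auto simp: h_def qunit_def queer_mat_add[of _ n] queer_mat_smult[of _ n])
    moreover have "P (h a (r S A))" using insert by auto
    ultimately show ?case
      using add[OF hq[OF rc] queer_smult[OF qunit_queer]] smult[OF qunit_queer unit] p by simp
  qed
  have full: "r ({..<n} \<times> {..<n}) A = A" if "A \<in> carrier_mat n n" for A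
    using that by (intro eq_matI) (auto simp: r_def)
  have "P (h a A)" if "A \<in> carrier_mat n n" for a A
    using key[of "{..<n} \<times> {..<n}" a A] that by (simp add: full)
  then have "P (h 0 A + h 1 B)"
    using AB by (intro add hq) auto
  then show ?thesis
    using AB by (simp add: h_def queer_mat_add[of _ n])
qed

lemma strictly_upper_munit: "i < j \<Longrightarrow> munit n i j \<in> strictly_upper n"
  by (auto simp: strictly_upper_def munit_def)

lemma zero_strictly_upper: "0\<^sub>m n n \<in> strictly_upper n"
  by (auto simp: strictly_upper_def)

section \<open>Supermodules\<close>

definition component :: "'v::ab_group_add supermodule \<Rightarrow> bit \<Rightarrow> 'v \<Rightarrow> 'v" where
  "component V a v = (THE u. u \<in> part V a \<and> v - u \<in> part V (a + 1))"

text \<open>The grading automorphism; it commutes with even and anticommutes with odd elements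
  (\<open>parity_sign_act\<close>).\<close>

definition parity_sign :: "'v::ab_group_add supermodule \<Rightarrow> 'v \<Rightarrow> 'v" where
  "parity_sign V v = component V 0 v - component V 1 v"

abbreviation unit_act :: "nat \<Rightarrow> 'v supermodule \<Rightarrow> bit \<Rightarrow> nat \<Rightarrow> nat \<Rightarrow> 'v \<Rightarrow> 'v" where
  "unit_act n V a i j \<equiv> act V (qunit n a i j)"

locale supermod =
  fixes n :: nat and V :: "'v::ab_group_add supermodule"
  assumes is_supermodule: "is_supermodule n V"
begin

sublocale vs: vector_space "smul V"
  using is_supermodule by (simp add: is_supermodule_def)

abbreviation X where "X \<equiv> unit_act n V"

lemma part_subspace: "vs.subspace (part V a)"
  using is_supermodule by (simp add: is_supermodule_def)

lemma zero_in_part [simp]: "0 \<in> part V a"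
  by (rule vs.subspace_0[OF part_subspace])

lemma part_add: "u \<in> part V a \<Longrightarrow> v \<in> part V a \<Longrightarrow> u + v \<in> part V a"
  by (rule vs.subspace_add[OF part_subspace])

lemma part_diff: "u \<in> part V a \<Longrightarrow> v \<in> part V a \<Longrightarrow> u - v \<in> part V a"
  by (rule vs.subspace_diff[OF part_subspace])

lemma part_scale: "v \<in> part V a \<Longrightarrow> smul V c v \<in> part V a"
  by (rule vs.subspace_scale[OF part_subspace])

lemma part_neg: "v \<in> part V a \<Longrightarrow> - v \<in> part V a"
  by (rule vs.subspace_neg[OF part_subspace])

lemma part_disjoint: "v \<in> part V a \<Longrightarrow> v \<in> part V (a + 1) \<Longrightarrow> v = 0"
  using is_supermodule by (cases a) (auto simp: is_supermodule_def)

lemma part_subset: "v \<in> part V a \<Longrightarrow> v \<in> sm_space V"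
  unfolding sm_space_def
  using add.right_neutral[of v] add.left_neutral[of v] zero_in_part
  by (cases a; simp; metis)

lemma space_subspace: "vs.subspace (sm_space V)"
proof -
  have "sm_space V = {u + w | u w. u \<in> part V 0 \<and> w \<in> part V 1}" by (simp add: sm_space_def)
  then show ?thesis using vs.subspace_sums[OF part_subspace part_subspace] by simp
qed

lemma space_zero [simp]: "0 \<in> sm_space V"
  by (rule vs.subspace_0[OF space_subspace])

lemma space_add [intro]: "u \<in> sm_space V \<Longrightarrow> v \<in> sm_space V \<Longrightarrow> u + v \<in> sm_space V"
  by (rule vs.subspace_add[OF space_subspace])

lemma space_diff [intro]: "u \<in> sm_space V \<Longrightarrow> v \<in> sm_space V \<Longrightarrow> u - v \<in> sm_space V"
  by (rule vs.subspace_diff[OF space_subspace])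

lemma space_neg [intro]: "v \<in> sm_space V \<Longrightarrow> - v \<in> sm_space V"
  by (rule vs.subspace_neg[OF space_subspace])

lemma space_scale [intro]: "v \<in> sm_space V \<Longrightarrow> smul V c v \<in> sm_space V"
  by (rule vs.subspace_scale[OF space_subspace])

lemma space_sum: "(\<And>k. k \<in> F \<Longrightarrow> f k \<in> sm_space V) \<Longrightarrow> sum f F \<in> sm_space V"
  by (rule vs.subspace_sum[OF space_subspace])

lemma component_unique:
  assumes "u \<in> part V a" "v - u \<in> part V (a + 1)" "u' \<in> part V a" "v - u' \<in> part V (a + 1)"
  shows "u = u'"
proof -
  have "u - u' \<in> part V a" using assms by (simp add: part_diff)
  moreover have "u - u' \<in> part V (a + 1)"
    using part_diff[OF assms(4) assms(2)] by simp
  ultimately show ?thesis using part_disjoint by fastforce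
qed

lemma component_eqI: "u \<in> part V a \<Longrightarrow> v - u \<in> part V (a + 1) \<Longrightarrow> component V a v = u"
  unfolding component_def by (rule the_equality) (auto intro: component_unique)

lemma component_exists:
  assumes "v \<in> sm_space V"
  shows "\<exists>u. u \<in> part V a \<and> v - u \<in> part V (a + 1)"
proof -
  obtain u w where "u \<in> part V 0" "w \<in> part V 1" "v = u + w"
    using assms by (auto simp: sm_space_def)
  then show ?thesis
    by (cases a) (auto intro: exI[of _ u] exI[of _ w])
qed

lemma component_in [simp]: "v \<in> sm_space V \<Longrightarrow> component V a v \<in> part V a"
  and component_rest: "v \<in> sm_space V \<Longrightarrow> v - component V a v \<in> part V (a + 1)"
  using component_exists[of v a] component_eqI by auto

lemma component_space [simp]: "v \<in> sm_space V \<Longrightarrow> component V a v \<in> sm_space V"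
  by (rule part_subset) (rule component_in)

lemma component_same [simp]: "v \<in> part V a \<Longrightarrow> component V a v = v"
  by (rule component_eqI) auto

lemma component_other: "v \<in> part V (a + 1) \<Longrightarrow> component V a v = 0"
  by (rule component_eqI) auto

lemma component_sum_01: "v \<in> sm_space V \<Longrightarrow> component V 0 v + component V 1 v = v"
proof -
  assume v: "v \<in> sm_space V"
  have "component V 1 v = v - component V 0 v"
    using component_rest[OF v, of 0] component_in[OF v, of 0] by (intro component_eqI) auto
  then show ?thesis by simp
qed

lemma component_add:
  assumes "u \<in> sm_space V" "v \<in> sm_space V"
  shows "component V a (u + v) = component V a u + component V a v"
proof (rule component_eqI)
  show "u + v - (component V a u + component V a v) \<in> part V (a + 1)"
    using part_add[OF component_rest[OF assms(1), of a] component_rest[OF assms(2), of a]]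
    by (simp add: add_diff_add)
qed (use assms in \<open>auto intro: part_add\<close>)

lemma component_scale:
  assumes "v \<in> sm_space V"
  shows "component V a (smul V c v) = smul V c (component V a v)"
proof (rule component_eqI)
  show "smul V c v - smul V c (component V a v) \<in> part V (a + 1)"
    using part_scale[OF component_rest[OF assms]] by (simp add: vs.scale_right_diff_distrib)
qed (use assms in \<open>auto intro: part_scale\<close>)

lemma act_part: "x \<in> queer_part n a \<Longrightarrow> v \<in> part V b \<Longrightarrow> act V x v \<in> part V (a + b)"
  using is_supermodule by (simp add: is_supermodule_def)

lemma act_add: "x \<in> queer n \<Longrightarrow> u \<in> sm_space V \<Longrightarrow> v \<in> sm_space V \<Longrightarrow>
    act V x (u + v) = act V x u + act V x v"
  using is_supermodule by (simp add: is_supermodule_def)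

lemma act_scale: "x \<in> queer n \<Longrightarrow> v \<in> sm_space V \<Longrightarrow> act V x (smul V c v) = smul V c (act V x v)"
  using is_supermodule by (simp add: is_supermodule_def)

lemma act_add_mat: "x \<in> queer n \<Longrightarrow> y \<in> queer n \<Longrightarrow> v \<in> sm_space V \<Longrightarrow>
    act V (x + y) v = act V x v + act V y v"
  using is_supermodule by (simp add: is_supermodule_def)

lemma act_smult_mat: "x \<in> queer n \<Longrightarrow> v \<in> sm_space V \<Longrightarrow> act V (c \<cdot>\<^sub>m x) v = smul V c (act V x v)"
  using is_supermodule by (simp add: is_supermodule_def)

lemma act_bracket: "x \<in> queer_part n a \<Longrightarrow> y \<in> queer_part n b \<Longrightarrow> v \<in> sm_space V \<Longrightarrow>
    act V (super_bracket a b x y) v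
      = act V x (act V y v) - smul V (koszul_sign a b) (act V y (act V x v))"
  using is_supermodule unfolding is_supermodule_def by blast

lemma act_zero_mat: "v \<in> sm_space V \<Longrightarrow> act V (0\<^sub>m (n + n) (n + n)) v = 0"
  using act_smult_mat[OF queer_zero, of v 0] by (simp add: smult_zero_mat)

lemma X_part: "v \<in> part V b \<Longrightarrow> X a i j v \<in> part V (a + b)"
  by (rule act_part) auto

text \<open>The axioms fix the range of the action only on homogeneous vectors, so the vector is
  split into its components.\<close>

lemma X_space [simp]: 
  assumes "v \<in> sm_space V"
  shows "X a i j v \<in> sm_space V"
proof -
  have "X a i j v = X a i j (component V 0 v) + X a i j (component V 1 v)"
    using act_add[OF qunit_queer, of "component V 0 v" "component V 1 v"] component_sum_01 assms
    by simp
  then show ?thesis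
    using assms by (auto intro!: space_add part_subset[OF X_part[OF component_in]])
qed

lemma act_space [simp]: "x \<in> queer n \<Longrightarrow> v \<in> sm_space V \<Longrightarrow> act V x v \<in> sm_space V"
  by (induction x rule: queer_induct) (auto simp: act_zero_mat act_add_mat act_smult_mat)

lemma act_0 [simp]: "x \<in> queer n \<Longrightarrow> act V x 0 = 0"
  using act_scale[of x 0 0] by simp

lemma act_neg: "x \<in> queer n \<Longrightarrow> v \<in> sm_space V \<Longrightarrow> act V x (- v) = - act V x v"
  using act_scale[of x v "-1"] by simp

lemma act_diff: "x \<in> queer n \<Longrightarrow> u \<in> sm_space V \<Longrightarrow> v \<in> sm_space V \<Longrightarrow>
    act V x (u - v) = act V x u - act V x v"
  using act_add[of x u "- v"] by (auto simp: act_neg)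

lemma act_sum: "x \<in> queer n \<Longrightarrow> (\<And>k. k \<in> F \<Longrightarrow> f k \<in> sm_space V) \<Longrightarrow>
    act V x (sum f F) = (\<Sum>k\<in>F. act V x (f k))"
  by (induction F rule: infinite_finite_induct) (auto simp: act_add space_sum)

lemma component_act:
  assumes x: "x \<in> queer_part n a" and v: "v \<in> sm_space V"
  shows "component V (a + b) (act V x v) = act V x (component V b v)"
proof (rule component_eqI)
  have q: "x \<in> queer n" using x queer_part_subset by auto
  show "act V x (component V b v) \<in> part V (a + b)"
    using x v by (intro act_part component_in)
  have "act V x (v - component V b v) \<in> part V (a + (b + 1))"
    using act_part[OF x component_rest[OF v]] .
  then show "act V x v - act V x (component V b v) \<in> part V (a + b + 1)"
    using v q by (simp add: act_diff add.assoc)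
qed

lemmas component_X = component_act[OF qunit_part]

lemma component_X_even: "v \<in> sm_space V \<Longrightarrow> component V b (X 0 i j v) = X 0 i j (component V b v)"
  using component_X[of v 0 b i j] by simp

text \<open>The bracket relation solved for one order of the product, the form in which operators
  are moved past each other below.\<close>

lemma X_X:
  assumes "v \<in> sm_space V" "i < n" "j < n" "k < n" "l < n"
  shows "X a i j (X b k l v) = smul V (koszul_sign a b) (X b k l (X a i j v))
    + smul V (of_bool (j = k)) (X (a + b) i l v)
    - smul V (koszul_sign a b * of_bool (l = i)) (X (a + b) k j v)"
proof -
  have "X a i j (X b k l v) - smul V (koszul_sign a b) (X b k l (X a i j v))
    = smul V (of_bool (j = k)) (X (a + b) i l v)
    + smul V (- (koszul_sign a b * of_bool (l = i))) (X (a + b) k j v)"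
    using act_bracket[of "qunit n a i j" a "qunit n b k l" b v]
    unfolding bracket_qunit[OF assms(2-)]
    using assms(1) by (simp add: act_add_mat act_smult_mat queer_smult)
  then show ?thesis by (simp add: algebra_simps)
qed

lemma invariantI:
  assumes "vs.subspace W" "W \<subseteq> sm_space V"
    and "\<And>a i j w. i < n \<Longrightarrow> j < n \<Longrightarrow> w \<in> W \<Longrightarrow> X a i j w \<in> W"
  shows "invariant_subspace (queer n) V W"
  unfolding invariant_subspace_def
proof (intro conjI ballI)
  fix x w assume xw: "x \<in> queer n" "w \<in> W"
  then have "w \<in> sm_space V" using assms by auto
  with xw show "act V x w \<in> W"
    by (induction x rule: queer_induct)
      (auto simp: act_zero_mat act_add_mat act_smult_mat assms
        vs.subspace_0 vs.subspace_add vs.subspace_scale)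
qed (use assms in auto)

lemma gradedI:
  assumes "vs.subspace W" "W \<subseteq> sm_space V" and "\<And>a w. w \<in> W \<Longrightarrow> component V a w \<in> W"
  shows "graded V W"
  unfolding graded_def
proof (intro equalityI subsetI)
  fix w assume w: "w \<in> W"
  then have "w = component V 0 w + component V 1 w" "component V 0 w \<in> part V 0" "component V 1 w \<in> part V 1"
    using assms component_sum_01 by auto
  then show "w \<in> {u + w |u w. u \<in> W \<inter> part V 0 \<and> w \<in> W \<inter> part V 1}"
    using assms(3)[OF w] by blast
qed (auto intro: vs.subspace_add[OF assms(1)])

lemma gradedD:
  assumes "graded V W" "w \<in> W"
  shows "component V a w \<in> W"
proof -
  obtain u u' where u: "w = u + u'" "u \<in> W \<inter> part V 0" "u' \<in> W \<inter> part V 1"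
    using assms unfolding graded_def by blast
  then have "component V 0 w = u" "component V 1 w = u'"
    by (auto intro!: component_eqI)
  then show ?thesis using u by (cases a) auto
qed

lemma parity_sign_space [simp]: "v \<in> sm_space V \<Longrightarrow> parity_sign V v \<in> sm_space V"
  unfolding parity_sign_def by auto

lemma parity_sign_add: "u \<in> sm_space V \<Longrightarrow> v \<in> sm_space V \<Longrightarrow>
    parity_sign V (u + v) = parity_sign V u + parity_sign V v"
  by (simp add: parity_sign_def component_add)

lemma parity_sign_scale: "v \<in> sm_space V \<Longrightarrow> parity_sign V (smul V c v) = smul V c (parity_sign V v)"
  by (simp add: parity_sign_def component_scale vs.scale_right_diff_distrib)

lemma parity_sign_part: "v \<in> part V a \<Longrightarrow> parity_sign V v = (if a = 0 then v else - v)"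
  using component_other[of v 0] component_other[of v 1]
  by (cases a) (auto simp: parity_sign_def)

lemma parity_sign_in_part: "v \<in> part V a \<Longrightarrow> parity_sign V v \<in> part V a"
  by (auto simp: parity_sign_part part_neg)

lemma parity_sign_invol: "v \<in> sm_space V \<Longrightarrow> parity_sign V (parity_sign V v) = v"
proof -
  assume v: "v \<in> sm_space V"
  have "component V 0 (parity_sign V v) = component V 0 v"
    unfolding parity_sign_def using v by (intro component_eqI) (auto intro: part_neg)
  moreover have "component V 1 (parity_sign V v) = - component V 1 v"
    unfolding parity_sign_def using v by (intro component_eqI) (auto intro: part_neg)
  ultimately show ?thesis
    using component_sum_01[OF v] by (simp add: parity_sign_def)
qed

lemma parity_sign_act:
  assumes x: "x \<in> queer_part n a" and v: "v \<in> sm_space V"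
  shows "parity_sign V (act V x v) = smul V (koszul_sign a 1) (act V x (parity_sign V v))"
proof -
  have q: "x \<in> queer n" using x queer_part_subset by auto
  show ?thesis
    using component_act[OF x v, of 0] component_act[OF x v, of 1] v q
    by (cases a) (simp_all add: parity_sign_def act_diff)
qed

end

definition submod :: "nat \<Rightarrow> 'v::ab_group_add supermodule \<Rightarrow> 'v set \<Rightarrow> bool" where
  "submod n V W \<longleftrightarrow> invariant_subspace (queer n) V W \<and> graded V W"

section \<open>Weight spaces and generated submodules\<close>

definition wspace :: "nat \<Rightarrow> (nat \<Rightarrow> complex) \<Rightarrow> 'v::ab_group_add supermodule \<Rightarrow> 'v set" where
  "wspace n lam V = {v \<in> sm_space V. \<forall>i<n. unit_act n V 0 i i v = smul V (lam i) v}"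

definition raising_trivial :: "nat \<Rightarrow> (nat \<Rightarrow> complex) \<Rightarrow> 'v::ab_group_add supermodule \<Rightarrow> bool" where
  "raising_trivial n lam V \<longleftrightarrow>
     (\<forall>v\<in>wspace n lam V. \<forall>a i j. i < j \<longrightarrow> j < n \<longrightarrow> unit_act n V a i j v = 0)"

definition wspace_generates :: "nat \<Rightarrow> (nat \<Rightarrow> complex) \<Rightarrow> 'v::ab_group_add supermodule \<Rightarrow> bool" where
  "wspace_generates n lam V \<longleftrightarrow>
     (\<forall>K. submod n V K \<and> wspace n lam V \<subseteq> K \<longrightarrow> K = sm_space V)"

text \<open>Dual to \<open>wspace_generates\<close>: it makes a homomorphism injective once it is
  injective on the weight space, as generation makes two homomorphisms equal once they agree
  there.\<close>

definition wspace_cogenerates :: "nat \<Rightarrow> (nat \<Rightarrow> complex) \<Rightarrow> 'v::ab_group_add supermodule \<Rightarrow> bool" where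
  "wspace_cogenerates n lam V \<longleftrightarrow>
     (\<forall>K. submod n V K \<and> K \<inter> wspace n lam V \<subseteq> {0} \<longrightarrow> K = {0})"

definition top_degree :: "nat \<Rightarrow> (nat \<Rightarrow> complex) \<Rightarrow> complex" where
  "top_degree n lam = (\<Sum>k<n. - of_nat k * lam k)"

context supermod
begin

lemma submoduleI:
  assumes "vs.subspace W" "W \<subseteq> sm_space V"
    and "\<And>a i j w. i < n \<Longrightarrow> j < n \<Longrightarrow> w \<in> W \<Longrightarrow> X a i j w \<in> W"
    and "\<And>a w. w \<in> W \<Longrightarrow> component V a w \<in> W"
  shows "submod n V W"
  using invariantI[OF assms(1-3)] gradedI[OF assms(1,2,4)] by (simp add: submod_def)

lemma submodule_subspace: "submod n V W \<Longrightarrow> vs.subspace W"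
  and submodule_subset: "submod n V W \<Longrightarrow> W \<subseteq> sm_space V"
  and submodule_act: "submod n V W \<Longrightarrow> x \<in> queer n \<Longrightarrow> w \<in> W \<Longrightarrow> act V x w \<in> W"
  and submodule_component: "submod n V W \<Longrightarrow> w \<in> W \<Longrightarrow> component V a w \<in> W"
  using gradedD by (auto simp: submod_def invariant_subspace_def)

lemma submodule_zero: "submod n V {0}"
  by (rule submoduleI) (auto simp: vs.subspace_def)

lemma submodule_space: "submod n V (sm_space V)"
  by (rule submoduleI) (auto simp: space_subspace)

lemma wspace_space: "v \<in> wspace n lam V \<Longrightarrow> v \<in> sm_space V"
  by (simp add: wspace_def)

lemma wspaceD: "v \<in> wspace n lam V \<Longrightarrow> i < n \<Longrightarrow> X 0 i i v = smul V (lam i) v"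
  by (simp add: wspace_def)

lemma wspace_subspace: "vs.subspace (wspace n lam V)"
  by (rule vs.subspaceI)
    (auto simp: wspace_def act_add act_scale vs.scale_right_distrib)

lemma wspace_X_diag:
  assumes "v \<in> wspace n lam V" "k < n"
  shows "X b k k v \<in> wspace n lam V"
  using assms by (auto simp: wspace_def X_X act_scale)

lemma wspace_component:
  assumes "v \<in> wspace n lam V"
  shows "component V a v \<in> wspace n lam V"
  using assms component_X_even[of v a, symmetric]
  by (auto simp: wspace_def component_scale)

lemma wspace_parity_sign: "v \<in> wspace n lam V \<Longrightarrow> parity_sign V v \<in> wspace n lam V"
  unfolding parity_sign_def
  by (intro vs.subspace_diff[OF wspace_subspace] wspace_component)

text \<open>The action of the even diagonal element with entries -k. The sign makes the unit (i, j)
  of either parity shift the degree by j - i, so that raising operators raise it. On the weight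
  space the eigenvalue is \<open>top_degree\<close>.\<close>

definition degree_op :: "'v \<Rightarrow> 'v" where
  "degree_op v = (\<Sum>k<n. smul V (- of_nat k) (X 0 k k v))"

definition degree_space :: "complex \<Rightarrow> 'v set" where
  "degree_space c = {v \<in> sm_space V. degree_op v = smul V c v}"

lemma degree_op_space [simp]: "v \<in> sm_space V \<Longrightarrow> degree_op v \<in> sm_space V"
  unfolding degree_op_def by (rule space_sum) (auto simp del: vs.scale_minus_left)

lemma degree_op_add: "u \<in> sm_space V \<Longrightarrow> v \<in> sm_space V \<Longrightarrow>
    degree_op (u + v) = degree_op u + degree_op v"
  unfolding degree_op_def by (simp add: act_add vs.scale_right_distrib sum.distrib del: vs.scale_minus_left)

lemma degree_op_scale: "v \<in> sm_space V \<Longrightarrow> degree_op (smul V c v) = smul V c (degree_op v)"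
  unfolding degree_op_def
  by (simp add: act_scale vs.scale_sum_right mult.commute del: vs.scale_minus_left)

lemma degree_op_zero [simp]: "degree_op 0 = 0"
  using degree_op_scale[of 0 0] by simp

lemma degree_op_sum: "(\<And>k. k \<in> F \<Longrightarrow> f k \<in> sm_space V) \<Longrightarrow>
    degree_op (sum f F) = (\<Sum>k\<in>F. degree_op (f k))"
  by (induction F rule: infinite_finite_induct) (auto simp: degree_op_add space_sum)

lemma degree_op_X:
  assumes "v \<in> sm_space V" "i < n" "j < n"
  shows "degree_op (X a i j v) = X a i j (degree_op v) + smul V (of_nat j - of_nat i) (X a i j v)"
proof -
  have "degree_op (X a i j v) = (\<Sum>k<n. smul V (- of_nat k) (X a i j (X 0 k k v))
      + (if k = i then smul V (- of_nat i) (X a i j v) else 0)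
      - (if k = j then smul V (- of_nat j) (X a i j v) else 0))"
    unfolding degree_op_def
  proof (rule sum.cong[OF refl])
    fix k assume "k \<in> {..<n}"
    then show "smul V (- of_nat k) (X 0 k k (X a i j v)) = smul V (- of_nat k) (X a i j (X 0 k k v))
      + (if k = i then smul V (- of_nat i) (X a i j v) else 0)
      - (if k = j then smul V (- of_nat j) (X a i j v) else 0)"
      using X_X[OF assms(1), of k k i j 0 a] assms
      by (auto simp: vs.scale_right_diff_distrib vs.scale_right_distrib simp del: vs.scale_minus_left)
  qed
  also have "\<dots> = (\<Sum>k<n. smul V (- of_nat k) (X a i j (X 0 k k v)))
      + smul V (- of_nat i) (X a i j v) - smul V (- of_nat j) (X a i j v)"
    using assms by (simp add: sum.distrib sum_subtractf sum_negf)
  also have "(\<Sum>k<n. smul V (- of_nat k) (X a i j (X 0 k k v))) = X a i j (degree_op v)"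
    unfolding degree_op_def using assms
    by (subst act_sum) (auto simp: act_scale simp del: vs.scale_minus_left intro!: sum.cong)
  finally show ?thesis by (simp add: algebra_simps)
qed

lemma degree_space_X:
  assumes "v \<in> degree_space c" "i < n" "j < n"
  shows "X a i j v \<in> degree_space (c + of_nat j - of_nat i)"
  using assms by (auto simp: degree_space_def degree_op_X act_scale algebra_simps)

lemma degree_space_subspace: "vs.subspace (degree_space c)"
  by (rule vs.subspaceI)
    (auto simp: degree_space_def degree_op_add degree_op_scale vs.scale_right_distrib mult.commute)

lemma wspace_degree: "v \<in> wspace n lam V \<Longrightarrow> v \<in> degree_space (top_degree n lam)"
  by (auto simp: wspace_def degree_space_def degree_op_def top_degree_def vs.scale_sum_left)

text \<open>Independence of eigenspaces: applying \<open>degree_op\<close> minus the eigenvalue of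
  one summand removes that summand and multiplies \<open>w\<close> by a non-zero number, so
  induction on the number of summands applies.\<close>

lemma degree_sum_zero:
  assumes "finite F" "\<And>k. k \<in> F \<Longrightarrow> u k \<in> degree_space (c k)"
    and "\<And>k. k \<in> F \<Longrightarrow> c k \<noteq> d" and "w \<in> degree_space d" and "w = (\<Sum>k\<in>F. u k)"
  shows "w = 0"
  using assms
proof (induction F arbitrary: u w rule: finite_induct)
  case (insert k F)
  have u: "u j \<in> sm_space V" "degree_op (u j) = smul V (c j) (u j)" if "j \<in> insert k F" for j
    using insert.prems(1)[OF that] by (auto simp: degree_space_def)
  have "degree_op w = smul V d w" using insert.prems by (simp add: degree_space_def)
  moreover have "degree_op w = (\<Sum>j\<in>insert k F. smul V (c j) (u j))"
    unfolding insert.prems(4) using u by (subst degree_op_sum) (auto intro!: sum.cong)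
  ultimately have eq: "smul V d w = smul V (c k) (u k) + (\<Sum>j\<in>F. smul V (c j) (u j))"
    using insert.hyps by simp
  have "smul V (d - c k) w = smul V d w - smul V (c k) (\<Sum>j\<in>insert k F. u j)"
    using insert.prems(4) by (simp add: vs.scale_left_diff_distrib)
  also have "\<dots> = (\<Sum>j\<in>F. smul V (c j - c k) (u j))"
    unfolding eq using insert.hyps
    by (simp add: vs.scale_right_distrib vs.scale_left_diff_distrib vs.scale_sum_right sum_subtractf)
  finally have "smul V (d - c k) w = (\<Sum>j\<in>F. smul V (c j - c k) (u j))" .
  moreover have "smul V (c j - c k) (u j) \<in> degree_space (c j)" if "j \<in> F" for j
    using insert.prems(1) that by (auto intro: vs.subspace_scale[OF degree_space_subspace])
  moreover have "smul V (d - c k) w \<in> degree_space d"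
    using insert.prems(3) by (rule vs.subspace_scale[OF degree_space_subspace])
  ultimately have "smul V (d - c k) w = 0"
    using insert.IH[of "\<lambda>j. smul V (c j - c k) (u j)" "smul V (d - c k) w"] insert.prems(2) by simp
  then show ?case using insert.prems(2)[of k] by auto
qed simp

end

text \<open>The submodule generated by \<open>T\<close> is the closure of \<open>T\<close> under the lowering operators.\<close>

locale singular_subspace = supermod +
  fixes lam :: "nat \<Rightarrow> complex" and T :: "'a set"
  assumes T_subspace: "vs.subspace T"
    and T_wspace: "T \<subseteq> wspace n lam V"
    and T_diag: "\<And>v k. v \<in> T \<Longrightarrow> k < n \<Longrightarrow> X 1 k k v \<in> T"
    and T_component: "\<And>v a. v \<in> T \<Longrightarrow> component V a v \<in> T"
    and T_raising: "\<And>v a i j. v \<in> T \<Longrightarrow> i < j \<Longrightarrow> j < n \<Longrightarrow> X a i j v = 0"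
begin

inductive_set generated :: "'a set" where
  base: "t \<in> T \<Longrightarrow> t \<in> generated"
| add: "u \<in> generated \<Longrightarrow> w \<in> generated \<Longrightarrow> u + w \<in> generated"
| scale: "w \<in> generated \<Longrightarrow> smul V c w \<in> generated"
| lower: "w \<in> generated \<Longrightarrow> j < i \<Longrightarrow> i < n \<Longrightarrow> X a i j w \<in> generated"

lemma generated_space: "w \<in> generated \<Longrightarrow> w \<in> sm_space V"
  by (induction rule: generated.induct) (use T_wspace wspace_space in auto)

lemma generated_subspace: "vs.subspace generated"
  by (rule vs.subspaceI)
    (auto intro: generated.intros vs.subspace_0[OF T_subspace])

text \<open>Moving a raising or diagonal operator past a lowering operator leaves commutators, which
  are single units acting on the previously generated vector; so induction on the generation gives
  closure without ordered monomials.\<close>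

lemma generated_raise: "w \<in> generated \<Longrightarrow> k \<le> l \<Longrightarrow> l < n \<Longrightarrow> X b k l w \<in> generated"
proof (induction arbitrary: b k l rule: generated.induct)
  case (base t)
  show ?case
  proof (cases "k = l")
    case True
    have "X 0 l l t \<in> T"
      using base wspaceD[of t lam l] T_wspace vs.subspace_scale[OF T_subspace] by auto
    then show ?thesis
      using True T_diag base by (cases b) (auto intro: generated.base)
  next
    case False
    then show ?thesis
      using base T_raising vs.subspace_0[OF generated_subspace] by auto
  qed
next
  case (add u w)
  then show ?case by (auto simp: act_add generated_space intro: generated.add)
next
  case (scale w c)
  then show ?case by (auto simp: act_scale generated_space intro: generated.scale)
next
  case (lower w j i a)
  \<comment> \<open>The commutators are units with arbitrary indices: the induction hypothesis
    covers \<open>p \<le> q\<close>, the closure rule covers \<open>q < p\<close>.\<close>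
  have any: "X b' p q w \<in> generated" if "p < n" "q < n" for b' p q
    using that lower.IH generated.lower[OF lower.hyps(1)] by (cases "p \<le> q") auto
  have "X b k l (X a i j w) = smul V (koszul_sign b a) (X a i j (X b k l w))
    + smul V (of_bool (l = i)) (X (b + a) k j w)
    - smul V (koszul_sign b a * of_bool (j = k)) (X (b + a) i l w)"
    using lower by (intro X_X generated_space) auto
  also have "\<dots> \<in> generated"
    using lower any by (intro vs.subspace_diff[OF generated_subspace] generated.add generated.scale)
      (auto intro: generated.lower)
  finally show ?case .
qed

lemma generated_X: "w \<in> generated \<Longrightarrow> i < n \<Longrightarrow> j < n \<Longrightarrow> X a i j w \<in> generated"
  using generated_raise generated.lower by (cases "i \<le> j") auto

lemma generated_component: "w \<in> generated \<Longrightarrow> component V b w \<in> generated"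
proof (induction arbitrary: b rule: generated.induct)
  case (lower w j i a)
  have "component V (a + (a + b)) (X a i j w) = X a i j (component V (a + b) w)"
    using lower by (intro component_X generated_space)
  then show ?case using lower by (simp add: generated.lower)
qed (auto simp: component_add component_scale generated_space intro: generated.intros T_component)

lemma submodule_generated: "submod n V generated"
  using generated_subspace generated_space generated_X generated_component
  by (intro submoduleI) auto

text \<open>Each lowering step drops the degree, so the part of top degree never leaves
  \<open>T\<close>. The sum is asserted for all large bounds so that two expansions can be added
  termwise.\<close>

lemma generated_expansion:
  assumes "w \<in> generated"
  shows "\<exists>u K. u 0 \<in> T \<and> (\<forall>k. u k \<in> degree_space (top_degree n lam - of_nat k)) \<and>
    (\<forall>K'\<ge>K. w = (\<Sum>k\<le>K'. u k))"
  using assms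
proof (induction rule: generated.induct)
  case (base t)
  then have "t \<in> degree_space (top_degree n lam)" using wspace_degree T_wspace by auto
  moreover have "(\<Sum>k\<le>K'. if k = 0 then t else 0) = t" for K' :: nat
    by (induction K') auto
  ultimately show ?case
    using base by (intro exI[of _ "\<lambda>k. if k = 0 then t else 0"] exI[of _ 0])
      (auto intro: vs.subspace_0[OF degree_space_subspace])
next
  case (add v w)
  then obtain f K g K' where
    "f 0 \<in> T" "\<forall>k. f k \<in> degree_space (top_degree n lam - of_nat k)" "\<forall>M\<ge>K. v = (\<Sum>k\<le>M. f k)"
    "g 0 \<in> T" "\<forall>k. g k \<in> degree_space (top_degree n lam - of_nat k)" "\<forall>M\<ge>K'. w = (\<Sum>k\<le>M. g k)"
    by blast
  then show ?case
    by (intro exI[of _ "\<lambda>k. f k + g k"] exI[of _ "max K K'"])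
      (auto simp: sum.distrib intro: vs.subspace_add[OF T_subspace]
        vs.subspace_add[OF degree_space_subspace])
next
  case (scale w c)
  then obtain f K where
    "f 0 \<in> T" "\<forall>k. f k \<in> degree_space (top_degree n lam - of_nat k)" "\<forall>M\<ge>K. w = (\<Sum>k\<le>M. f k)"
    by blast
  then show ?case
    by (intro exI[of _ "\<lambda>k. smul V c (f k)"] exI[of _ K])
      (auto simp: vs.scale_sum_right intro: vs.subspace_scale[OF T_subspace]
        vs.subspace_scale[OF degree_space_subspace])
next
  case (lower w j i a)
  then obtain f K where f:
    "f 0 \<in> T" "\<forall>k. f k \<in> degree_space (top_degree n lam - of_nat k)" "\<forall>M\<ge>K. w = (\<Sum>k\<le>M. f k)"
    by blast
  \<comment> \<open>The unit (i, j) with j < i lowers the degree by p > 0, hence the index shift by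
    p; in particular the new top term is 0.\<close>
  define p where "p = i - j"
  define g where "g k = (if p \<le> k then X a i j (f (k - p)) else 0)" for k
  have "g 0 = 0" using lower by (simp add: g_def p_def)
  then have "g 0 \<in> T" using vs.subspace_0[OF T_subspace] by simp
  moreover have "g k \<in> degree_space (top_degree n lam - of_nat k)" for k
  proof (cases "p \<le> k")
    case True
    have "top_degree n lam - of_nat (k - p) + of_nat j - of_nat i = top_degree n lam - of_nat k"
      using lower True by (simp add: p_def of_nat_diff)
    then show ?thesis
      using degree_space_X[of "f (k - p)" _ i j a] f lower True unfolding g_def by (metis less_trans)
  qed (auto simp: g_def vs.subspace_0[OF degree_space_subspace])
  moreover have "X a i j w = (\<Sum>k\<le>M. g k)" if "M \<ge> K + p" for M
  proof -
    have fs: "f k \<in> sm_space V" for k using f by (simp add: degree_space_def)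
    have "(\<Sum>k\<le>M. g k) = (\<Sum>k\<in>{p..M}. g k)"
      by (rule sum.mono_neutral_right) (auto simp: g_def)
    also have "\<dots> = (\<Sum>k\<in>{0..M - p}. g (k + p))"
      using that by (intro sum.reindex_bij_witness[of _ "\<lambda>k. k + p" "\<lambda>k. k - p"]) auto
    also have "\<dots> = (\<Sum>k\<le>M - p. X a i j (f k))"
      by (simp add: g_def atLeast0AtMost)
    also have "\<dots> = X a i j (\<Sum>k\<le>M - p. f k)"
      using fs by (simp add: act_sum)
    finally show ?thesis using f(3)[rule_format, of "M - p"] that by simp
  qed
  ultimately show ?case by blast
qed

text \<open>Only the top term \<open>u 0\<close> of an expansion has the degree of the weight space,
  so everything else cancels. Generating a submodule thus adds no vectors of weight
  \<open>lam\<close>.\<close>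

lemma generated_wspace:
  assumes "w \<in> generated" "w \<in> wspace n lam V"
  shows "w \<in> T"
proof -
  obtain u K where u: "u 0 \<in> T" "\<forall>k. u k \<in> degree_space (top_degree n lam - of_nat k)"
    "\<forall>K'\<ge>K. w = (\<Sum>k\<le>K'. u k)"
    using generated_expansion[OF assms(1)] by blast
  have "w - u 0 = 0"
  proof (rule degree_sum_zero)
    show "w - u 0 = (\<Sum>k\<in>{1..K}. u k)"
      using u(3)[rule_format, of K]
      by (simp add: atLeast0AtMost[symmetric] sum.atLeast_Suc_atMost algebra_simps)
    show "w - u 0 \<in> degree_space (top_degree n lam)"
      using u(1) assms(2) T_wspace wspace_degree by (blast intro: vs.subspace_diff[OF degree_space_subspace])
    show "u k \<in> degree_space (top_degree n lam - of_nat k)" for k using u(2) by simp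
  qed auto
  then show ?thesis using u by simp
qed

text \<open>All degrees in an expansion are the top degree minus a natural number, never the top
  degree plus a positive one.\<close>

lemma generated_bounded:
  assumes "w \<in> generated" "w \<in> degree_space (top_degree n lam + of_nat p)" "p > 0"
  shows "w = 0"
proof -
  obtain u K where u: "u 0 \<in> T" "\<forall>k. u k \<in> degree_space (top_degree n lam - of_nat k)"
    "\<forall>K'\<ge>K. w = (\<Sum>k\<le>K'. u k)"
    using generated_expansion[OF assms(1)] by blast
  have "- of_nat k \<noteq> (of_nat p :: complex)" for k
  proof
    assume "- of_nat k = (of_nat p :: complex)"
    then have "of_nat (k + p) = (0::complex)" by (simp add: add_eq_0_iff)
    then show False using assms(3) by (simp only: of_nat_eq_0_iff)
  qed
  then have "top_degree n lam - of_nat k \<noteq> top_degree n lam + of_nat p" for k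
    by (metis add_left_cancel diff_conv_add_uminus)
  then show ?thesis
    using u assms(2) by (intro degree_sum_zero[of "{..K}" u "\<lambda>k. top_degree n lam - of_nat k"]) auto
qed

end

section \<open>Homomorphisms\<close>

locale sm_morphism = V: supermod n V + W: supermod n W
  for n and V :: "'v::ab_group_add supermodule" and W :: "'w::ab_group_add supermodule" +
  fixes f
  assumes hom: "f \<in> sm_hom n V W"
begin

lemma map_add: "u \<in> sm_space V \<Longrightarrow> v \<in> sm_space V \<Longrightarrow> f (u + v) = f u + f v"
  and map_scale: "v \<in> sm_space V \<Longrightarrow> f (smul V c v) = smul W c (f v)"
  and map_part: "v \<in> part V a \<Longrightarrow> f v \<in> part W a"
  and map_act: "x \<in> queer n \<Longrightarrow> v \<in> sm_space V \<Longrightarrow> f (act V x v) = act W x (f v)"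
  using hom by (auto simp: sm_hom_def)

lemma map_zero [simp]: "f 0 = 0"
  using map_scale[of 0 0] by simp

lemma map_neg: "v \<in> sm_space V \<Longrightarrow> f (- v) = - f v"
  using map_scale[of v "-1"] by simp

lemma map_diff: "u \<in> sm_space V \<Longrightarrow> v \<in> sm_space V \<Longrightarrow> f (u - v) = f u - f v"
  using map_add[of u "- v"] by (auto simp: map_neg)

lemma map_space [simp]: "v \<in> sm_space V \<Longrightarrow> f v \<in> sm_space W"
  by (metis V.component_in V.component_space V.component_sum_01 W.part_subset W.space_add map_add map_part)

lemma map_component: "v \<in> sm_space V \<Longrightarrow> component W a (f v) = f (component V a v)"
  by (rule W.component_eqI)
    (auto intro: map_part V.component_rest simp flip: map_diff)

lemma map_wspace: "v \<in> wspace n lam V \<Longrightarrow> f v \<in> wspace n lam W"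
  by (auto simp: wspace_def simp flip: map_act map_scale)

lemma submodule_preimage:
  assumes "submod n W K"
  shows "submod n V {v \<in> sm_space V. f v \<in> K}"
  using assms W.submodule_subspace[OF assms]
  by (intro V.submoduleI V.vs.subspaceI)
    (auto simp: map_add map_scale map_act W.submodule_act
      W.vs.subspace_0 W.vs.subspace_add W.vs.subspace_scale W.submodule_component simp flip: map_component)

lemma submodule_image:
  assumes "submod n V K"
  shows "submod n W (f ` K)"
proof (intro W.submoduleI W.vs.subspaceI)
  note s = V.submodule_subset[OF assms] and sub = V.submodule_subspace[OF assms]
  show "0 \<in> f ` K" using V.vs.subspace_0[OF sub] by (auto intro!: image_eqI[of _ _ 0])
  show "x + y \<in> f ` K" if xy: "x \<in> f ` K" "y \<in> f ` K" for x y
  proof -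
    obtain u v where "u \<in> K" "v \<in> K" "x = f u" "y = f v" using xy by auto
    then show ?thesis using s V.vs.subspace_add[OF sub] by (auto simp: map_add[symmetric] subset_iff)
  qed
  show "smul W c x \<in> f ` K" if "x \<in> f ` K" for c x
    using that s V.vs.subspace_scale[OF sub] by (auto simp: subset_iff simp flip: map_scale)
  show "f ` K \<subseteq> sm_space W" using s by auto
  show "unit_act n W a i j x \<in> f ` K" if "x \<in> f ` K" for a i j x
    using that s V.submodule_act[OF assms] by (auto simp: subset_iff simp flip: map_act)
  show "component W a x \<in> f ` K" if "x \<in> f ` K" for a x
    using that s V.submodule_component[OF assms] by (auto simp: subset_iff map_component)
qed

lemma submodule_kernel: "submod n V {v \<in> sm_space V. f v = 0}"
  using submodule_preimage[OF W.submodule_zero] by simp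

lemma submodule_equalizer:
  assumes "g \<in> sm_hom n V W"
  shows "submod n V {v \<in> sm_space V. f v = g v}"
proof -
  interpret g: sm_morphism n V W g by unfold_locales (rule assms)
  show ?thesis
    by (intro V.submoduleI V.vs.subspaceI)
      (auto simp: map_add map_scale map_act g.map_add g.map_scale g.map_act
        simp flip: map_component g.map_component)
qed

text \<open>Two homomorphisms agree on a graded submodule, and this one contains the generating
  weight space.\<close>

lemma eq_from_wspace:
  assumes "g \<in> sm_hom n V W" "wspace_generates n lam V"
    and "\<And>v. v \<in> wspace n lam V \<Longrightarrow> f v = g v" and "v \<in> sm_space V"
  shows "f v = g v"
  using submodule_equalizer[OF assms(1)] assms(2-) V.wspace_space
  unfolding wspace_generates_def by blast

end

lemma sm_morphismI: "is_supermodule n V \<Longrightarrow> is_supermodule n W \<Longrightarrow> f \<in> sm_hom n V W \<Longrightarrow>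
    sm_morphism n V W f"
  by (simp add: sm_morphism_def sm_morphism_axioms_def supermod_def)

lemma sm_homI:
  assumes "is_supermodule n V" "is_supermodule n W"
    and add: "\<And>u v. u \<in> sm_space V \<Longrightarrow> v \<in> sm_space V \<Longrightarrow> f (u + v) = f u + f v"
    and scale: "\<And>c v. v \<in> sm_space V \<Longrightarrow> f (smul V c v) = smul W c (f v)"
    and part: "\<And>a v. v \<in> part V a \<Longrightarrow> f v \<in> part W a"
    and X: "\<And>a i j v. i < n \<Longrightarrow> j < n \<Longrightarrow> v \<in> sm_space V \<Longrightarrow>
      f (unit_act n V a i j v) = unit_act n W a i j (f v)"
  shows "f \<in> sm_hom n V W"
proof -
  interpret V: supermod n V by unfold_locales (rule assms)
  interpret W: supermod n W by unfold_locales (rule assms)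
  have space: "f v \<in> sm_space W" if "v \<in> sm_space V" for v
    using that add[of "component V 0 v" "component V 1 v"] part
    by (metis V.component_in V.component_space V.component_sum_01 W.part_subset W.space_add)
  have "f (act V x v) = act W x (f v)" if x: "x \<in> queer n" and v: "v \<in> sm_space V" for x v
    using x
  proof (induction x rule: queer_induct)
    case zero
    have "f 0 = 0" using scale[of 0 0] by simp
    then show ?case using v space by (simp add: V.act_zero_mat W.act_zero_mat)
  qed (use v space in \<open>simp_all add: X V.act_add_mat W.act_add_mat V.act_smult_mat W.act_smult_mat
      add scale queer_add\<close>)
  then show ?thesis using assms by (simp add: sm_hom_def)
qed

lemma sm_hom_comp:
  assumes "is_supermodule n U" "is_supermodule n V" "is_supermodule n W"
    and "f \<in> sm_hom n U V" "g \<in> sm_hom n V W"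
  shows "(\<lambda>x. g (f x)) \<in> sm_hom n U W"
proof -
  interpret f: sm_morphism n U V f by (rule sm_morphismI) fact+
  interpret g: sm_morphism n V W g by (rule sm_morphismI) fact+
  show ?thesis
    unfolding sm_hom_def
    by (auto simp: f.map_add g.map_add f.map_scale g.map_scale f.map_act g.map_act
        intro: f.map_part g.map_part)
qed

lemma sm_hom_scale:
  assumes "is_supermodule n V" "is_supermodule n W" and "f \<in> sm_hom n V W"
  shows "(\<lambda>x. smul W c (f x)) \<in> sm_hom n V W"
proof -
  interpret f: sm_morphism n V W f by (rule sm_morphismI) fact+
  show ?thesis
    unfolding sm_hom_def
    by (auto simp: f.map_add f.map_scale f.map_act f.W.vs.scale_right_distrib f.W.act_scale mult.commute
        intro: f.map_part f.W.part_scale)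
qed

section \<open>Fibre products\<close>

text \<open>Serves two purposes: over \<open>L\<close> it is the pullback in the Baer sum, over the
  zero module it is the direct sum.\<close>

locale fibre_product =
  p: sm_morphism n V X p + q: sm_morphism n W X q
  for n and V :: "'v::ab_group_add supermodule" and W :: "'w::ab_group_add supermodule"
    and X :: "'x::ab_group_add supermodule" and p q
begin

abbreviation P where "P \<equiv> pullback p q V W"

lemma P_smul: "smul P c (v, w) = (smul V c v, smul W c w)"
  and P_part: "(v, w) \<in> part P a \<longleftrightarrow> v \<in> part V a \<and> w \<in> part W a \<and> p v = q w"
  and P_act: "act P x (v, w) = (act V x v, act W x w)"
  by (auto simp: pullback_def)

lemma P_space: "(v, w) \<in> sm_space P \<longleftrightarrow> v \<in> sm_space V \<and> w \<in> sm_space W \<and> p v = q w"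
proof
  assume "(v, w) \<in> sm_space P"
  then obtain v0 w0 v1 w1 where *: "(v0, w0) \<in> part P 0" "(v1, w1) \<in> part P 1" "v = v0 + v1" "w = w0 + w1"
    unfolding sm_space_def by auto
  then show "v \<in> sm_space V \<and> w \<in> sm_space W \<and> p v = q w"
    using p.V.part_subset q.V.part_subset by (auto simp: P_part p.map_add q.map_add)
next
  assume *: "v \<in> sm_space V \<and> w \<in> sm_space W \<and> p v = q w"
  then have "(component V a v, component W a w) \<in> part P a" for a
    by (auto simp: P_part simp flip: p.map_component q.map_component)
  moreover have "(v, w) = (component V 0 v, component W 0 w) + (component V 1 v, component W 1 w)"
    using * p.V.component_sum_01 q.V.component_sum_01 by simp
  ultimately show "(v, w) \<in> sm_space P" unfolding sm_space_def by blast
qed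

lemma P_vector_space: "vector_space (smul P)"
  by unfold_locales
    (auto simp: pullback_def p.V.vs.scale_right_distrib q.V.vs.scale_right_distrib
      p.V.vs.scale_left_distrib q.V.vs.scale_left_distrib)

lemma P_supermodule: "is_supermodule n P"
  unfolding is_supermodule_def
proof (intro conjI allI ballI)
  interpret P: vector_space "smul P" by (rule P_vector_space)
  show "vector_space (smul P)" by (rule P_vector_space)
  show "P.subspace (part P a)" for a
  proof (rule P.subspaceI)
    show "0 \<in> part P a" by (simp add: zero_prod_def P_part)
    show "x + y \<in> part P a" if "x \<in> part P a" "y \<in> part P a" for x y
      using that by (cases x; cases y)
        (auto simp: P_part p.V.part_add q.V.part_add
          p.map_add[OF p.V.part_subset p.V.part_subset] q.map_add[OF q.V.part_subset q.V.part_subset])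
    show "smul P c x \<in> part P a" if "x \<in> part P a" for c x
      using that by (cases x)
        (auto simp: P_part P_smul p.V.part_scale q.V.part_scale
          p.map_scale[OF p.V.part_subset] q.map_scale[OF q.V.part_subset])
  qed
  show "part P 0 \<inter> part P 1 = {0}"
    using p.V.part_disjoint[of _ 0] q.V.part_disjoint[of _ 0] 
    by (auto simp: zero_prod_def P_part)
  show "act P x v \<in> part P (a + b)" if "x \<in> queer_part n a" "v \<in> part P b" for a b x v
  proof -
    have "x \<in> queer n" using that queer_part_subset by auto
    then show ?thesis
      using that by (cases v)
        (auto simp: P_part P_act p.V.act_part q.V.act_part
          p.map_act[OF _ p.V.part_subset] q.map_act[OF _ q.V.part_subset])
  qed
  show "act P x (u + v) = act P x u + act P x v"
    if "x \<in> queer n" "u \<in> sm_space P" "v \<in> sm_space P" for x u v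
    using that by (cases u; cases v) (auto simp: P_space P_act p.V.act_add q.V.act_add)
  show "act P x (smul P c v) = smul P c (act P x v)" if "x \<in> queer n" "v \<in> sm_space P" for x c v
    using that by (cases v) (auto simp: P_space P_act P_smul p.V.act_scale q.V.act_scale)
  show "act P (x + y) v = act P x v + act P y v"
    if "x \<in> queer n" "y \<in> queer n" "v \<in> sm_space P" for x y v
    using that by (cases v) (auto simp: P_space P_act p.V.act_add_mat q.V.act_add_mat)
  show "act P (c \<cdot>\<^sub>m x) v = smul P c (act P x v)" if "x \<in> queer n" "v \<in> sm_space P" for x c v
    using that by (cases v) (auto simp: P_space P_act P_smul p.V.act_smult_mat q.V.act_smult_mat)
  show "act P (super_bracket a b x y) v
      = act P x (act P y v) - smul P (koszul_sign a b) (act P y (act P x v))"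
    if "x \<in> queer_part n a" "y \<in> queer_part n b" "v \<in> sm_space P" for a b x y v
    using that by (cases v) (simp add: P_space P_act P_smul p.V.act_bracket q.V.act_bracket)
qed

sublocale P: supermod n P
  by unfold_locales (rule P_supermodule)

lemma P_component:
  assumes "(v, w) \<in> sm_space P"
  shows "component P a (v, w) = (component V a v, component W a w)"
proof (rule P.component_eqI)
  have *: "v \<in> sm_space V" "w \<in> sm_space W" "p v = q w" using assms by (auto simp: P_space)
  then show "(component V a v, component W a w) \<in> part P a"
    by (simp add: P_part flip: p.map_component q.map_component)
  then have "p (component V a v) = q (component W a w)" by (simp add: P_part)
  then show "(v, w) - (component V a v, component W a w) \<in> part P (a + 1)"
    using * by (simp add: P_part p.V.component_rest q.V.component_rest p.map_diff q.map_diff)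
qed

lemma P_wspace: "(v, w) \<in> wspace n lam P \<longleftrightarrow> v \<in> wspace n lam V \<and> w \<in> wspace n lam W \<and> p v = q w"
  by (auto simp: wspace_def P_space P_act P_smul)

lemma P_raising_trivial:
  "raising_trivial n lam V \<Longrightarrow> raising_trivial n lam W \<Longrightarrow> raising_trivial n lam P"
  by (auto simp: raising_trivial_def P_wspace P_act zero_prod_def)

lemma fst_hom: "fst \<in> sm_hom n P V"
  by (auto simp: sm_hom_def P_act P_smul P_part)

end

definition zero_supermodule :: "complex supermodule" where
  "zero_supermodule = \<lparr>smul = (*), part = \<lambda>_. {0}, act = \<lambda>_ _. 0\<rparr>"

definition zero_map :: "'a \<Rightarrow> complex" where
  "zero_map v = 0"

lemma zero_map [simp]: "zero_map v = 0"
  by (simp add: zero_map_def)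

lemma zero_supermodule: "is_supermodule n zero_supermodule"
proof -
  have v: "vector_space ((*) :: complex \<Rightarrow> _)"
    by unfold_locales (auto simp: algebra_simps)
  interpret vector_space "(*) :: complex \<Rightarrow> _" by (rule v)
  show ?thesis
    by (simp add: is_supermodule_def zero_supermodule_def v subspace_single_0)
qed

lemma direct_sum:
  assumes "is_supermodule n V" "is_supermodule n W"
  shows "fibre_product n V W zero_supermodule zero_map zero_map"
  unfolding fibre_product_def using assms zero_supermodule
  by (auto intro!: sm_morphismI simp: sm_hom_def zero_supermodule_def)

section \<open>Extending homomorphisms from the highest weight space\<close>

text \<open>Parity-preserving homomorphisms over the Cartan subsuperalgebra; its even elements act
  by the same scalars on both weight spaces, so only the odd ones give a condition.\<close>

definition cartan_hom :: "nat \<Rightarrow> (nat \<Rightarrow> complex) \<Rightarrow> 'v::ab_group_add supermodule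
    \<Rightarrow> 'w::ab_group_add supermodule \<Rightarrow> ('v \<Rightarrow> 'w) set" where
  "cartan_hom n lam V W = {f.
     (\<forall>u\<in>wspace n lam V. \<forall>v\<in>wspace n lam V. f (u + v) = f u + f v) \<and>
     (\<forall>c. \<forall>v\<in>wspace n lam V. f (smul V c v) = smul W c (f v)) \<and>
     (\<forall>v\<in>wspace n lam V. f v \<in> wspace n lam W) \<and>
     (\<forall>a. \<forall>v\<in>wspace n lam V. v \<in> part V a \<longrightarrow> f v \<in> part W a) \<and>
     (\<forall>k<n. \<forall>v\<in>wspace n lam V. f (unit_act n V 1 k k v) = unit_act n W 1 k k (f v))}"

lemma cartan_homD:
  assumes "f \<in> cartan_hom n lam V W" "v \<in> wspace n lam V"
  shows "u \<in> wspace n lam V \<Longrightarrow> f (u + v) = f u + f v"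
    and "f (smul V c v) = smul W c (f v)"
    and "f v \<in> wspace n lam W"
    and "v \<in> part V a \<Longrightarrow> f v \<in> part W a"
    and "k < n \<Longrightarrow> f (unit_act n V 1 k k v) = unit_act n W 1 k k (f v)"
  using assms by (simp_all add: cartan_hom_def)

lemma cartan_hom_component:
  assumes "is_supermodule n V" "is_supermodule n W" "f \<in> cartan_hom n lam V W" "v \<in> wspace n lam V"
  shows "component W a (f v) = f (component V a v)"
proof -
  interpret V: supermod n V by unfold_locales (rule assms)
  interpret W: supermod n W by unfold_locales (rule assms)
  let ?c = "component V a v" and ?d = "v - component V a v"
  have c: "?c \<in> wspace n lam V" "?d \<in> wspace n lam V"
    using assms(4) V.wspace_component V.vs.subspace_diff[OF V.wspace_subspace] by auto
  have "f v = f ?c + f ?d" using cartan_homD(1)[OF assms(3) c(2,1)] by simp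
  moreover have "f ?c \<in> part W a" "f ?d \<in> part W (a + 1)"
    using cartan_homD(4)[OF assms(3) c(1)] cartan_homD(4)[OF assms(3) c(2)] V.component_rest V.wspace_space[OF assms(4)] by auto
  ultimately show ?thesis by (intro W.component_eqI) auto
qed

text \<open>The submodule of \<open>M \<oplus> V\<close> generated by the graph of \<open>f\<close> is the graph of the extension.\<close>

theorem cartan_hom_extends:
  assumes M: "is_supermodule n M" "raising_trivial n lam M" "wspace_generates n lam M"
    and V: "is_supermodule n V" "raising_trivial n lam V" "wspace_cogenerates n lam V"
    and f: "f \<in> cartan_hom n lam M V"
  shows "\<exists>F\<in>sm_hom n M V. \<forall>v\<in>wspace n lam M. F v = f v"
proof -
  interpret M: supermod n M by unfold_locales (rule M)
  interpret V: supermod n V by unfold_locales (rule V)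
  interpret D: fibre_product n M V zero_supermodule zero_map zero_map
    by (rule direct_sum[OF M(1) V(1)])
  define T where "T = (\<lambda>v. (v, f v)) ` wspace n lam M"
  note f' = cartan_homD[OF f]
  have f0: "f 0 = 0"
    using f'(2)[OF M.vs.subspace_0[OF M.wspace_subspace], of 0]
    by (simp only: M.vs.scale_zero_left V.vs.scale_zero_left)
  have TD: "(v, w) \<in> T \<longleftrightarrow> v \<in> wspace n lam M \<and> w = f v" for v w
    by (auto simp: T_def)
  have Tw: "T \<subseteq> wspace n lam D.P"
    using f'(3) by (auto simp: T_def D.P_wspace)
  interpret S: singular_subspace n D.P lam T
  proof unfold_locales
    show "D.P.vs.subspace T"
    proof (rule D.P.vs.subspaceI)
      show "0 \<in> T" using f0 M.vs.subspace_0[OF M.wspace_subspace] by (simp add: TD zero_prod_def)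
      show "x + y \<in> T" if "x \<in> T" "y \<in> T" for x y
        using that f'(1) M.vs.subspace_add[OF M.wspace_subspace] by (cases x; cases y) (simp add: TD)
      show "smul D.P c x \<in> T" if "x \<in> T" for c x
        using that f'(2) M.vs.subspace_scale[OF M.wspace_subspace] by (cases x) (simp add: TD D.P_smul)
    qed
    show "T \<subseteq> wspace n lam D.P" by (rule Tw)
    show "unit_act n D.P 1 k k v \<in> T" if "v \<in> T" "k < n" for v k
      using that f'(5) M.wspace_X_diag by (cases v) (simp add: TD D.P_act)
    show "component D.P a v \<in> T" if "v \<in> T" for v a
    proof -
      have "v \<in> sm_space D.P" using that Tw D.P.wspace_space by blast
      then show ?thesis
        using that M.wspace_component cartan_hom_component[OF M(1) V(1) f]
        by (cases v) (simp add: TD D.P_component)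
    qed
    show "unit_act n D.P a i j v = 0" if "v \<in> T" "i < j" "j < n" for v a i j
      using that Tw D.P_raising_trivial[OF M(2) V(2)] unfolding raising_trivial_def by blast
  qed
  define G where "G = S.generated"
  have G: "submod n D.P G" "T \<subseteq> G" and GT: "x \<in> G \<Longrightarrow> x \<in> wspace n lam D.P \<Longrightarrow> x \<in> T" for x
    using S.submodule_generated S.generated_wspace S.generated.base by (auto simp: G_def)
  note Gsub = D.P.submodule_subspace[OF G(1)] and Gsp = D.P.submodule_subset[OF G(1)]
  have Gadd: "(v + v', w + w') \<in> G" if "(v, w) \<in> G" "(v', w') \<in> G" for v v' w w'
    using D.P.vs.subspace_add[OF Gsub that] by simp
  have Gdiff: "(v - v', w - w') \<in> G" if "(v, w) \<in> G" "(v', w') \<in> G" for v v' w w'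
    using D.P.vs.subspace_diff[OF Gsub that] by simp
  have Gscale: "(smul M c v, smul V c w) \<in> G" if "(v, w) \<in> G" for v w c
    using D.P.vs.subspace_scale[OF Gsub that] by (simp add: D.P_smul)
  have Gact: "(act M x v, act V x w) \<in> G" if "(v, w) \<in> G" "x \<in> queer n" for v w x
    using D.P.submodule_act[OF G(1) that(2,1)] by (simp add: D.P_act)
  have Gcomp: "(component M a v, component V a w) \<in> G" if "(v, w) \<in> G" for v w a
    using D.P.submodule_component[OF G(1) that] that Gsp by (subst (asm) D.P_component) auto
  have G0: "(0, 0) \<in> G" using D.P.vs.subspace_0[OF Gsub] by (simp add: zero_prod_def)
  have Gspace: "v \<in> sm_space M \<and> w \<in> sm_space V" if "(v, w) \<in> G" for v w
    using that Gsp by (auto simp: D.P_space)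
  \<comment> \<open>\<open>K\<close> measures the failure of \<open>G\<close> to be single-valued.
    Inside the weight space \<open>G\<close> is the graph of \<open>f\<close>, so \<open>K\<close>
    meets the weight space only in \<open>f 0 = 0\<close>, and cogeneration forces \<open>K\<close>
    to be 0.\<close>
  define K where "K = {w. (0, w) \<in> G}"
  have "submod n V K"
  proof (intro V.submoduleI V.vs.subspaceI)
    show "component V a w \<in> K" if "w \<in> K" for a w
      using Gcomp[of 0 w a] that by (simp add: K_def M.component_same)
    show "unit_act n V a i j w \<in> K" if "w \<in> K" for a i j w
      using Gact[of 0 w "qunit n a i j"] that by (simp add: K_def)
    show "u + w \<in> K" if "u \<in> K" "w \<in> K" for u w
      using Gadd[of 0 u 0 w] that by (simp add: K_def)
    show "smul V c w \<in> K" if "w \<in> K" for c w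
      using Gscale[of 0 w c] that by (simp add: K_def)
  qed (use G0 Gspace in \<open>auto simp: K_def\<close>)
  moreover have "K \<inter> wspace n lam V \<subseteq> {0}"
  proof
    fix w assume w: "w \<in> K \<inter> wspace n lam V"
    then have "(0, w) \<in> T"
      using M.vs.subspace_0[OF M.wspace_subspace] by (intro GT) (auto simp: K_def D.P_wspace)
    then show "w \<in> {0}" using f0 by (simp add: TD)
  qed
  ultimately have K0: "K = {0}" using V(3) by (simp add: wspace_cogenerates_def)
  \<comment> \<open>The domain of the relation \<open>G\<close> is a submodule containing the weight
    space, hence everything by generation.\<close>
  define E where "E = fst ` G"
  interpret fst: sm_morphism n D.P M fst
    by (rule sm_morphismI) (auto simp: D.P_supermodule M D.fst_hom)
  have "submod n M E"
    unfolding E_def by (rule fst.submodule_image[OF G(1)])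
  moreover have "wspace n lam M \<subseteq> E"
    using G(2) by (force simp: E_def T_def)
  ultimately have E: "E = sm_space M" using M(3) by (simp add: wspace_generates_def)
  define F where "F v = (THE w. (v, w) \<in> G)" for v
  have Feq: "F v = w" if "(v, w) \<in> G" for v w
    unfolding F_def
  proof (rule the_equality)
    show "(v, w) \<in> G" by (rule that)
    fix w' assume "(v, w') \<in> G"
    then have "w' - w \<in> K" using Gdiff[OF _ that] by (force simp: K_def)
    then show "w' = w" using K0 by simp
  qed
  have FG: "(v, F v) \<in> G" if "v \<in> sm_space M" for v
    using that Feq unfolding E[symmetric] E_def by fastforce
  have "F \<in> sm_hom n M V"
  proof (rule sm_homI[OF M(1) V(1)])
    show "F v \<in> part V a" if v: "v \<in> part M a" for a v
    proof -
      have "F v = component V a (F v)"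
        using Feq[OF Gcomp[OF FG, of v a]] v M.part_subset by simp
      moreover have "F v \<in> sm_space V" using FG[of v] Gspace M.part_subset[OF v] by blast
      ultimately show ?thesis using V.component_in by metis
    qed
  qed (use FG Feq Gadd Gscale Gact in auto)
  moreover have "\<forall>v\<in>wspace n lam M. F v = f v"
    using G(2) Feq by (auto simp: T_def)
  ultimately show ?thesis by blast
qed

section \<open>The simple module and its parity shifts\<close>

text \<open>Indexing by a parity puts a module and its parity change into one family, so that both
  Ext groups are handled by the same lemmas.\<close>

definition shift :: "bit \<Rightarrow> 'v supermodule \<Rightarrow> 'v supermodule" where
  "shift p V = V\<lparr>part := \<lambda>a. part V (a + p)\<rparr>"

lemma shift_0 [simp]: "shift 0 V = V"
  and parity_change_shift: "parity_change V = shift 1 V"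
  by (simp_all add: shift_def parity_change_def)

lemma shift_simps [simp]:
  "smul (shift p V) = smul V" "act (shift p V) = act V" "part (shift p V) a = part V (a + p)"
  by (simp_all add: shift_def)

lemma sm_space_shift [simp]: "sm_space (shift p V) = sm_space V"
proof (cases p)
  assume "p = 1"
  then show ?thesis unfolding sm_space_def by (auto, metis add.commute, metis add.commute)
qed simp

lemma graded_shift [simp]: "graded (shift p V) W \<longleftrightarrow> graded V W"
proof (cases p)
  assume p: "p = 1"
  have "{u + w |u w. u \<in> W \<inter> part V 1 \<and> w \<in> W \<inter> part V 0} =
      {u + w |u w. u \<in> W \<inter> part V 0 \<and> w \<in> W \<inter> part V 1}"
    by (auto, (metis add.commute)+)
  then show ?thesis by (simp add: graded_def p)
qed simp

lemma is_supermodule_shift: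
  assumes "is_supermodule n V"
  shows "is_supermodule n (shift p V)"
proof (cases p)
  assume p: "p = 1"
  have "part V 1 \<inter> part V 0 = {0}" using assms by (auto simp: is_supermodule_def)
  then show ?thesis
    using assms p by (simp add: is_supermodule_def add.assoc)
qed (use assms in simp)

lemma submodule_shift [simp]: "submod n (shift p V) W \<longleftrightarrow> submod n V W"
  by (simp add: submod_def invariant_subspace_def)

lemma wspace_shift [simp]: "wspace n lam (shift p V) = wspace n lam V"
  by (simp add: wspace_def)

lemma
  shows raising_trivial_shift [simp]: "raising_trivial n lam (shift p V) = raising_trivial n lam V"
    and wspace_generates_shift [simp]: "wspace_generates n lam (shift p V) = wspace_generates n lam V"
    and wspace_cogenerates_shift [simp]:
      "wspace_cogenerates n lam (shift p V) = wspace_cogenerates n lam V"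
  by (simp_all add: raising_trivial_def wspace_generates_def wspace_cogenerates_def)

lemma (in supermod) component_shift: "component (shift p V) a v = component V (a + p) v"
  by (simp add: component_def add.assoc add.commute[of 1 p])

locale simple_hw =
  fixes n :: nat and lam :: "nat \<Rightarrow> complex" and L :: "'v::ab_group_add supermodule"
  assumes obj: "queer_category_obj n L" and is_L: "is_L n lam L"
begin

sublocale supermod n L
  using obj by unfold_locales (simp add: queer_category_obj_def)

abbreviation TL where "TL \<equiv> wspace n lam L"

text \<open>Highest weight vectors in the strict sense; they turn out to fill the whole weight space
  (\<open>wspace_singular\<close>).\<close>

definition singular :: "'v set" where
  "singular = {v \<in> TL. \<forall>a i j. i < j \<longrightarrow> j < n \<longrightarrow> X a i j v = 0}"

sublocale sing: singular_subspace n L lam singular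
proof unfold_locales
  show "vs.subspace singular"
    by (rule vs.subspaceI)
      (auto simp: singular_def act_add act_scale wspace_space vs.subspace_0[OF wspace_subspace]
        intro: vs.subspace_add[OF wspace_subspace] vs.subspace_scale[OF wspace_subspace])
  show "X 1 k k v \<in> singular" if "v \<in> singular" "k < n" for v k
    using that by (auto simp: singular_def wspace_X_diag X_X wspace_space)
  show "component L a v \<in> singular" if "v \<in> singular" for v a
  proof -
    have v: "v \<in> sm_space L" using that wspace_space by (auto simp: singular_def)
    have "X b i j (component L a v) = 0" if "X b i j v = 0" for b i j
      using component_X[OF v, of b a i j] that by simp
    then show ?thesis using that wspace_component by (simp add: singular_def)
  qed
qed (auto simp: singular_def)

lemma submodule_cases: "submod n L W \<Longrightarrow> W = {0} \<or> W = sm_space L"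
  using is_L by (simp add: is_L_def simple_supermodule_def submod_def)

lemma singular_nonzero: "\<exists>v\<in>singular. v \<noteq> 0"
proof -
  obtain v where v: "v \<in> sm_space L" "v \<noteq> 0"
    "\<forall>i<n. act L (queer_mat (unit_diag n i) (0\<^sub>m n n)) v = smul L (lam i) v"
    "\<forall>A\<in>strictly_upper n. \<forall>B\<in>strictly_upper n. act L (queer_mat A B) v = 0"
    using is_L by (auto simp: is_L_def has_highest_weight_def)
  have "X a i j v = 0" if "i < j" for a i j
    using v(4) strictly_upper_munit[OF that] zero_strictly_upper by (simp add: qunit_def)
  then have "v \<in> singular" using v by (auto simp: singular_def wspace_def unit_diag_qunit)
  then show ?thesis using v by blast
qed

lemma generated_singular: "sing.generated = sm_space L"
  using submodule_cases[OF sing.submodule_generated] singular_nonzero sing.generated.base by blast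

text \<open>By simplicity the singular vectors generate \<open>L\<close>, and generation adds no
  vectors of weight \<open>lam\<close>.\<close>

lemma wspace_singular: "TL = singular"
  using sing.generated_wspace generated_singular wspace_space by (auto simp: singular_def)

lemma raising_trivial: "raising_trivial n lam L"
  unfolding raising_trivial_def wspace_singular by (simp add: singular_def)

lemma degree_bounded:
  "v \<in> degree_space (top_degree n lam + of_nat p) \<Longrightarrow> p > 0 \<Longrightarrow> v = 0"
  by (rule sing.generated_bounded) (auto simp: generated_singular degree_space_def)

lemma wspace_nonzero: "\<exists>v\<in>TL. v \<noteq> 0"
  using singular_nonzero wspace_singular by simp

lemma wspace_generates: "wspace_generates n lam L"
  unfolding wspace_generates_def
proof (intro allI impI)
  fix K assume K: "submod n L K \<and> TL \<subseteq> K"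
  then have "K \<noteq> {0}" using wspace_nonzero by auto
  then show "K = sm_space L" using submodule_cases[OF conjunct1[OF K]] by simp
qed

lemma wspace_cogenerates: "wspace_cogenerates n lam L"
  unfolding wspace_cogenerates_def
proof (intro allI impI)
  fix K assume K: "submod n L K \<and> K \<inter> TL \<subseteq> {0}"
  obtain v where v: "v \<in> TL" "v \<noteq> 0" using wspace_nonzero by (rule bexE)
  show "K = {0}"
    using submodule_cases[OF conjunct1[OF K]]
  proof
    assume "K = sm_space L"
    then have "v \<in> K" using wspace_space[OF v(1)] by (simp only:)
    then have "v \<in> {0}" using v(1) by (rule subsetD[OF conjunct2[OF K] IntI])
    then show ?thesis using v(2) by simp
  qed
qed

text \<open>A Cartan submodule of the weight space generates 0 or \<open>L\<close>, and it is
  recovered as the weight space part of what it generates.\<close>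

lemma wspace_simple:
  assumes "vs.subspace T" "T \<subseteq> TL"
    and "\<And>v k. v \<in> T \<Longrightarrow> k < n \<Longrightarrow> X 1 k k v \<in> T" and "\<And>v a. v \<in> T \<Longrightarrow> component L a v \<in> T"
  shows "T = {0} \<or> T = TL"
proof -
  interpret T: singular_subspace n L lam T
  proof unfold_locales
    show "X a i j v = 0" if "v \<in> T" "i < j" "j < n" for v a i j
      using that assms(2) raising_trivial unfolding raising_trivial_def by blast
  qed (fact assms)+
  have "T.generated = {0} \<or> T.generated = sm_space L"
    by (rule submodule_cases) (rule T.submodule_generated)
  then show ?thesis
  proof
    assume "T.generated = {0}"
    then have "T \<subseteq> {0}" using T.generated.base by auto
    then show ?thesis using vs.subspace_0[OF assms(1)] by auto
  next
    assume "T.generated = sm_space L"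
    then have "TL \<subseteq> T" using T.generated_wspace wspace_space by auto
    then show ?thesis using assms(2) by auto
  qed
qed

text \<open>The image of h_j is a Cartan submodule of a simple one. If it were everything, h_j would
  vanish anyway, since its square is \<open>lam j = 0\<close> and so it kills its own image.\<close>

lemma odd_diag_zero:
  assumes "j < n" "lam j = 0" "v \<in> TL"
  shows "X 1 j j v = 0"
proof -
  let ?h = "X 1 j j"
  define T where "T = ?h ` TL"
  have sq: "?h (?h v) = 0" if "v \<in> TL" for v
  proof -
    have "?h (?h v) = - ?h (?h v)"
      using X_X[of v j j j j 1 1] that assms wspaceD[of v lam j] wspace_space by simp
    then have "?h (?h v) + ?h (?h v) = 0" by (simp add: eq_neg_iff_add_eq_0)
    then have "smul L 2 (?h (?h v)) = 0" using vs.scale_left_distrib[of 1 1] by simp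
    then show ?thesis by simp
  qed
  have T0: "0 \<in> T"
    unfolding T_def
    by (rule image_eqI[of _ _ 0]) (auto simp: vs.subspace_0[OF wspace_subspace])
  have "T = {0} \<or> T = TL"
  proof (rule wspace_simple)
    show "vs.subspace T"
    proof (rule vs.subspaceI)
      show "0 \<in> T" by (rule T0)
      show "x + y \<in> T" if "x \<in> T" "y \<in> T" for x y
        using that vs.subspace_add[OF wspace_subspace]
        by (auto simp: T_def wspace_space simp flip: act_add[OF qunit_queer])
      show "smul L c x \<in> T" if "x \<in> T" for c x
        using that vs.subspace_scale[OF wspace_subspace]
        by (auto simp: T_def wspace_space simp flip: act_scale[OF qunit_queer])
    qed
    show "T \<subseteq> TL" using assms wspace_X_diag by (auto simp: T_def)
    show "X 1 k k v \<in> T" if v: "v \<in> T" and k: "k < n" for v k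
    proof -
      obtain u where u: "u \<in> TL" "v = ?h u" using v by (auto simp: T_def)
      show ?thesis
      proof (cases "k = j")
        case True
        then show ?thesis using sq[OF u(1)] u(2) T0 by simp
      next
        case False
        \<comment> \<open>The sign from anticommuting is absorbed into the preimage
          \<open>u\<close>.\<close>
        have "X 1 k k v = ?h (X 1 k k (- u))"
          using X_X[of u k k j j 1 1] False u k assms wspace_space[OF u(1)] by (simp add: act_neg)
        then show ?thesis
          using wspace_X_diag vs.subspace_neg[OF wspace_subspace u(1)] k by (auto simp: T_def)
      qed
    qed
    show "component L a v \<in> T" if v: "v \<in> T" for v a
    proof -
      obtain u where u: "u \<in> TL" "v = ?h u" using v by (auto simp: T_def)
      have "component L (1 + (1 + a)) (?h u) = ?h (component L (1 + a) u)"
        by (rule component_X) (rule wspace_space[OF u(1)])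
      then show ?thesis using u wspace_component by (auto simp: T_def)
    qed
  qed
  then show ?thesis
  proof
    assume "T = {0}"
    then show ?thesis using assms(3) unfolding T_def by blast
  next
    assume "T = TL"
    then obtain u where u: "u \<in> TL" "v = ?h u" using assms(3) unfolding T_def by blast
    show ?thesis unfolding u(2) by (rule sq[OF u(1)])
  qed
qed

end

section \<open>Finite-dimensional modules\<close>

text \<open>Non-zero eigenvectors of \<open>degree_op\<close> for distinct eigenvalues are
  independent, so infinitely many of them do not fit into a finite span.\<close>

lemma (in supermod) degree_sequence_vanishes:
  assumes fin: "finite_dimensional V"
    and u: "\<And>k. u k \<in> degree_space (c k)" and inj: "inj c"
  shows "\<exists>k::nat. u k = 0"
proof (rule ccontr)
  assume "\<nexists>k. u k = 0"
  then have nz: "u k \<noteq> 0" for k by blast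
  have injc: "inj u"
  proof (rule injI)
    fix j k assume eq: "u j = u k"
    have "smul V (c j) (u j) = smul V (c k) (u j)"
      using u[of j] u[of k] eq by (simp add: degree_space_def)
    then show "j = k" using nz[of j] inj by (auto dest: injD)
  qed
  have "vs.independent (range u)"
    unfolding vs.independent_explicit_module
  proof (intro allI impI)
    fix S g v
    assume S: "finite S" "S \<subseteq> range u" "(\<Sum>v\<in>S. smul V (g v) v) = 0" "v \<in> S"
    define F where "F = u -` S"
    have F: "finite F" "S = u ` F" using S injc by (auto simp: F_def finite_vimageI)
    have sum0: "(\<Sum>k\<in>F. smul V (g (u k)) (u k)) = 0"
      using S(3) F inj_on_subset[OF injc] by (simp add: sum.reindex)
    obtain k where k: "k \<in> F" "v = u k" using S(4) F by auto
    have ds: "smul V b (u j) \<in> degree_space (c j)" for b j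
      using u by (rule vs.subspace_scale[OF degree_space_subspace])
    have "smul V (g (u k)) (u k) + (\<Sum>j\<in>F - {k}. smul V (g (u j)) (u j)) = 0"
      using sum0 unfolding sum.remove[OF F(1) k(1)] .
    then have eq: "smul V (- g (u k)) (u k) = (\<Sum>j\<in>F - {k}. smul V (g (u j)) (u j))"
      unfolding vs.scale_minus_left by (rule minus_unique)
    have "smul V (- g (u k)) (u k) = 0"
      by (rule degree_sum_zero[OF _ _ _ ds eq]) (use F(1) ds inj in \<open>auto dest: injD\<close>)
    then show "g v = 0" using k nz by simp
  qed
  moreover obtain B where B: "finite B" "vs.span B = sm_space V"
    using fin by (auto simp: finite_dimensional_def)
  moreover have "range u \<subseteq> vs.span B" using u B by (auto simp: degree_space_def)
  ultimately have "finite (range u)" using vs.independent_span_bound by blast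
  then show False using injc by (simp add: finite_image_iff)
qed

text \<open>Otherwise the powers of the lowering operator give non-zero vectors of infinitely many degrees.\<close>

lemma (in supermod) lowering_zero:
  assumes fin: "finite_dimensional V" and raise: "raising_trivial n lam V"
    and ij: "i < j" "j < n" "lam i = 0" "lam j = 0" and v: "v \<in> wspace n lam V"
  shows "X 0 j i v = 0"
proof (rule ccontr)
  assume nz: "X 0 j i v \<noteq> 0"
  let ?e = "X 0 i j" and ?f = "X 0 j i"
  define h where "h w = X 0 i i w - X 0 j j w" for w
  \<comment> \<open>The string starts at f v and not at v: since e and h kill v, the vector f v is
    again killed by e and has h-weight -2, a negative highest weight for which the string never
    ends.\<close>
  define u where "u k = (?f ^^ Suc k) v" for k
  have vs: "v \<in> sm_space V" using v wspace_space by blast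
  have us: "u k \<in> sm_space V" for k
    by (induction k) (auto simp: u_def vs)
  have u_Suc: "u (Suc k) = ?f (u k)" for k by (simp add: u_def)
  have ef: "?e (?f w) = ?f (?e w) + h w" if "w \<in> sm_space V" for w
    using X_X[OF that, of i j j i 0 0] ij by (simp add: h_def)
  have hf: "h (?f w) = ?f (h w) - smul V 2 (?f w)" if "w \<in> sm_space V" for w
    using X_X[OF that, of i i j i 0 0] X_X[OF that, of j j j i 0 0] ij that
      vs.scale_left_distrib[of 1 1 "?f w"]
    by (simp add: h_def act_diff)
  have hv: "h v = 0" using v ij wspaceD[OF v] by (simp add: h_def)
  have ev: "?e v = 0" using raise v ij by (simp add: raising_trivial_def)
  have hu: "h (u k) = smul V (- 2 * (of_nat k + 1)) (u k)" for k
  proof (induction k)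
    case 0
    show ?case using hf[OF vs] hv by (simp add: u_def)
  next
    case (Suc k)
    have "h (u (Suc k)) = smul V (- 2 * (of_nat k + 1)) (u (Suc k)) - smul V 2 (u (Suc k))"
      unfolding u_Suc hf[OF us] Suc by (subst act_scale) (auto simp: us)
    also have "\<dots> = smul V (- 2 * (of_nat (Suc k) + 1)) (u (Suc k))"
      by (simp only: flip: vs.scale_left_diff_distrib) (simp add: algebra_simps)
    finally show ?case .
  qed
  have e0: "?e (u 0) = 0" using ef[OF vs] ev hv by (simp add: u_def)
  \<comment> \<open>The sl_2 formula e f^r w = r (mu - r + 1) f^(r-1) w for a highest weight vector
    w of weight mu, with mu = -2 and r = k + 1; this coefficient never vanishes.\<close>
  have eu: "?e (u (Suc k)) = smul V (- of_nat (Suc k) * of_nat (k + 2)) (u k)" for k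
  proof (induction k)
    case 0
    show ?case unfolding u_Suc ef[OF us] e0 hu by simp
  next
    case (Suc k)
    have "?e (u (Suc (Suc k))) = smul V (- of_nat (Suc k) * of_nat (k + 2)) (u (Suc k))
        + smul V (- 2 * (of_nat (Suc k) + 1)) (u (Suc k))"
      unfolding u_Suc[of "Suc k"] ef[OF us] Suc hu
      by (subst act_scale) (auto simp: us u_Suc)
    also have "\<dots> = smul V (- of_nat (Suc (Suc k)) * of_nat (Suc k + 2)) (u (Suc k))"
      by (simp only: flip: vs.scale_left_distrib) (simp add: algebra_simps)
    finally show ?case .
  qed
  have unz: "u k \<noteq> 0" for k
  proof (induction k)
    case (Suc k)
    have "(- of_nat (Suc k) * of_nat (k + 2) :: complex) \<noteq> 0"
      by (simp only: mult_eq_0_iff neg_equal_0_iff_equal of_nat_eq_0_iff) simp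
    then have "?e (u (Suc k)) \<noteq> 0" using eu[of k] Suc by (simp only: vs.scale_eq_0_iff) simp
    then show ?case by auto
  qed (use nz in \<open>simp add: u_def\<close>)
  \<comment> \<open>\<open>u k\<close> lies k + 1 lowering steps below v, each of degree j - i > 0,
    so its degrees are pairwise distinct.\<close>
  define c where "c k = top_degree n lam - of_nat (Suc k) * (of_nat (j - i) :: complex)" for k
  have "u k \<in> degree_space (c k)" for k
  proof (induction k)
    case 0
    show ?case
      using degree_space_X[OF wspace_degree[OF v], of j i 0] ij
      by (simp add: u_def c_def of_nat_diff algebra_simps)
  next
    case (Suc k)
    have "c k + of_nat i - of_nat j = c (Suc k)"
      using ij by (simp add: c_def of_nat_diff algebra_simps)
    then show ?case
      using degree_space_X[OF Suc, of j i 0] ij by (simp add: u_Suc)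
  qed
  moreover have "inj c" using ij by (auto simp: c_def inj_def)
  ultimately show False using degree_sequence_vanishes[OF fin, of u c] unz by blast
qed

text \<open>For i < j, the bracket of the odd unit (i, j) with the even unit (j, i) is the
  difference of the two odd diagonal units. On \<open>v\<close> it vanishes, the first factor being
  a raising operator and the second being covered by \<open>lowering_zero\<close>.\<close>

lemma (in supermod) odd_diag_eq:
  assumes fin: "finite_dimensional V" and raise: "raising_trivial n lam V"
    and ij: "i < n" "j < n" "lam i = 0" "lam j = 0" and v: "v \<in> wspace n lam V"
  shows "X 1 i i v = X 1 j j v"
proof -
  have *: "X 1 i i v = X 1 j j v" if "i < j" "j < n" "lam i = 0" "lam j = 0" for i j
  proof -
    have "X 0 j i v = 0" by (rule lowering_zero[OF fin raise that v])
    moreover have "X 1 i j v = 0" using raise v that by (simp add: raising_trivial_def)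
    ultimately show ?thesis
      using X_X[OF wspace_space[OF v], of i j j i 1 0] that by simp
  qed
  show ?thesis
  proof (cases i j rule: linorder_cases)
    case less
    then show ?thesis using ij by (intro *)
  next
    case greater
    then show ?thesis using ij by (intro *[symmetric])
  qed simp
qed

section \<open>Schur's lemma for the highest weight space\<close>

text \<open>Stated for a sequence, which may repeat vectors; a repetition yields the relation
  directly, with coefficients 1 and -1.\<close>

lemma (in vector_space) lin_dependence:
  assumes "finite B" "\<And>i. u i \<in> span B"
  shows "\<exists>g. (\<exists>i\<le>card B. g i \<noteq> 0) \<and> (\<Sum>i\<le>card B. scale (g i) (u i)) = 0"
proof (cases "inj_on u {..card B}")
  case True
  have "dependent (u ` {..card B})"
  proof (rule ccontr)
    assume "independent (u ` {..card B})"
    then have "card (u ` {..card B}) \<le> card B"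
      using independent_span_bound[OF assms(1)] assms(2) by blast
    then show False using True by (simp add: card_image)
  qed
  then obtain g where "\<exists>v\<in>u ` {..card B}. g v \<noteq> 0" "(\<Sum>v\<in>u ` {..card B}. scale (g v) v) = 0"
    using dependent_finite[of "u ` {..card B}"] by auto
  then show ?thesis
    using True by (intro exI[of _ "g \<circ> u"]) (auto simp: sum.reindex)
next
  case False
  then obtain i j where ij: "i \<le> card B" "j \<le> card B" "i \<noteq> j" "u i = u j"
    by (auto simp: inj_on_def)
  define g where "g k = of_bool (k = i) - (of_bool (k = j) :: 'a)" for k
  have "(\<Sum>k\<le>card B. scale (g k) (u k))
      = (\<Sum>k\<le>card B. (if k = i then u i else 0) - (if k = j then u j else 0))"
    by (rule sum.cong) (auto simp: g_def)
  also have "\<dots> = 0" using ij by (simp add: sum_subtractf)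
  finally show ?thesis using ij by (intro exI[of _ g]) (auto simp: g_def)
qed

text \<open>Split off a root c of \<open>p\<close>. Either (f - c) v = 0 and v is an eigenvector, or
  (f - c) v is a non-zero vector annihilated by the remaining factor. Linearity of \<open>f\<close>
  is assumed only on \<open>S\<close>, since the maps in question are arbitrary outside their
  domain.\<close>

lemma eigenvector_from_polynomial:
  fixes scale :: "complex \<Rightarrow> 'v::ab_group_add \<Rightarrow> 'v"
  assumes vs: "vector_space scale" and S: "module.subspace scale S"
    and f: "\<And>v. v \<in> S \<Longrightarrow> f v \<in> S" "\<And>u v. u \<in> S \<Longrightarrow> v \<in> S \<Longrightarrow> f (u + v) = f u + f v"
      "\<And>c v. v \<in> S \<Longrightarrow> f (scale c v) = scale c (f v)"
    and p: "p \<noteq> 0" "degree p \<le> D" "(\<Sum>i\<le>D. scale (coeff p i) ((f ^^ i) v)) = 0" and v: "v \<in> S" "v \<noteq> 0"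
  shows "\<exists>c. \<exists>w\<in>S. w \<noteq> 0 \<and> f w = scale c w"
  using p v
proof (induction D arbitrary: p v)
  case 0
  interpret vector_space scale by (rule vs)
  have "coeff p 0 \<noteq> 0" using 0 by (metis leading_coeff_0_iff le_zero_eq)
  then show ?case using 0 by simp
next
  case (Suc D)
  interpret vector_space scale by (rule vs)
  have fS: "(f ^^ i) w \<in> S" if "w \<in> S" for i w
    by (induction i) (use that f in auto)
  have vS: "v \<in> S" by (rule Suc.prems)
  show ?case
  proof (cases "degree p = 0")
    \<comment> \<open>A non-zero constant cannot annihilate \<open>v\<close>, so this case is
      contradictory.\<close>
    case True
    then have "coeff p i = 0" if "i > 0" for i using that by (simp add: coeff_eq_0)
    then have "(\<Sum>i\<le>Suc D. scale (coeff p i) ((f ^^ i) v)) = scale (coeff p 0) v"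
      by (simp add: sum.atMost_Suc_shift del: sum.atMost_Suc)
    moreover have "coeff p 0 \<noteq> 0" using True Suc.prems(1) by (metis leading_coeff_0_iff)
    ultimately show ?thesis using Suc.prems by (metis scale_eq_0_iff)
  next
    case False
    then obtain c where "poly p c = 0"
      using fundamental_theorem_of_algebra[of p] by (auto simp: constant_degree)
    then obtain q where pq: "p = [:- c, 1:] * q" by (auto simp: poly_eq_0_iff_dvd dvd_def)
    have q: "q \<noteq> 0" using pq Suc.prems(1) by auto
    have "degree p = Suc (degree q)" unfolding pq using q by (subst degree_mult_eq) auto
    then have deg: "degree q \<le> D" using Suc.prems(2) by simp
    have co: "coeff p i = (case i of 0 \<Rightarrow> 0 | Suc k \<Rightarrow> coeff q k) - c * coeff q i" for i
      unfolding pq by (simp add: coeff_pCons split: nat.split)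
    define w where "w = f v - scale c v"
    have wS: "w \<in> S" unfolding w_def using Suc.prems S f by (intro subspace_diff subspace_scale) auto
    have fw: "(f ^^ i) w = (f ^^ Suc i) v - scale c ((f ^^ i) v)" for i
    proof (induction i)
      case (Suc i)
      have "f ((f ^^ Suc i) v - scale c ((f ^^ i) v))
          = f ((f ^^ Suc i) v) + f (scale (- c) ((f ^^ i) v))"
        using fS[OF vS] subspace_scale[OF S] f(1)
        by (subst f(2)[symmetric]) (auto simp del: scale_minus_left, simp)
      also have "\<dots> = (f ^^ Suc (Suc i)) v - scale c ((f ^^ Suc i) v)"
        using fS[OF vS] by (subst f(3)) auto
      finally show ?case using Suc.IH by simp
    qed (simp add: w_def)
    have "(\<Sum>i\<le>D. scale (coeff q i) ((f ^^ i) w))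
        = (\<Sum>i\<le>D. scale (coeff q i) ((f ^^ Suc i) v)) - (\<Sum>i\<le>D. scale (c * coeff q i) ((f ^^ i) v))"
      unfolding fw by (simp add: scale_right_diff_distrib sum_subtractf mult.commute del: funpow.simps)
    also have "(\<Sum>i\<le>D. scale (coeff q i) ((f ^^ Suc i) v))
        = (\<Sum>i\<le>Suc D. scale (case i of 0 \<Rightarrow> 0 | Suc k \<Rightarrow> coeff q k) ((f ^^ i) v))"
      by (simp add: sum.atMost_Suc_shift del: sum.atMost_Suc funpow.simps)
    \<comment> \<open>The added term is 0 because \<open>q\<close> has degree at most
      \<open>D\<close>; both sums now have the range of the relation for \<open>p\<close>.\<close>
    also have "(\<Sum>i\<le>D. scale (c * coeff q i) ((f ^^ i) v))
        = (\<Sum>i\<le>Suc D. scale (c * coeff q i) ((f ^^ i) v))"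
      using deg by (simp add: coeff_eq_0)
    finally have eq: "(\<Sum>i\<le>D. scale (coeff q i) ((f ^^ i) w)) = 0"
      using Suc.prems(3) unfolding co by (simp add: scale_left_diff_distrib sum_subtractf)
    show ?thesis
    proof (cases "w = 0")
      case True
      then show ?thesis using Suc.prems by (auto simp: w_def)
    next
      case False
      then show ?thesis using Suc.IH[OF q deg eq wS] by blast
    qed
  qed
qed

text \<open>The iterates of \<open>v\<close> stay in a finite span, and a linear relation between
  them is a polynomial in \<open>f\<close> annihilating \<open>v\<close>.\<close>

lemma eigenvector_exists:
  fixes scale :: "complex \<Rightarrow> 'v::ab_group_add \<Rightarrow> 'v"
  assumes vs: "vector_space scale" and S: "module.subspace scale S"
    and B: "finite B" "S \<subseteq> module.span scale B"
    and f: "\<And>v. v \<in> S \<Longrightarrow> f v \<in> S" "\<And>u v. u \<in> S \<Longrightarrow> v \<in> S \<Longrightarrow> f (u + v) = f u + f v"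
      "\<And>c v. v \<in> S \<Longrightarrow> f (scale c v) = scale c (f v)"
    and v: "v \<in> S" "v \<noteq> 0"
  shows "\<exists>c. \<exists>w\<in>S. w \<noteq> 0 \<and> f w = scale c w"
proof -
  interpret vector_space scale by (rule vs)
  have "(f ^^ i) v \<in> S" for i by (induction i) (use v f in auto)
  then obtain g where g: "\<exists>i\<le>card B. g i \<noteq> 0" "(\<Sum>i\<le>card B. scale (g i) ((f ^^ i) v)) = 0"
    using lin_dependence[OF B(1), of "\<lambda>i. (f ^^ i) v"] B(2) by blast
  define p where "p = (\<Sum>i\<le>card B. monom (g i) i)"
  have co: "coeff p i = (if i \<le> card B then g i else 0)" for i
  proof -
    have "coeff p i = (\<Sum>j\<le>card B. if j = i then g j else 0)"
      by (auto simp: p_def coeff_sum intro!: sum.cong)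
    then show ?thesis by simp
  qed
  have "p \<noteq> 0" using g(1) co by (metis coeff_0)
  moreover have "degree p \<le> card B" by (rule degree_le) (simp add: co)
  ultimately show ?thesis
    using g(2) v by (intro eigenvector_from_polynomial[OF vs S f, of p "card B" v]) (auto simp: co)
qed

context simple_hw
begin

text \<open>An eigenspace is a Cartan submodule of a simple one. It is graded because
  \<open>f\<close> preserves parity, so only scalars occur, even when \<open>L\<close> is isomorphic
  to its parity change.\<close>

lemma cartan_schur:
  assumes f: "f \<in> cartan_hom n lam L L"
  shows "\<exists>c. \<forall>v\<in>TL. f v = smul L c v"
proof -
  note f' = cartan_homD[OF f]
  obtain B where B: "finite B" "vs.span B = sm_space L"
    using is_L by (auto simp: is_L_def finite_dimensional_def)
  have "\<exists>c. \<exists>w\<in>TL. w \<noteq> 0 \<and> f w = smul L c w"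
    using wspace_nonzero
    by (auto intro!: eigenvector_exists[OF vs.vector_space_axioms wspace_subspace B(1)]
        simp: B(2) wspace_space f')
  then obtain c w where w: "w \<in> TL" "w \<noteq> 0" "f w = smul L c w" by blast
  define T where "T = {v \<in> TL. f v = smul L c v}"
  have "T = {0} \<or> T = TL"
  proof (rule wspace_simple)
    show "vs.subspace T"
    proof (rule vs.subspaceI)
      show "0 \<in> T" using f'(2)[OF w(1), of 0] vs.subspace_0[OF wspace_subspace] by (simp add: T_def)
      show "x + y \<in> T" if "x \<in> T" "y \<in> T" for x y
        using that f'(1) vs.subspace_add[OF wspace_subspace] by (simp add: T_def vs.scale_right_distrib)
      show "smul L a x \<in> T" if "x \<in> T" for a x
        using that f'(2) vs.subspace_scale[OF wspace_subspace] by (simp add: T_def mult.commute)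
    qed
    show "X 1 k k v \<in> T" if "v \<in> T" "k < n" for v k
      using that f'(5) wspace_X_diag wspace_space[of v lam] by (simp add: T_def act_scale)
    show "component L a v \<in> T" if "v \<in> T" for v a
      using that wspace_component cartan_hom_component[OF is_supermodule is_supermodule f, symmetric]
        wspace_space[of v lam]
      by (simp add: T_def component_scale)
  qed (auto simp: T_def)
  then have "T = TL" using w by (auto simp: T_def)
  then show ?thesis by (auto simp: T_def)
qed

text \<open>A non-zero value would extend to a non-zero homomorphism from \<open>L\<close> to its
  parity change, whose kernel and image leave it no choice but to be bijective.\<close>

lemma cartan_schur_shift:
  assumes f: "f \<in> cartan_hom n lam L (shift 1 L)" and "\<not> sm_isomorphic n L (shift 1 L)"
    and v: "v \<in> TL"
  shows "f v = 0"
proof (rule ccontr)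
  assume nz: "f v \<noteq> 0"
  note sh = is_supermodule_shift[OF is_supermodule, of 1]
  have "\<exists>F\<in>sm_hom n L (shift 1 L). \<forall>v\<in>TL. F v = f v"
    by (rule cartan_hom_extends[OF is_supermodule raising_trivial wspace_generates sh _ _ f])
      (simp_all add: raising_trivial wspace_cogenerates)
  then obtain F where F: "F \<in> sm_hom n L (shift 1 L)" "\<forall>v\<in>TL. F v = f v"
    by blast
  interpret F: sm_morphism n L "shift 1 L" F
    by (rule sm_morphismI[OF is_supermodule sh F(1)])
  have Fv: "F v \<noteq> 0" using F(2) nz v by simp
  note vs = wspace_space[OF v]
  have ker: "{u \<in> sm_space L. F u = 0} = {0}"
    using submodule_cases[OF F.submodule_kernel]
  proof
    assume "{u \<in> sm_space L. F u = 0} = sm_space L"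
    then show ?thesis using vs Fv by blast
  qed
  have "submod n L (F ` sm_space L)"
    using F.submodule_image[OF submodule_space] by simp
  then have im: "F ` sm_space L = sm_space L"
  proof (rule disjE[OF submodule_cases])
    assume "F ` sm_space L = {0}"
    then show ?thesis using vs Fv by blast
  qed
  have "inj_on F (sm_space L)"
  proof (rule inj_onI)
    fix x y assume xy: "x \<in> sm_space L" "y \<in> sm_space L" "F x = F y"
    then have "x - y \<in> {u \<in> sm_space L. F u = 0}" by (auto simp: F.map_diff)
    then show "x = y" using ker by auto
  qed
  then have "sm_isomorphic n L (shift 1 L)"
    unfolding sm_isomorphic_def bij_betw_def using F(1) im by auto
  then show False using assms(2) by contradiction
qed

end

text \<open>The bracket of an odd element with itself is twice its square; for h_i it is also twice
  the even diagonal unit, and the 2 cancels.\<close>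

lemma (in supermod) odd_diag_square:
  assumes "v \<in> wspace n lam V" "i < n"
  shows "X 1 i i (X 1 i i v) = smul V (lam i) v"
proof -
  let ?a = "X 1 i i (X 1 i i v)" and ?b = "smul V (lam i) v"
  have eq: "?a = - ?a + ?b + ?b"
    using X_X[OF wspace_space[OF assms(1)], of i i i i 1 1] assms(2) wspaceD[OF assms] by simp
  have "?a + ?a = ?a + (- ?a + ?b + ?b)"
    by (rule arg_cong[OF eq])
  also have "\<dots> = ?b + ?b"
    by (simp add: add.assoc)
  finally have "?a + ?a = ?b + ?b" .
  then have "smul V (1 + 1) (X 1 i i (X 1 i i v)) = smul V (1 + 1) (smul V (lam i) v)"
    unfolding vs.scale_left_distrib vs.scale_one .
  then show ?thesis by (subst (asm) vs.scale_cancel_left) auto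
qed

lemma (in supermod) odd_diag_anticommute:
  assumes "v \<in> sm_space V" "i < n" "j < n" "i \<noteq> j"
  shows "X 1 i i (X 1 j j v) = - X 1 j j (X 1 i i v)"
  using X_X[of v i i j j 1 1] assms by simp

section \<open>Extensions of the simple module\<close>

text \<open>The obstruction to splitting. It is a relation because existence of \<open>c\<close>
  rests on Schur's lemma and uniqueness on the presence of a zero coordinate; without zero
  coordinates every \<open>c\<close> qualifies.\<close>

definition ext_scalar :: "nat \<Rightarrow> (nat \<Rightarrow> complex) \<Rightarrow> 'v::ab_group_add supermodule
    \<Rightarrow> ('v, 'v) extension \<Rightarrow> complex \<Rightarrow> bool" where
  "ext_scalar n lam L e c \<longleftrightarrow> (\<forall>j<n. lam j = 0 \<longrightarrow> (\<forall>v\<in>wspace n lam (mid e).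
     unit_act n (mid e) 1 j j v = inc e (smul L c (parity_sign L (prj e v)))))"

locale self_extension = simple_hw n lam L
  for n lam and L :: "'v::ab_group_add supermodule" +
  fixes p :: bit and e :: "('v, 'v) extension"
  assumes ext: "e \<in> extensions n L (shift p L)"
begin

lemma mid_obj: "queer_category_obj n (mid e)"
  using ext by (simp add: extensions_def)

sublocale M: supermod n "mid e"
  using mid_obj by unfold_locales (simp add: queer_category_obj_def)

sublocale i: sm_morphism n "shift p L" "mid e" "inc e"
  using ext is_supermodule_shift[OF is_supermodule]
  by unfold_locales (auto simp: extensions_def)

sublocale q: sm_morphism n "mid e" L "prj e"
  using ext by unfold_locales (auto simp: extensions_def)

abbreviation E where "E \<equiv> mid e"

abbreviation TM where "TM \<equiv> wspace n lam E"

lemma inc_add: "x \<in> sm_space L \<Longrightarrow> y \<in> sm_space L \<Longrightarrow> inc e (x + y) = inc e x + inc e y"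
  and inc_scale: "x \<in> sm_space L \<Longrightarrow> inc e (smul L c x) = smul E c (inc e x)"
  and inc_act: "a \<in> queer n \<Longrightarrow> x \<in> sm_space L \<Longrightarrow> inc e (act L a x) = act E a (inc e x)"
  and inc_space: "x \<in> sm_space L \<Longrightarrow> inc e x \<in> sm_space E"
  and inc_wspace: "x \<in> TL \<Longrightarrow> inc e x \<in> TM"
  using i.map_add[of x y] i.map_scale[of x c] i.map_act[of a x] i.map_space[of x]
    i.map_wspace[of x lam] by simp_all

lemma inc_part: "x \<in> part L a \<Longrightarrow> inc e x \<in> part E (a + p)"
  using i.map_part[of x "a + p"] by (simp add: add.assoc)

lemma inc_part_iff:
  assumes "x \<in> sm_space L"
  shows "inc e x \<in> part E (a + p) \<longleftrightarrow> x \<in> part L a"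
proof
  assume h: "inc e x \<in> part E (a + p)"
  have "inc e (component L a x) = component E (a + p) (inc e x)"
    using i.map_component[of x "a + p"] assms component_shift[of p "a + p" x] by (simp add: add.assoc)
  also have "\<dots> = inc e x" by (rule M.component_same[OF h])
  finally have "component L a x = x"
    using ext assms by (auto simp: extensions_def dest!: inj_onD)
  then show "x \<in> part L a" using component_in[OF assms, of a] by simp
qed (rule inc_part)

lemma inc_inject: "x \<in> sm_space L \<Longrightarrow> y \<in> sm_space L \<Longrightarrow> inc e x = inc e y \<longleftrightarrow> x = y"
  using ext by (auto simp: extensions_def dest!: inj_onD)

lemma inc_range: "v \<in> sm_space E \<Longrightarrow> prj e v = 0 \<Longrightarrow> \<exists>y\<in>sm_space L. v = inc e y"
  and prj_inc [simp]: "y \<in> sm_space L \<Longrightarrow> prj e (inc e y) = 0"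
proof -
  have eq: "inc e ` sm_space L = {v \<in> sm_space E. prj e v = 0}"
    using ext by (simp add: extensions_def)
  show "v \<in> sm_space E \<Longrightarrow> prj e v = 0 \<Longrightarrow> \<exists>y\<in>sm_space L. v = inc e y"
    using eq by blast
  show "y \<in> sm_space L \<Longrightarrow> prj e (inc e y) = 0" using eq by blast
qed

lemma inc_eq_0: "y \<in> sm_space L \<Longrightarrow> inc e y = 0 \<longleftrightarrow> y = 0"
  using inc_inject[of y 0] by simp

lemma prj_surj: "x \<in> sm_space L \<Longrightarrow> \<exists>v\<in>sm_space E. prj e v = x"
proof -
  have eq: "prj e ` sm_space E = sm_space L" using ext by (simp add: extensions_def)
  show "x \<in> sm_space L \<Longrightarrow> \<exists>v\<in>sm_space E. prj e v = x"
    unfolding eq[symmetric] by blast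
qed

lemma inc_wspaceD:
  assumes "y \<in> sm_space L" "inc e y \<in> TM"
  shows "y \<in> TL"
proof -
  have "X 0 i i y = smul L (lam i) y" if "i < n" for i
  proof -
    have "inc e (X 0 i i y) = inc e (smul L (lam i) y)"
      using M.wspaceD[OF assms(2) that] assms(1) by (simp add: inc_act inc_scale)
    then show ?thesis using assms(1) by (subst (asm) inc_inject) auto
  qed
  then show ?thesis using assms(1) by (simp add: wspace_def)
qed

lemma inc_degree_op:
  assumes "y \<in> sm_space L"
  shows "inc e (degree_op y) = M.degree_op (inc e y)"
proof -
  have "inc e (\<Sum>k\<in>F. smul L (c k) (X 0 k k y))
      = (\<Sum>k\<in>F. smul E (c k) (M.X 0 k k (inc e y)))" for F and c :: "nat \<Rightarrow> complex"
    using assms i.map_zero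
    by (induction F rule: infinite_finite_induct)
      (simp_all add: inc_add space_sum inc_scale inc_act space_scale)
  then show ?thesis by (simp only: degree_op_def M.degree_op_def)
qed

text \<open>A raised weight vector maps to 0 in the quotient, so it comes from the kernel, a copy of
  \<open>L\<close>, where nothing non-zero has degree j - i above the top.\<close>

lemma mid_raising_trivial: "raising_trivial n lam E"
  unfolding raising_trivial_def
proof (intro ballI allI impI)
  fix v a i j assume v: "v \<in> TM" and ij: "i < j" "j < n"
  let ?w = "M.X a i j v"
  have "prj e ?w = X a i j (prj e v)"
    using q.map_act[OF qunit_queer M.wspace_space[OF v]] .
  also have "\<dots> = 0"
    using raising_trivial q.map_wspace[OF v] ij by (simp add: raising_trivial_def)
  finally obtain y where y: "y \<in> sm_space L" "?w = inc e y"
    using inc_range[of ?w] M.wspace_space[OF v] by auto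
  let ?c = "top_degree n lam + of_nat (j - i)"
  have "?w \<in> M.degree_space ?c"
    using M.degree_space_X[OF M.wspace_degree[OF v], of i j a] ij by (simp add: of_nat_diff add_diff_eq)
  then have "inc e (degree_op y) = inc e (smul L ?c y)"
    using y by (simp add: M.degree_space_def inc_degree_op inc_scale)
  then have "y \<in> degree_space ?c"
    using y(1) inc_inject[of "degree_op y" "smul L ?c y"] by (auto simp: degree_space_def)
  then have "y = 0" using degree_bounded[of y "j - i"] ij by simp
  then show "?w = 0" using y(2) i.map_zero by simp
qed

text \<open>A submodule \<open>K\<close> without weight vectors meets the kernel trivially, hence
  embeds into the quotient \<open>L\<close>. A weight vector in its image would lift to a weight
  vector in \<open>K\<close>, since the defect of the lift lies both in \<open>K\<close> and in the
  kernel; so the image is 0 too.\<close>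

lemma mid_cogenerates: "wspace_cogenerates n lam E"
  unfolding wspace_cogenerates_def
proof (intro allI impI)
  fix K assume K: "submod n E K \<and> K \<inter> TM \<subseteq> {0}"
  then have Ks: "submod n E K" by simp
  note sub = M.submodule_subspace[OF Ks] and sp = M.submodule_subset[OF Ks]
  define K' where "K' = {y \<in> sm_space L. inc e y \<in> K}"
  have "submod n L K'" using i.submodule_preimage[OF Ks] by (simp add: K'_def)
  moreover have "K' \<inter> TL \<subseteq> {0}"
    using K inc_wspace inc_eq_0 by (fastforce simp: K'_def)
  ultimately have K'0: "K' = {0}" using wspace_cogenerates by (simp add: wspace_cogenerates_def)
  have ker: "v = 0" if v: "v \<in> K" "prj e v = 0" for v
  proof -
    obtain y where y: "y \<in> sm_space L" "v = inc e y" using inc_range[of v] v sp by auto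
    then have "y \<in> K'" using v by (simp add: K'_def)
    then show ?thesis using K'0 y i.map_zero by simp
  qed
  have "submod n L (prj e ` K)" by (rule q.submodule_image[OF Ks])
  moreover have "prj e ` K \<inter> TL \<subseteq> {0}"
  proof
    fix x assume "x \<in> prj e ` K \<inter> TL"
    then obtain v where v: "v \<in> K" "x = prj e v" "prj e v \<in> TL" by auto
    then have vs: "v \<in> sm_space E" using sp by auto
    have "M.X 0 i i v - smul E (lam i) v = 0" if "i < n" for i
    proof (rule ker)
      show "M.X 0 i i v - smul E (lam i) v \<in> K"
        using v(1) M.submodule_act[OF Ks] by (auto intro!: M.vs.subspace_diff[OF sub] M.vs.subspace_scale[OF sub])
      show "prj e (M.X 0 i i v - smul E (lam i) v) = 0"
        using vs wspaceD[OF v(3) that] M.space_scale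
        by (simp add: q.map_diff q.map_act q.map_scale)
    qed
    then have "v \<in> TM" using vs by (simp add: wspace_def)
    then have "v = 0" using K v(1) by auto
    then show "x \<in> {0}" using v(2) by simp
  qed
  ultimately have "prj e ` K = {0}" using wspace_cogenerates by (simp add: wspace_cogenerates_def)
  then have "K \<subseteq> {0}" using ker by blast
  then show "K = {0}" using M.vs.subspace_0[OF sub] by auto
qed

section \<open>Sections of an extension on the weight space\<close>

definition is_section :: "('v \<Rightarrow> nat \<Rightarrow> complex) \<Rightarrow> bool" where
  "is_section s \<longleftrightarrow>
     (\<forall>x\<in>TL. \<forall>y\<in>TL. s (x + y) = s x + s y) \<and>
     (\<forall>c. \<forall>x\<in>TL. s (smul L c x) = smul E c (s x)) \<and>
     (\<forall>x\<in>TL. s x \<in> TM \<and> prj e (s x) = x) \<and>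
     (\<forall>a. \<forall>x\<in>TL. x \<in> part L a \<longrightarrow> s x \<in> part E a)"

lemma is_sectionD:
  assumes "is_section s" "x \<in> TL"
  shows "y \<in> TL \<Longrightarrow> s (x + y) = s x + s y"
    and "s (smul L c x) = smul E c (s x)"
    and "s x \<in> TM"
    and "prj e (s x) = x"
    and "x \<in> part L a \<Longrightarrow> s x \<in> part E a"
  using assms by (simp_all add: is_section_def)

text \<open>Semisimplicity over the even part provides a complement of the kernel stable under the
  even diagonal elements, so lifting into it preserves weights. The complement may fail to be
  graded.\<close>

lemma linear_section: "\<exists>s. is_section s"
proof -
  let ?W = "inc e ` sm_space L"
  have "submod n E ?W"
    using i.submodule_image[OF i.V.submodule_space] by simp
  then have "invariant_subspace (queer_part n 0) E ?W"
    using queer_part_subset unfolding submod_def invariant_subspace_def by blast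
  then obtain W' where W': "invariant_subspace (queer_part n 0) E W'" "?W \<inter> W' = {0}"
    "{w + w' |w w'. w \<in> ?W \<and> w' \<in> W'} = sm_space E"
    using mid_obj unfolding queer_category_obj_def semisimple_over_even_def by blast
  have sub: "M.vs.subspace W'" and sp: "W' \<subseteq> sm_space E"
    and X: "w \<in> W' \<Longrightarrow> M.X 0 i i w \<in> W'" for w i
    using W'(1) by (auto simp: invariant_subspace_def)
  have uniq: "u = w" if "u \<in> W'" "w \<in> W'" "prj e u = prj e w" for u w
  proof -
    have "u - w \<in> W'" using that sub by (simp add: M.vs.subspace_diff)
    moreover have "u - w \<in> ?W"
      using inc_range[of "u - w"] that sp by (auto simp: q.map_diff subset_iff)
    ultimately have "u - w \<in> {0}" unfolding W'(2)[symmetric] by (intro IntI)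
    then show ?thesis by simp
  qed
  define r where "r x = (THE w. w \<in> W' \<and> prj e w = x)" for x
  have req: "r x = w" if "w \<in> W'" "prj e w = x" for x w
    unfolding r_def using that uniq by (intro the_equality) auto
  have r: "r x \<in> W'" "prj e (r x) = x" if x: "x \<in> sm_space L" for x
  proof -
    obtain v where v: "v \<in> sm_space E" "prj e v = x" using prj_surj[OF x] by blast
    obtain y w where w: "y \<in> sm_space L" "w \<in> W'" "v = inc e y + w" using W'(3) v(1) by blast
    have "prj e w = x" using v w sp by (auto simp: q.map_add inc_space subset_iff)
    then show "r x \<in> W'" "prj e (r x) = x" using req w(2) by auto
  qed
  have rs: "r x \<in> sm_space E" if "x \<in> sm_space L" for x using r(1)[OF that] sp by auto
  have radd: "r (x + y) = r x + r y" if "x \<in> sm_space L" "y \<in> sm_space L" for x y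
    by (rule req) (use that r rs in \<open>auto simp: q.map_add intro: M.vs.subspace_add[OF sub]\<close>)
  have rscale: "r (smul L c x) = smul E c (r x)" if "x \<in> sm_space L" for c x
    by (rule req) (use that r rs in \<open>auto simp: q.map_scale intro: M.vs.subspace_scale[OF sub]\<close>)
  have rw: "r x \<in> TM" if x: "x \<in> TL" for x
  proof -
    note xs = wspace_space[OF x]
    have "M.X 0 i i (r x) = smul E (lam i) (r x)" if "i < n" for i
    proof (rule uniq)
      show "M.X 0 i i (r x) \<in> W'" using r(1)[OF xs] by (rule X)
      show "smul E (lam i) (r x) \<in> W'" using r(1)[OF xs] by (rule M.vs.subspace_scale[OF sub])
      show "prj e (M.X 0 i i (r x)) = prj e (smul E (lam i) (r x))"
        using wspaceD[OF x that] r(2)[OF xs] rs[OF xs] by (simp add: q.map_act q.map_scale)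
    qed
    then show ?thesis using rs[OF xs] by (simp add: wspace_def)
  qed
  \<comment> \<open>Keeping only the parity-preserving part of \<open>r\<close> makes the lift even;
    it is still a section because the projection commutes with taking components.\<close>
  define s where "s x = component E 0 (r (component L 0 x)) + component E 1 (r (component L 1 x))" for x
  have "is_section s"
    unfolding is_section_def
  proof (intro conjI ballI allI impI)
    show "s (x + y) = s x + s y" if "x \<in> TL" "y \<in> TL" for x y
      using that wspace_space by (simp add: s_def component_add radd M.component_add rs)
    show "s (smul L c x) = smul E c (s x)" if "x \<in> TL" for c x
      using that wspace_space
      by (simp add: s_def component_scale rscale M.component_scale rs M.vs.scale_right_distrib)
    show "s x \<in> TM" if "x \<in> TL" for x
      unfolding s_def using that wspace_component rw
      by (intro M.vs.subspace_add[OF M.wspace_subspace] M.wspace_component) auto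
    show "prj e (s x) = x" if "x \<in> TL" for x
      using wspace_space[OF that] rs component_sum_01
      by (simp add: s_def q.map_add r(2) flip: q.map_component)
    show "s x \<in> part E a" if "x \<in> TL" "x \<in> part L a" for a x
    proof -
      have r0: "r 0 = 0" using rscale[of 0 0] by simp
      have "s x = component E a (r x)"
        using that(2) component_other[of x 0] component_other[of x 1] r0
          M.component_same[OF M.zero_in_part]
        by (cases a) (auto simp: s_def)
      then show ?thesis using rs[OF wspace_space[OF that(1)]] by simp
    qed
  qed
  then show ?thesis by blast
qed

text \<open>Averaging \<open>s\<close> over the Clifford relation \<open>h\<^sub>i\<^sup>2 = lam i\<close> makes it commute with \<open>h\<^sub>i\<close>.\<close>

lemma cartan_section:
  "\<exists>s. is_section s \<and> (\<forall>k<n. lam k \<noteq> 0 \<longrightarrow>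
     (\<forall>x\<in>TL. s (X 1 k k x) = M.X 1 k k (s x)))"
proof -
  \<comment> \<open>The odd elements are treated one at a time, and each averaging must keep the
    equivariance already reached.\<close>
  have "\<exists>s. is_section s \<and> (\<forall>k\<in>F. \<forall>x\<in>TL.
      s (X 1 k k x) = M.X 1 k k (s x))"
    if "finite F" "F \<subseteq> {k. k < n \<and> lam k \<noteq> 0}" for F
    using that
  proof (induction F rule: finite_induct)
    case empty
    show ?case using linear_section by simp
  next
    case (insert i F)
    then obtain s where s: "is_section s" and
      comm: "\<And>k x. k \<in> F \<Longrightarrow> x \<in> TL \<Longrightarrow>
        s (X 1 k k x) = M.X 1 k k (s x)"
      by auto
    have i: "i < n" "lam i \<noteq> 0" using insert.prems by auto
    let ?h = "X 1 i i" and ?H = "M.X 1 i i"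
    note sD = is_sectionD[OF s]
    have hw: "?h x \<in> TL" if "x \<in> TL" for x
      using that i(1) by (rule wspace_X_diag)
    have hs: "?h x \<in> sm_space L" if "x \<in> TL" for x
      using wspace_space[OF hw[OF that]] .
    have sm: "s x \<in> sm_space E" if "x \<in> TL" for x
      using M.wspace_space[OF sD(3)[OF that]] .
    \<comment> \<open>Passing from s to H s h / lam i is an involution, h and H both having square
      \<open>lam i\<close>; so s plus its transform intertwines h and H. The factor 1/2 is postponed
      to \<open>s'\<close>.\<close>
    define t where "t x = s x + smul E (1 / lam i) (?H (s (?h x)))" for x
    have tw: "t x \<in> TM" if "x \<in> TL" for x
      unfolding t_def using that hw sD(3) i
      by (intro M.vs.subspace_add[OF M.wspace_subspace] M.vs.subspace_scale[OF M.wspace_subspace]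
          M.wspace_X_diag) auto
    have sq: "?h (?h x) = smul L (lam i) x" if "x \<in> TL" for x
      using that i(1) by (rule odd_diag_square)
    have Sq: "?H (?H v) = smul E (lam i) v" if "v \<in> TM" for v
      using that i(1) by (rule M.odd_diag_square)
    have ti: "t (?h x) = ?H (t x)" if x: "x \<in> TL" for x
      using i sq[OF x] Sq[OF sD(3)[OF hw[OF x]]] sD(2)[OF x] sm[OF x] sm[OF hw[OF x]]
      by (simp add: t_def M.act_add M.act_scale M.space_scale add.commute)
    \<comment> \<open>Moving h_k past h_i in \<open>L\<close> and past h_i in the middle term gives
      one sign each, and the two cancel.\<close>
    have tk: "t (X 1 k k x) = M.X 1 k k (t x)"
      if k: "k \<in> F" and x: "x \<in> TL" for k x
    proof -
      have k': "k < n" "k \<noteq> i" using k insert by auto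
      have kw: "X 1 k k x \<in> TL" using x k'(1) by (rule wspace_X_diag)
      have "s (?h (X 1 k k x)) = s (smul L (- 1) (X 1 k k (?h x)))"
        using odd_diag_anticommute[of x i k] k' i wspace_space[OF x] by simp
      also have "\<dots> = - M.X 1 k k (s (?h x))"
        using sD(2)[OF wspace_X_diag[OF hw[OF x] k'(1)], of "- 1"] comm[OF k hw[OF x]] by simp
      finally have "?H (s (?h (X 1 k k x))) = M.X 1 k k (?H (s (?h x)))"
        using M.odd_diag_anticommute[of "s (?h x)" i k] k' i sm[OF hw[OF x]]
        by (simp add: M.act_neg)
      then show ?thesis
        using comm[OF k x] sm[OF x] sm[OF hw[OF x]]
        by (simp add: t_def M.act_add M.act_scale M.space_scale)
    qed
    \<comment> \<open>The projection sends \<open>t x\<close> to \<open>x + x\<close>.\<close>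
    define s' where "s' x = smul E (1/2) (t x)" for x
    have ts: "t x \<in> sm_space E" if "x \<in> TL" for x
      using M.wspace_space[OF tw[OF that]] .
    have "is_section s'"
      unfolding is_section_def
    proof (intro conjI ballI allI impI)
      show "s' (x + y) = s' x + s' y" if "x \<in> TL" "y \<in> TL" for x y
        using that sD(1) hw sm wspace_space
        by (simp add: s'_def t_def act_add M.act_add M.vs.scale_right_distrib algebra_simps)
      show "s' (smul L c x) = smul E c (s' x)" if "x \<in> TL" for c x
        using that sD(2) hw sm wspace_space
        by (simp add: s'_def t_def act_scale M.act_scale M.vs.scale_right_distrib mult.commute)
      show "s' x \<in> TM" if "x \<in> TL" for x
        unfolding s'_def using tw[OF that] by (rule M.vs.subspace_scale[OF M.wspace_subspace])
      show "prj e (s' x) = x" if x: "x \<in> TL" for x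
      proof -
        have "prj e (t x) = x + x"
          using x i sD(4) hw sm sq by (simp add: t_def q.map_add q.map_scale q.map_act M.space_scale)
        moreover have "smul L (1/2) (x + x) = x"
          by (simp add: vs.scale_right_distrib flip: vs.scale_left_distrib)
        ultimately show ?thesis using ts[OF x] by (simp add: s'_def q.map_scale)
      qed
      show "s' x \<in> part E a" if x: "x \<in> TL" "x \<in> part L a" for a x
      proof -
        have "?H (s (?h x)) \<in> part E (1 + (1 + a))"
          using x by (intro M.X_part sD(5) hw X_part)
        then show ?thesis
          using x sD(5) by (auto simp: s'_def t_def intro!: M.part_scale M.part_add)
      qed
    qed
    moreover have "\<forall>k\<in>insert i F. \<forall>x\<in>TL.
        s' (X 1 k k x) = M.X 1 k k (s' x)"
      using ti tk ts by (simp add: s'_def M.act_scale)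
    ultimately show ?case by blast
  qed
  from this[of "{k. k < n \<and> lam k \<noteq> 0}"] show ?thesis by auto
qed

definition sect :: "'v \<Rightarrow> nat \<Rightarrow> complex" where
  "sect = (SOME s. is_section s \<and> (\<forall>k<n. lam k \<noteq> 0 \<longrightarrow>
     (\<forall>x\<in>TL. s (X 1 k k x) = M.X 1 k k (s x))))"

lemma sect_section: "is_section sect"
  and sect_comm: "k < n \<Longrightarrow> lam k \<noteq> 0 \<Longrightarrow> x \<in> TL \<Longrightarrow>
    sect (X 1 k k x) = M.X 1 k k (sect x)"
  using someI_ex[OF cartan_section] unfolding sect_def by blast+

lemmas sect = is_sectionD[OF sect_section]

lemma sect_space: "x \<in> TL \<Longrightarrow> sect x \<in> sm_space E"
  using sect(3) M.wspace_space by blast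

lemma sect_0 [simp]: "sect 0 = 0"
  using sect(2)[of 0 0] vs.subspace_0[OF wspace_subspace] by simp

text \<open>A submodule containing the weight space contains the kernel, which its own weight space
  generates, and it maps onto \<open>L\<close>, because \<open>sect\<close> lifts the weight space
  of \<open>L\<close> into it.\<close>

lemma mid_generates: "wspace_generates n lam E"
  unfolding wspace_generates_def
proof (intro allI impI)
  fix K assume "submod n E K \<and> TM \<subseteq> K"
  then have K: "submod n E K" "TM \<subseteq> K" by auto
  note sub = M.submodule_subspace[OF K(1)] and sp = M.submodule_subset[OF K(1)]
  have "submod n L {y \<in> sm_space L. inc e y \<in> K}" using i.submodule_preimage[OF K(1)] by simp
  moreover have "TL \<subseteq> {y \<in> sm_space L. inc e y \<in> K}"
    using K(2) inc_wspace wspace_space by auto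
  ultimately have inc: "inc e y \<in> K" if "y \<in> sm_space L" for y
    using wspace_generates that unfolding wspace_generates_def by blast
  have "TL \<subseteq> prj e ` K"
  proof
    fix x assume x: "x \<in> TL"
    show "x \<in> prj e ` K"
      using sect(3)[OF x] sect(4)[OF x, symmetric] K(2) by (intro image_eqI) auto
  qed
  then have im: "prj e ` K = sm_space L"
    using wspace_generates q.submodule_image[OF K(1)] by (simp add: wspace_generates_def)
  show "K = sm_space E"
  proof (intro equalityI sp subsetI)
    fix v assume v: "v \<in> sm_space E"
    then obtain k where k: "k \<in> K" "prj e v = prj e k" using im q.map_space by blast
    then have ks: "k \<in> sm_space E" using sp by auto
    obtain y where "y \<in> sm_space L" "v - k = inc e y"
      using inc_range[of "v - k"] k v ks by (auto simp: q.map_diff)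
    then have "v - k \<in> K" using inc by simp
    then show "v \<in> K" using M.vs.subspace_add[OF sub k(1)] by fastforce
  qed
qed

section \<open>The projection of the weight space to the kernel along the section\<close>

definition retract :: "(nat \<Rightarrow> complex) \<Rightarrow> 'v" where
  "retract v = (THE y. y \<in> sm_space L \<and> inc e y = v - sect (prj e v))"

lemma retract_eqI: "y \<in> sm_space L \<Longrightarrow> inc e y = v - sect (prj e v) \<Longrightarrow> retract v = y"
  unfolding retract_def by (rule the_equality) (metis inc_inject)+

lemma
  assumes v: "v \<in> TM"
  shows retract_wspace: "retract v \<in> TL"
    and inc_retract: "inc e (retract v) = v - sect (prj e v)"
proof -
  note pw = q.map_wspace[OF v]
  have dw: "v - sect (prj e v) \<in> TM"
    using v sect(3)[OF pw] by (rule M.vs.subspace_diff[OF M.wspace_subspace])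
  have "prj e (v - sect (prj e v)) = 0"
    using M.wspace_space[OF v] sect(4)[OF pw] sect_space[OF pw] by (simp add: q.map_diff)
  then obtain y where y: "y \<in> sm_space L" "v - sect (prj e v) = inc e y"
    using inc_range M.wspace_space[OF dw] by blast
  then have "retract v = y" by (intro retract_eqI) auto
  then show "retract v \<in> TL" "inc e (retract v) = v - sect (prj e v)"
    using y dw inc_wspaceD by auto
qed

lemma retract_inc: "y \<in> sm_space L \<Longrightarrow> retract (inc e y) = y"
  by (rule retract_eqI) auto

lemma retract_add:
  assumes "u \<in> TM" "v \<in> TM"
  shows "retract (u + v) = retract u + retract v"
  using assms retract_wspace[THEN wspace_space]
  by (intro retract_eqI)
    (auto simp: inc_add inc_retract q.map_add M.wspace_space sect(1) q.map_wspace)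

lemma retract_scale:
  assumes "v \<in> TM"
  shows "retract (smul E c v) = smul L c (retract v)"
  using assms retract_wspace[THEN wspace_space]
  by (intro retract_eqI)
    (auto simp: inc_scale inc_retract q.map_scale M.wspace_space sect(2) q.map_wspace
      M.vs.scale_right_diff_distrib)

lemma retract_part:
  assumes "v \<in> TM" "v \<in> part E (a + p)"
  shows "retract v \<in> part L a"
proof -
  have "v - sect (prj e v) \<in> part E (a + p)"
    using assms by (intro M.part_diff sect(5) q.map_wspace q.map_part)
  then show ?thesis
    using inc_part_iff[OF wspace_space[OF retract_wspace[OF assms(1)]]] inc_retract[OF assms(1)] by simp
qed

lemma retract_comm:
  assumes "v \<in> TM" "k < n" "lam k \<noteq> 0"
  shows "retract (M.X 1 k k v) = X 1 k k (retract v)"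
  using assms retract_wspace[THEN wspace_space]
  by (intro retract_eqI)
    (auto simp: inc_act inc_retract q.map_act M.wspace_space sect_comm q.map_wspace
      M.act_diff sect_space)

text \<open>For \<open>lam k = 0\<close> the vector h_k v already lies in the kernel, where
  \<open>retract\<close> inverts \<open>inc e\<close>.\<close>

lemma retract_zero:
  assumes "ext_scalar n lam L e c" "v \<in> TM" "k < n" "lam k = 0"
  shows "retract (M.X 1 k k v) = smul L c (parity_sign L (prj e v))"
  using assms wspace_space[OF q.map_wspace[OF assms(2)]]
  by (simp add: ext_scalar_def retract_inc space_scale)

end

section \<open>Lifting into an extension and the scalar of an extension\<close>

context self_extension
begin

text \<open>The common source of splittings (R = L), morphisms of extensions (R a middle term) and
  Baer sums (R a fibre product). \<open>rho\<close> is the kernel component of the lift and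
  \<open>sect\<close> supplies the rest; the last condition says that at zero coordinates
  \<open>rho\<close> must reproduce the scalar \<open>c\<close>.\<close>

lemma lift_exists:
  assumes R: "is_supermodule n R" "raising_trivial n lam R" "wspace_generates n lam R"
    and r: "r \<in> sm_hom n R L" and c: "ext_scalar n lam L e c"
    and rho_add: "\<And>u v. u \<in> wspace n lam R \<Longrightarrow> v \<in> wspace n lam R \<Longrightarrow> rho (u + v) = rho u + rho v"
    and rho_scale: "\<And>b v. v \<in> wspace n lam R \<Longrightarrow> rho (smul R b v) = smul L b (rho v)"
    and rho_wspace: "\<And>v. v \<in> wspace n lam R \<Longrightarrow> rho v \<in> TL"
    and rho_part: "\<And>v a. v \<in> wspace n lam R \<Longrightarrow> v \<in> part R (a + p) \<Longrightarrow> rho v \<in> part L a"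
    and rho_comm: "\<And>v k. v \<in> wspace n lam R \<Longrightarrow> k < n \<Longrightarrow> lam k \<noteq> 0 \<Longrightarrow>
      rho (unit_act n R 1 k k v) = X 1 k k (rho v)"
    and rho_zero: "\<And>v k. v \<in> wspace n lam R \<Longrightarrow> k < n \<Longrightarrow> lam k = 0 \<Longrightarrow>
      rho (unit_act n R 1 k k v) = smul L c (parity_sign L (r v))"
  shows "\<exists>F\<in>sm_hom n R E. (\<forall>t\<in>wspace n lam R. F t = inc e (rho t) + sect (r t)) \<and>
    (\<forall>v\<in>sm_space R. prj e (F v) = r v)"
proof -
  interpret r: sm_morphism n R L r by (rule sm_morphismI[OF R(1) is_supermodule r])
  define f where "f t = inc e (rho t) + sect (r t)" for t
  have rs: "rho t \<in> sm_space L" if "t \<in> wspace n lam R" for t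
    using wspace_space[OF rho_wspace[OF that]] .
  have rw: "r t \<in> TL" if "t \<in> wspace n lam R" for t
    using r.map_wspace[OF that] .
  have ts: "t \<in> sm_space R" if "t \<in> wspace n lam R" for t
    using r.V.wspace_space[OF that] .
  have fw: "f t \<in> TM" if "t \<in> wspace n lam R" for t
    unfolding f_def using that rho_wspace inc_wspace sect(3) rw
    by (intro M.vs.subspace_add[OF M.wspace_subspace]) auto
  have pf: "prj e (f t) = r t" if "t \<in> wspace n lam R" for t
    using rs[OF that] rw[OF that] sect(4)[OF rw[OF that]] sect_space[OF rw[OF that]]
    by (simp add: f_def q.map_add inc_space)
  have "f \<in> cartan_hom n lam R E"
    unfolding cartan_hom_def mem_Collect_eq
  proof (intro conjI ballI allI impI)
    show "f (u + v) = f u + f v" if "u \<in> wspace n lam R" "v \<in> wspace n lam R" for u v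
      using that by (simp add: f_def rho_add inc_add rs r.map_add ts sect(1) rw)
    show "f (smul R b v) = smul E b (f v)" if "v \<in> wspace n lam R" for b v
      using that by (simp add: f_def rho_scale inc_scale rs r.map_scale ts sect(2) rw
          M.vs.scale_right_distrib)
    show "f v \<in> part E a" if v: "v \<in> wspace n lam R" "v \<in> part R a" for a v
    proof -
      have "rho v \<in> part L (a + p)" using v by (intro rho_part) (auto simp: add.assoc)
      then have "inc e (rho v) \<in> part E a" using inc_part[of "rho v" "a + p"] by (simp add: add.assoc)
      then show ?thesis
        unfolding f_def using v by (intro M.part_add sect(5) rw r.map_part)
    qed
    show "f (unit_act n R 1 k k v) = M.X 1 k k (f v)" if k: "k < n" and v: "v \<in> wspace n lam R" for k v
    proof (cases "lam k = 0")
      case True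
      \<comment> \<open>h_k kills the weight space of \<open>L\<close>, so the section contributes
        nothing and both sides lie in the kernel.\<close>
      have "r (unit_act n R 1 k k v) = 0"
        using odd_diag_zero[OF k True rw[OF v]] r.map_act[OF qunit_queer ts[OF v]] by simp
      moreover have "M.X 1 k k (f v) = inc e (smul L c (parity_sign L (prj e (f v))))"
        using c k True fw[OF v] unfolding ext_scalar_def by blast
      ultimately show ?thesis
        using rho_zero[OF v k True] pf[OF v] by (simp add: f_def)
    next
      case False
      then show ?thesis
        using rho_comm[OF v k False] sect_comm[OF k False rw[OF v]] rs[OF v] ts[OF v]
          sect_space[OF rw[OF v]]
        by (simp add: f_def inc_act r.map_act M.act_add inc_space)
    qed
  qed (use fw in auto)
  then obtain F where F: "F \<in> sm_hom n R E" "\<forall>t\<in>wspace n lam R. F t = f t"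
    using cartan_hom_extends[OF R M.is_supermodule mid_raising_trivial mid_cogenerates] by blast
  have "(\<lambda>v. prj e (F v)) \<in> sm_hom n R L"
    by (rule sm_hom_comp[OF R(1) M.is_supermodule is_supermodule F(1) q.hom])
  then have "r v = prj e (F v)" if "v \<in> sm_space R" for v
    using R(3) by (rule r.eq_from_wspace) (use F(2) pf that in auto)
  then show ?thesis using F by (auto simp: f_def)
qed

lemma hom_eq_inc:
  assumes g: "g \<in> sm_hom n (shift p L) E"
    and y: "y \<in> sm_space L" and eq: "\<And>y. y \<in> TL \<Longrightarrow> g y = inc e (smul L a y)"
  shows "g y = inc e (smul L a y)"
proof -
  interpret g: sm_morphism n "shift p L" E g
    by (rule sm_morphismI[OF i.V.is_supermodule M.is_supermodule g])
  have h: "(\<lambda>y. smul E a (inc e y)) \<in> sm_hom n (shift p L) E"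
    by (rule sm_hom_scale[OF i.V.is_supermodule M.is_supermodule i.hom])
  have "g y = smul E a (inc e y)"
    using h by (rule g.eq_from_wspace[of _ lam]) (use eq y wspace_generates wspace_space inc_scale in auto)
  then show ?thesis using y inc_scale by simp
qed

text \<open>Lift the identity of \<open>L\<close>: with scalar 0 the kernel component 0 is
  admissible.\<close>

lemma scalar_zero_splits:
  assumes "ext_scalar n lam L e 0"
  shows "e \<in> split_extensions n L (shift p L)"
proof -
  have "(\<lambda>x. x) \<in> sm_hom n L L" by (simp add: sm_hom_def)
  then obtain F where "F \<in> sm_hom n L E" "\<forall>v\<in>sm_space L. prj e (F v) = v"
    using lift_exists[OF is_supermodule raising_trivial wspace_generates, of "\<lambda>x. x" 0 "\<lambda>_. 0"]
      assms vs.subspace_0[OF wspace_subspace] by auto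
  then show ?thesis using ext by (auto simp: split_extensions_def)
qed

text \<open>Measures how far \<open>sect\<close> is from commuting with h_j. The parity sign in
  front turns anticommutation with the other odd diagonal elements into commutation.\<close>

definition slope :: "nat \<Rightarrow> 'v \<Rightarrow> 'v" where
  "slope j x = retract (M.X 1 j j (sect (parity_sign L x)))"

text \<open>h_j kills the weight space of \<open>L\<close>, so applied to a lift it lands in the
  kernel. Both h_j and the parity sign anticommute with h_k, so their composite commutes with it.
  The shift is 1 from the odd h_j plus p from the kernel.\<close>

lemma
  assumes j: "j < n" "lam j = 0"
  shows inc_slope: "x \<in> TL \<Longrightarrow>
      inc e (slope j x) = M.X 1 j j (sect (parity_sign L x))"
    and slope_cartan: "slope j \<in> cartan_hom n lam L (shift (1 + p) L)"
proof -
  let ?H = "M.X 1 j j" and ?d = "parity_sign L"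
  have sd: "sect (?d x) \<in> TM" if "x \<in> TL" for x
    using sect(3)[OF wspace_parity_sign[OF that]] .
  have sds: "sect (?d x) \<in> sm_space E" if "x \<in> TL" for x
    using M.wspace_space[OF sd[OF that]] .
  have Hw: "?H (sect (?d x)) \<in> TM" if "x \<in> TL" for x
    using sd[OF that] j(1) by (rule M.wspace_X_diag)
  have w: "slope j x \<in> TL" if "x \<in> TL" for x
    unfolding slope_def using Hw[OF that] by (rule retract_wspace)
  show inc: "inc e (slope j x) = ?H (sect (?d x))" if x: "x \<in> TL" for x
  proof -
    have "prj e (?H (sect (?d x))) = X 1 j j (?d x)"
      using q.map_act[OF qunit_queer sds[OF x]] sect(4)[OF wspace_parity_sign[OF x]] by simp
    also have "\<dots> = 0" using odd_diag_zero[OF j wspace_parity_sign[OF x]] .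
    finally show ?thesis using inc_retract[OF Hw[OF x]] by (simp add: slope_def)
  qed
  have space: "x \<in> sm_space L" "?d x \<in> TL" if "x \<in> TL" for x
    using that wspace_space wspace_parity_sign by auto
  show "slope j \<in> cartan_hom n lam L (shift (1 + p) L)"
    unfolding cartan_hom_def mem_Collect_eq
  proof (intro conjI ballI allI impI)
    show "slope j (u + v) = slope j u + slope j v" if "u \<in> TL" "v \<in> TL" for u v
      using that sds Hw space
      by (simp add: slope_def parity_sign_add sect(1) M.act_add retract_add)
    show "slope j (smul L b v) = smul (shift (1 + p) L) b (slope j v)" if "v \<in> TL" for b v
      using that sds Hw space
      by (simp add: slope_def parity_sign_scale sect(2) M.act_scale retract_scale)
    show "slope j v \<in> wspace n lam (shift (1 + p) L)" if "v \<in> TL" for v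
      using w[OF that] by simp
    show "slope j v \<in> part (shift (1 + p) L) a" if "v \<in> TL" "v \<in> part L a" for a v
    proof -
      have "?H (sect (?d v)) \<in> part E (1 + a)"
        using that by (intro M.X_part sect(5) space parity_sign_in_part)
      then have "?H (sect (?d v)) \<in> part E ((a + (1 + p)) + p)"
        by (simp add: add.assoc add.commute[of 1 a])
      then show ?thesis unfolding slope_def shift_simps by (intro retract_part Hw that)
    qed
    show "slope j (X 1 k k v) = unit_act n (shift (1 + p) L) 1 k k (slope j v)"
      if k: "k < n" and v: "v \<in> TL" for k v
    proof (cases "lam k = 0")
      case True
      \<comment> \<open>For \<open>lam k = 0\<close> both sides vanish, since h_k kills the weight
        space of \<open>L\<close>.\<close>
      have "slope j 0 = 0"
        using inc[of 0] w[of 0] vs.subspace_0[OF wspace_subspace] parity_sign_scale[of 0 0]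
          inc_eq_0[of "slope j 0"] wspace_space[of "slope j 0" lam] by simp
      then show ?thesis using odd_diag_zero[OF k True v] odd_diag_zero[OF k True w[OF v]] by simp
    next
      case False
      have kj: "k \<noteq> j" using False j by auto
      let ?h = "X 1 k k" and ?G = "M.X 1 k k"
      have dh: "?d (?h v) = ?h (smul L (- 1) (?d v))"
        using parity_sign_act[OF qunit_part, of v 1] space[OF v] by (simp add: act_neg)
      have nd: "smul L (- 1) (?d v) \<in> TL"
        using space(2)[OF v] by (rule vs.subspace_scale[OF wspace_subspace])
      have "?H (sect (?d (?h v))) = ?H (?G (smul E (- 1) (sect (?d v))))"
        using sect_comm[OF k False nd] sect(2)[OF space(2)[OF v], of "- 1"] dh by simp
      also have "\<dots> = ?G (?H (sect (?d v)))"
        using M.odd_diag_anticommute[of "sect (?d v)" j k] k j kj sds[OF v]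
        by (simp add: M.act_neg)
      finally show ?thesis
        using retract_comm[OF Hw[OF v] k False] by (simp add: slope_def)
    qed
  qed
qed

text \<open>A weight vector is a kernel part, killed by h_j, plus a lift, on which h_j is the slope
  taken at the parity sign of the projection; the sign reappears because it is an involution.
  \<open>odd_diag_eq\<close> carries the result to the other zero coordinates.\<close>

lemma scalar_from_slope:
  assumes j: "j < n" "lam j = 0" and c: "\<And>x. x \<in> TL \<Longrightarrow> slope j x = smul L c x"
  shows "ext_scalar n lam L e c"
  unfolding ext_scalar_def
proof (intro allI impI ballI)
  fix k v assume k: "k < n" "lam k = 0" and v: "v \<in> TM"
  have fin: "finite_dimensional E" using mid_obj by (simp add: queer_category_obj_def)
  let ?H = "M.X 1 j j" and ?x = "prj e v"
  have x: "?x \<in> TL" by (rule q.map_wspace[OF v])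
  have rv: "retract v \<in> TL" by (rule retract_wspace[OF v])
  have "?H (inc e (retract v)) = 0"
    using inc_act[OF qunit_queer wspace_space[OF rv], of 1 j j] odd_diag_zero[OF j rv] i.map_zero by simp
  moreover have "?H (sect ?x) = inc e (smul L c (parity_sign L ?x))"
    using inc_slope[OF j wspace_parity_sign[OF x]] parity_sign_invol[OF wspace_space[OF x]]
      c[OF wspace_parity_sign[OF x]] by simp
  moreover have "v = inc e (retract v) + sect ?x" using inc_retract[OF v] by simp
  ultimately have "?H v = inc e (smul L c (parity_sign L ?x))"
    using M.act_add[OF qunit_queer inc_space[OF wspace_space[OF rv]] sect_space[OF x], of 1 j j]
    by simp
  then show "M.X 1 k k v = inc e (smul L c (parity_sign L ?x))"
    using M.odd_diag_eq[OF fin mid_raising_trivial k(1) j(1) k(2) j(2) v] by simp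
qed

text \<open>For p = 1 the two parity shifts cancel, so the slope is a Cartan endomorphism and hence
  a scalar. Without zero coordinates any \<open>c\<close> serves.\<close>

lemma scalar_exists:
  assumes "p = 1"
  shows "\<exists>c. ext_scalar n lam L e c"
proof (cases "\<exists>j<n. lam j = 0")
  case True
  then obtain j where j: "j < n" "lam j = 0" by blast
  have "slope j \<in> cartan_hom n lam L L"
    using slope_cartan[OF j] assms by simp
  then show ?thesis using cartan_schur scalar_from_slope[OF j] by blast
qed (auto simp: ext_scalar_def)

text \<open>For p = 0 the slope maps to the parity change, and there Schur's lemma leaves only
  0.\<close>

lemma scalar_zero:
  assumes "p = 0" "\<not> sm_isomorphic n L (shift 1 L)"
  shows "ext_scalar n lam L e 0"
proof (cases "\<exists>j<n. lam j = 0")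
  case True
  then obtain j where j: "j < n" "lam j = 0" by blast
  have "slope j \<in> cartan_hom n lam L (shift 1 L)"
    using slope_cartan[OF j] assms by simp
  then show ?thesis
    using cartan_schur_shift assms(2) scalar_from_slope[OF j, of 0] by simp
qed (auto simp: ext_scalar_def)

text \<open>One vector with non-zero projection is enough to read off the scalar, since
  \<open>inc e\<close> and the parity sign are injective.\<close>

lemma scalar_unique_aux:
  assumes j: "j < n" "lam j = 0" and v: "v \<in> TM"
    and x: "x \<in> sm_space L" "prj e v = x" "x \<noteq> 0"
    and c: "ext_scalar n lam L e c"
    and d: "M.X 1 j j v = inc e (smul L d (parity_sign L x))"
  shows "c = d"
proof -
  have "inc e (smul L c (parity_sign L x)) = inc e (smul L d (parity_sign L x))"
    using c j v d x unfolding ext_scalar_def by metis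
  then have "smul L c (parity_sign L x) = smul L d (parity_sign L x)"
    using x by (subst (asm) inc_inject) auto
  moreover have "parity_sign L x \<noteq> 0"
    using parity_sign_invol[OF x(1)] x(3) parity_sign_scale[of 0 0] by auto
  ultimately show ?thesis by simp
qed

lemma scalar_unique:
  assumes "j < n" "lam j = 0" "ext_scalar n lam L e c" "ext_scalar n lam L e d"
  shows "c = d"
proof -
  obtain x where x: "x \<in> TL" "x \<noteq> 0" using wspace_nonzero by blast
  show ?thesis
    using assms(4) assms(1,2) sect(3)[OF x(1)] sect(4)[OF x(1)] wspace_space[OF x(1)] x(2)
    by (intro scalar_unique_aux[OF assms(1,2) sect(3)[OF x(1)] _ _ _ assms(3)])
      (auto simp: ext_scalar_def)
qed

end

section \<open>Morphisms between extensions and Baer sums\<close>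

context simple_hw
begin

text \<open>The kernel component is \<open>a\<close> times the retraction of \<open>e1\<close>,
  which multiplies the scalar by \<open>a\<close>. The case a = 1 gives equivalences, general a the
  scalar multiplication of Ext.\<close>

lemma ext_morphism_exists:
  assumes e1: "e1 \<in> extensions n L (shift p L)" "ext_scalar n lam L e1 c"
    and e: "e \<in> extensions n L (shift p L)" "ext_scalar n lam L e (a * c)"
  shows "\<exists>f\<in>sm_hom n (mid e1) (mid e). (\<forall>y\<in>sm_space L. f (inc e1 y) = inc e (smul L a y)) \<and>
    (\<forall>v\<in>sm_space (mid e1). prj e (f v) = prj e1 v)"
proof -
  interpret e1: self_extension n lam L p e1 by unfold_locales (rule e1)
  interpret e: self_extension n lam L p e by unfold_locales (rule e)
  have "\<exists>F\<in>sm_hom n (mid e1) (mid e).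
    (\<forall>t\<in>wspace n lam (mid e1). F t = inc e (smul L a (e1.retract t)) + e.sect (prj e1 t)) \<and>
    (\<forall>v\<in>sm_space (mid e1). prj e (F v) = prj e1 v)"
    using wspace_space[OF e1.retract_wspace]
    by (intro e.lift_exists[OF e1.M.is_supermodule e1.mid_raising_trivial e1.mid_generates e1.q.hom e(2)])
      (auto simp: e1.retract_add e1.retract_scale e1.retract_comm e1.retract_zero[OF e1(2)]
        e1.retract_wspace act_scale vs.scale_right_distrib mult.commute
        intro!: vs.subspace_scale[OF wspace_subspace] part_scale e1.retract_part)
  then obtain F where F: "F \<in> sm_hom n (mid e1) (mid e)"
    "\<And>t. t \<in> wspace n lam (mid e1) \<Longrightarrow>
      F t = inc e (smul L a (e1.retract t)) + e.sect (prj e1 t)"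
    "\<forall>v\<in>sm_space (mid e1). prj e (F v) = prj e1 v" by blast
  have "(\<lambda>y. F (inc e1 y)) \<in> sm_hom n (shift p L) (mid e)"
    by (rule sm_hom_comp[OF e1.i.V.is_supermodule e1.M.is_supermodule e.M.is_supermodule e1.i.hom F(1)])
  then have "F (inc e1 y) = inc e (smul L a y)" if "y \<in> sm_space L" for y
    using that
    by (rule e.hom_eq_inc)
      (simp add: F(2) e1.inc_wspace e1.retract_inc wspace_space)
  then show ?thesis using F by blast
qed

text \<open>Push one lifted weight vector through \<open>f\<close> and compare the two descriptions
  of h_j on its image.\<close>

lemma ext_morphism_scalar:
  assumes j: "j < n" "lam j = 0"
    and e1: "e1 \<in> extensions n L (shift p L)" "ext_scalar n lam L e1 c1"
    and e: "e \<in> extensions n L (shift p L)" "ext_scalar n lam L e c"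
    and f: "f \<in> sm_hom n (mid e1) (mid e)" "\<forall>y\<in>sm_space L. f (inc e1 y) = inc e (smul L a y)"
      "\<forall>v\<in>sm_space (mid e1). prj e (f v) = prj e1 v"
  shows "c = a * c1"
proof -
  interpret e1: self_extension n lam L p e1 by unfold_locales (rule e1)
  interpret e: self_extension n lam L p e by unfold_locales (rule e)
  interpret f: sm_morphism n "mid e1" "mid e" f
    by (rule sm_morphismI[OF e1.M.is_supermodule e.M.is_supermodule f(1)])
  obtain x where x: "x \<in> TL" "x \<noteq> 0" using wspace_nonzero by blast
  let ?v = "e1.sect x"
  have v: "?v \<in> wspace n lam (mid e1)" "prj e1 ?v = x" "?v \<in> sm_space (mid e1)"
    using e1.sect(3,4)[OF x(1)] e1.M.wspace_space by auto
  have xs: "x \<in> sm_space L" by (rule wspace_space[OF x(1)])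
  have "unit_act n (mid e1) 1 j j ?v = inc e1 (smul L c1 (parity_sign L x))"
    using e1(2) j v unfolding ext_scalar_def by metis
  then have "unit_act n (mid e) 1 j j (f ?v) = inc e (smul L (a * c1) (parity_sign L x))"
    using f.map_act[OF qunit_queer v(3), of 1 j j] f(2) xs by (simp add: space_scale)
  moreover have "prj e (f ?v) = x" using f(3) v by simp
  ultimately show ?thesis
    using e.scalar_unique_aux[OF j f.map_wspace[OF v(1)] xs _ x(2) e(2)] by blast
qed

text \<open>The two inclusions embed both kernels into the fibre product, and the quotient by their
  sum is \<open>L\<close>. A submodule with all weight vectors contains both kernels and maps onto
  \<open>L\<close>, as in \<open>mid_generates\<close>.\<close>

lemma
  assumes e1: "e1 \<in> extensions n L (shift p L)" and e2: "e2 \<in> extensions n L (shift p L)"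
  shows fibre_product_extensions: "fibre_product n (mid e1) (mid e2) L (prj e1) (prj e2)"
    and fibre_product_inl: "(\<lambda>y. (inc e1 y, 0)) \<in> sm_hom n (shift p L) (pullback (prj e1) (prj e2) (mid e1) (mid e2))"
    and fibre_product_inr: "(\<lambda>y. (0, inc e2 y)) \<in> sm_hom n (shift p L) (pullback (prj e1) (prj e2) (mid e1) (mid e2))"
    and fibre_product_generates: "wspace_generates n lam (pullback (prj e1) (prj e2) (mid e1) (mid e2))"
proof -
  interpret e1: self_extension n lam L p e1 by unfold_locales (rule e1)
  interpret e2: self_extension n lam L p e2 by unfold_locales (rule e2)
  interpret D: fibre_product n "mid e1" "mid e2" L "prj e1" "prj e2" by unfold_locales
  show "fibre_product n (mid e1) (mid e2) L (prj e1) (prj e2)" by unfold_locales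
  have z: "inc e1 0 = 0" "inc e2 0 = 0" using e1.i.map_zero e2.i.map_zero by auto
  show l: "(\<lambda>y. (inc e1 y, 0)) \<in> sm_hom n (shift p L) D.P"
    using e1.inc_part part_subset
    by (intro sm_homI e1.i.V.is_supermodule D.P_supermodule)
      (auto simp: e1.inc_add e1.inc_scale D.P_smul D.P_part D.P_act e1.inc_act
        e1.i.map_part[of _ "a + p" for a, simplified add.assoc bit_add_self] intro: e1.i.map_part)
  show r: "(\<lambda>y. (0, inc e2 y)) \<in> sm_hom n (shift p L) D.P"
    using e2.inc_part part_subset
    by (intro sm_homI e1.i.V.is_supermodule D.P_supermodule)
      (auto simp: e2.inc_add e2.inc_scale D.P_smul D.P_part D.P_act e2.inc_act intro: e2.i.map_part)
  interpret l: sm_morphism n "shift p L" D.P "\<lambda>y. (inc e1 y, 0)"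
    by (rule sm_morphismI[OF e1.i.V.is_supermodule D.P_supermodule l])
  interpret r: sm_morphism n "shift p L" D.P "\<lambda>y. (0, inc e2 y)"
    by (rule sm_morphismI[OF e1.i.V.is_supermodule D.P_supermodule r])
  have t: "(\<lambda>v. prj e1 (fst v)) \<in> sm_hom n D.P L"
    by (rule sm_hom_comp[OF D.P_supermodule e1.M.is_supermodule is_supermodule D.fst_hom e1.q.hom])
  interpret t: sm_morphism n D.P L "\<lambda>v. prj e1 (fst v)"
    by (rule sm_morphismI[OF D.P_supermodule is_supermodule t])
  show "wspace_generates n lam D.P"
    unfolding wspace_generates_def
  proof (intro allI impI)
    fix K assume "submod n D.P K \<and> wspace n lam D.P \<subseteq> K"
    then have K: "submod n D.P K" "wspace n lam D.P \<subseteq> K" by auto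
    note sub = D.P.submodule_subspace[OF K(1)] and sp = D.P.submodule_subset[OF K(1)]
    have all: "L' = sm_space L" if "submod n L L'" "TL \<subseteq> L'" for L'
      using wspace_generates that by (simp add: wspace_generates_def)
    have "{y \<in> sm_space L. (inc e1 y, 0) \<in> K} = sm_space L"
      using l.submodule_preimage[OF K(1)] l.map_wspace[of _ lam] K(2) wspace_space by (intro all) auto
    then have kl: "(inc e1 y, 0) \<in> K" if "y \<in> sm_space L" for y using that by blast
    have "{y \<in> sm_space L. (0, inc e2 y) \<in> K} = sm_space L"
      using r.submodule_preimage[OF K(1)] r.map_wspace[of _ lam] K(2) wspace_space by (intro all) auto
    then have kr: "(0, inc e2 y) \<in> K" if "y \<in> sm_space L" for y using that by blast
    have im: "(\<lambda>v. prj e1 (fst v)) ` K = sm_space L"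
    proof (rule all[OF t.submodule_image[OF K(1)]])
      show "TL \<subseteq> (\<lambda>v. prj e1 (fst v)) ` K"
      proof
        fix x assume x: "x \<in> TL"
        have "(e1.sect x, e2.sect x) \<in> K"
          using K(2) e1.sect(3,4)[OF x] e2.sect(3,4)[OF x] by (auto simp: D.P_wspace)
        then show "x \<in> (\<lambda>v. prj e1 (fst v)) ` K"
          using e1.sect(4)[OF x] by force
      qed
    qed
    show "K = sm_space D.P"
    proof (intro equalityI sp subsetI)
      fix u assume "u \<in> sm_space D.P"
      then obtain v w where u: "u = (v, w)" "v \<in> sm_space (mid e1)" "w \<in> sm_space (mid e2)"
        "prj e1 v = prj e2 w"
        by (cases u) (auto simp: D.P_space)
      have "prj e1 v \<in> (\<lambda>v. prj e1 (fst v)) ` K"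
        unfolding im using u(2) by (rule e1.q.map_space)
      then obtain v' w' where k: "(v', w') \<in> K" "prj e1 v' = prj e1 v" by force
      then have k': "v' \<in> sm_space (mid e1)" "w' \<in> sm_space (mid e2)" "prj e1 v' = prj e2 w'"
        using sp by (auto simp: D.P_space)
      obtain y z where yz: "y \<in> sm_space L" "v - v' = inc e1 y" "z \<in> sm_space L" "w - w' = inc e2 z"
        using e1.inc_range[of "v - v'"] e2.inc_range[of "w - w'"] u k k'
        by (auto simp: e1.q.map_diff e2.q.map_diff)
      have "(v', w') + ((inc e1 y, 0) + (0, inc e2 z)) \<in> K"
        by (intro D.P.vs.subspace_add[OF sub] k kl kr yz)
      then show "u \<in> K" using u(1) yz(2,4)[symmetric] by simp
    qed
  qed
qed

text \<open>The kernel component is the sum of the two retractions; at zero coordinates this adds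
  the two scalars.\<close>

lemma baer_morphism_exists:
  assumes e1: "e1 \<in> extensions n L (shift p L)" "ext_scalar n lam L e1 c1"
    and e2: "e2 \<in> extensions n L (shift p L)" "ext_scalar n lam L e2 c2"
    and e: "e \<in> extensions n L (shift p L)" "ext_scalar n lam L e (c1 + c2)"
  defines "P \<equiv> pullback (prj e1) (prj e2) (mid e1) (mid e2)"
  shows "\<exists>f\<in>sm_hom n P (mid e).
    (\<forall>y\<in>sm_space L. \<forall>z\<in>sm_space L. f (inc e1 y, inc e2 z) = inc e (y + z)) \<and>
    (\<forall>(v, w)\<in>sm_space P. prj e (f (v, w)) = prj e1 v)"
proof -
  interpret e1: self_extension n lam L p e1 by unfold_locales (rule e1)
  interpret e2: self_extension n lam L p e2 by unfold_locales (rule e2)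
  interpret e: self_extension n lam L p e by unfold_locales (rule e)
  interpret D: fibre_product n "mid e1" "mid e2" L "prj e1" "prj e2"
    by (rule fibre_product_extensions[OF e1(1) e2(1)])
  note inl = fibre_product_inl[OF e1(1) e2(1)] and inr = fibre_product_inr[OF e1(1) e2(1)]
  have t: "(\<lambda>v. prj e1 (fst v)) \<in> sm_hom n D.P L"
    by (rule sm_hom_comp[OF D.P_supermodule e1.M.is_supermodule is_supermodule D.fst_hom e1.q.hom])
  define rho where "rho v = e1.retract (fst v) + e2.retract (snd v)" for v
  have "\<exists>F\<in>sm_hom n D.P (mid e).
    (\<forall>t\<in>wspace n lam D.P. F t = inc e (rho t) + e.sect (prj e1 (fst t))) \<and>
    (\<forall>v\<in>sm_space D.P. prj e (F v) = prj e1 (fst v))"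
  proof (rule e.lift_exists[OF D.P_supermodule _ fibre_product_generates[OF e1(1) e2(1)] t e(2)])
    show "raising_trivial n lam D.P"
      by (rule D.P_raising_trivial[OF e1.mid_raising_trivial e2.mid_raising_trivial])
    fix v assume "v \<in> wspace n lam D.P"
    then obtain v1 v2 where v: "v = (v1, v2)" "v1 \<in> wspace n lam (mid e1)" "v2 \<in> wspace n lam (mid e2)"
      "prj e1 v1 = prj e2 v2"
      by (cases v) (auto simp: D.P_wspace)
    note rw = e1.retract_wspace[OF v(2)] e2.retract_wspace[OF v(3)]
    show "rho v \<in> TL"
      using vs.subspace_add[OF wspace_subspace rw] by (simp add: rho_def v(1))
    show "rho (smul D.P b v) = smul L b (rho v)" for b
      using e1.retract_scale[OF v(2)] e2.retract_scale[OF v(3)]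
      by (simp add: rho_def v(1) D.P_smul vs.scale_right_distrib)
    show "rho v \<in> part L a" if "v \<in> part D.P (a + p)" for a
      using that e1.retract_part[OF v(2)] e2.retract_part[OF v(3)]
      by (auto simp: rho_def v(1) D.P_part intro: part_add)
    show "rho (unit_act n D.P 1 k k v) = X 1 k k (rho v)" if "k < n" "lam k \<noteq> 0" for k
      using e1.retract_comm[OF v(2) that] e2.retract_comm[OF v(3) that]
        act_add[OF qunit_queer wspace_space[OF rw(1)] wspace_space[OF rw(2)]]
      by (simp add: rho_def v(1) D.P_act)
    show "rho (unit_act n D.P 1 k k v) = smul L (c1 + c2) (parity_sign L (prj e1 (fst v)))"
      if "k < n" "lam k = 0" for k
      using e1.retract_zero[OF e1(2) v(2) that] e2.retract_zero[OF e2(2) v(3) that] v(4)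
      by (simp add: rho_def v(1) D.P_act vs.scale_left_distrib)
    show "rho (v + u) = rho v + rho u" if u: "u \<in> wspace n lam D.P" for u
    proof -
      obtain u1 u2 where "u = (u1, u2)" "u1 \<in> wspace n lam (mid e1)" "u2 \<in> wspace n lam (mid e2)"
        using u by (cases u) (auto simp: D.P_wspace)
      then show ?thesis
        using e1.retract_add[OF v(2), of u1] e2.retract_add[OF v(3), of u2]
        by (simp add: rho_def v(1) algebra_simps)
    qed
  qed
  then obtain F where F: "F \<in> sm_hom n D.P (mid e)"
    "\<And>t. t \<in> wspace n lam D.P \<Longrightarrow> F t = inc e (rho t) + e.sect (prj e1 (fst t))"
    "\<And>v. v \<in> sm_space D.P \<Longrightarrow> prj e (F v) = prj e1 (fst v)" by blast
  interpret F: sm_morphism n D.P "mid e" F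
    by (rule sm_morphismI[OF D.P_supermodule e.M.is_supermodule F(1)])
  interpret l: sm_morphism n "shift p L" D.P "\<lambda>y. (inc e1 y, 0)"
    by (rule sm_morphismI[OF e1.i.V.is_supermodule D.P_supermodule inl])
  interpret r: sm_morphism n "shift p L" D.P "\<lambda>y. (0, inc e2 y)"
    by (rule sm_morphismI[OF e1.i.V.is_supermodule D.P_supermodule inr])
  have r0: "e1.retract 0 = 0" "e2.retract 0 = 0"
    using e1.retract_inc[of 0] e2.retract_inc[of 0] e1.i.map_zero e2.i.map_zero by simp_all
  have Fl: "F (inc e1 y, 0) = inc e (smul L 1 y)" if "y \<in> sm_space L" for y
    using sm_hom_comp[OF e1.i.V.is_supermodule D.P_supermodule e.M.is_supermodule inl F(1)] that
  proof (rule e.hom_eq_inc)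
    fix y assume y: "y \<in> TL"
    show "F (inc e1 y, 0) = inc e (smul L 1 y)"
      using F(2)[of "(inc e1 y, 0)"] l.map_wspace[of y lam] y wspace_space[OF y]
      by (simp add: rho_def e1.retract_inc r0)
  qed
  have Fr: "F (0, inc e2 y) = inc e (smul L 1 y)" if "y \<in> sm_space L" for y
    using sm_hom_comp[OF e1.i.V.is_supermodule D.P_supermodule e.M.is_supermodule inr F(1)] that
  proof (rule e.hom_eq_inc)
    fix y assume y: "y \<in> TL"
    show "F (0, inc e2 y) = inc e (smul L 1 y)"
      using F(2)[of "(0, inc e2 y)"] r.map_wspace[of y lam] y wspace_space[OF y]
      by (simp add: rho_def e2.retract_inc r0)
  qed
  have "F (inc e1 y, inc e2 z) = inc e (y + z)" if "y \<in> sm_space L" "z \<in> sm_space L" for y z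
    using F.map_add[of "(inc e1 y, 0)" "(0, inc e2 z)"] l.map_space[of y] r.map_space[of z] that
    by (simp add: Fl Fr e.inc_add)
  then show ?thesis
    unfolding P_def using F(1,3) by (intro bexI[of _ F]) auto
qed

text \<open>Evaluate on the pair of lifts of one weight vector: h_j moves it into the two kernels,
  and \<open>f\<close> adds the contributions.\<close>

lemma baer_morphism_scalar:
  assumes j: "j < n" "lam j = 0"
    and e1: "e1 \<in> extensions n L (shift p L)" "ext_scalar n lam L e1 c1"
    and e2: "e2 \<in> extensions n L (shift p L)" "ext_scalar n lam L e2 c2"
    and e: "e \<in> extensions n L (shift p L)" "ext_scalar n lam L e c"
    and f: "f \<in> sm_hom n (pullback (prj e1) (prj e2) (mid e1) (mid e2)) (mid e)"
      "\<forall>y\<in>sm_space L. \<forall>z\<in>sm_space L. f (inc e1 y, inc e2 z) = inc e (y + z)"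
      "\<forall>(v, w)\<in>sm_space (pullback (prj e1) (prj e2) (mid e1) (mid e2)). prj e (f (v, w)) = prj e1 v"
  shows "c = c1 + c2"
proof -
  interpret e1: self_extension n lam L p e1 by unfold_locales (rule e1)
  interpret e2: self_extension n lam L p e2 by unfold_locales (rule e2)
  interpret e: self_extension n lam L p e by unfold_locales (rule e)
  interpret D: fibre_product n "mid e1" "mid e2" L "prj e1" "prj e2"
    by (rule fibre_product_extensions[OF e1(1) e2(1)])
  interpret f: sm_morphism n D.P "mid e" f
    by (rule sm_morphismI[OF D.P_supermodule e.M.is_supermodule f(1)])
  obtain x where x: "x \<in> TL" "x \<noteq> 0" using wspace_nonzero by blast
  have xs: "x \<in> sm_space L" by (rule wspace_space[OF x(1)])
  let ?v = "e1.sect x" and ?w = "e2.sect x"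
  have v: "?v \<in> wspace n lam (mid e1)" "prj e1 ?v = x" and w: "?w \<in> wspace n lam (mid e2)" "prj e2 ?w = x"
    using e1.sect(3,4)[OF x(1)] e2.sect(3,4)[OF x(1)] by auto
  have vw: "(?v, ?w) \<in> wspace n lam D.P" using v w by (simp add: D.P_wspace)
  note vws = D.P.wspace_space[OF vw]
  have "unit_act n (mid e1) 1 j j ?v = inc e1 (smul L c1 (parity_sign L x))"
    "unit_act n (mid e2) 1 j j ?w = inc e2 (smul L c2 (parity_sign L x))"
    using e1(2) e2(2) j v w unfolding ext_scalar_def by metis+
  then have "unit_act n (mid e) 1 j j (f (?v, ?w)) = inc e (smul L (c1 + c2) (parity_sign L x))"
    using f.map_act[OF qunit_queer vws, of 1 j j] f(2) xs
    by (simp add: D.P_act space_scale vs.scale_left_distrib)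
  moreover have "prj e (f (?v, ?w)) = x" using f(3) vws v by auto
  ultimately show ?thesis
    using e.scalar_unique_aux[OF j f.map_wspace[OF vw] xs _ x(2) e(2)] by blast
qed

end

section \<open>Realising supermodules on coordinate space\<close>

abbreviation even_invariant where "even_invariant n \<equiv> invariant_subspace (queer_part n 0)"

lemma semisimple_over_evenE:
  assumes "semisimple_over_even n V" "even_invariant n V W"
  obtains W' where "even_invariant n V W'" "W \<inter> W' = {0}"
    "{w + w' |w w'. w \<in> W \<and> w' \<in> W'} = sm_space V"
  using assms(1)[unfolded semisimple_over_even_def, rule_format, OF assms(2)] by (elim exE conjE)

text \<open>Middle terms must live in \<open>nat \<Rightarrow> complex\<close>, whereas the twisted
  sum lives on pairs; the module structure is carried over along linear coordinates \<Phi>, with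
  \<Psi> undoing them.\<close>

locale sm_transport = supermod n V for n and V :: "'w::ab_group_add supermodule" +
  fixes \<Phi> :: "'w \<Rightarrow> nat \<Rightarrow> complex" and \<Psi> :: "(nat \<Rightarrow> complex) \<Rightarrow> 'w"
  assumes \<Phi>_add: "\<And>u v. u \<in> sm_space V \<Longrightarrow> v \<in> sm_space V \<Longrightarrow> \<Phi> (u + v) = \<Phi> u + \<Phi> v"
    and \<Phi>_scale: "\<And>c v. v \<in> sm_space V \<Longrightarrow> \<Phi> (smul V c v) = (\<lambda>k. c * \<Phi> v k)"
    and \<Psi>_\<Phi>: "\<And>v. v \<in> sm_space V \<Longrightarrow> \<Psi> (\<Phi> v) = v"
begin

definition image :: "(nat \<Rightarrow> complex) supermodule" where
  "image = \<lparr>smul = \<lambda>c w k. c * w k, part = \<lambda>a. \<Phi> ` part V a, act = \<lambda>x w. \<Phi> (act V x (\<Psi> w))\<rparr>"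

lemma image_simps [simp]:
  "smul image = (\<lambda>c w k. c * w k)" "part image a = \<Phi> ` part V a" "act image x w = \<Phi> (act V x (\<Psi> w))"
  by (simp_all add: image_def)

lemma \<Phi>_smul: "v \<in> sm_space V \<Longrightarrow> \<Phi> (smul V c v) = smul image c (\<Phi> v)"
  by (simp add: \<Phi>_scale)

lemma \<Phi>_0: "\<Phi> 0 = 0"
  using \<Phi>_add[of 0 0] by simp

lemma \<Phi>_diff: "u \<in> sm_space V \<Longrightarrow> v \<in> sm_space V \<Longrightarrow> \<Phi> (u - v) = \<Phi> u - \<Phi> v"
  using \<Phi>_add[of "u - v" v] by (simp add: space_diff)

lemma \<Phi>_inject: "u \<in> sm_space V \<Longrightarrow> v \<in> sm_space V \<Longrightarrow> \<Phi> u = \<Phi> v \<longleftrightarrow> u = v"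
  using \<Psi>_\<Phi> by metis

lemma sm_space_image: "sm_space image = \<Phi> ` sm_space V"
proof
  show "sm_space image \<subseteq> \<Phi> ` sm_space V"
  proof
    fix w assume "w \<in> sm_space image"
    then obtain u v where "u \<in> part V 0" "v \<in> part V 1" "w = \<Phi> u + \<Phi> v"
      by (auto simp: sm_space_def[of image])
    then show "w \<in> \<Phi> ` sm_space V"
      using \<Phi>_add[of u v] part_subset by (metis image_eqI space_add)
  qed
  show "\<Phi> ` sm_space V \<subseteq> sm_space image"
  proof
    fix w assume "w \<in> \<Phi> ` sm_space V"
    then obtain v where v: "v \<in> sm_space V" "w = \<Phi> v" by blast
    have "w = \<Phi> (component V 0 v) + \<Phi> (component V 1 v)"
      using v component_sum_01[OF v(1)] by (simp flip: \<Phi>_add)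
    moreover have "\<Phi> (component V a v) \<in> part image a" for a using v by simp
    ultimately show "w \<in> sm_space image"
      unfolding sm_space_def[of image] by blast
  qed
qed

lemma vector_space_image: "vector_space (smul image)"
  by unfold_locales (auto simp: algebra_simps fun_eq_iff)

lemma subspace_image:
  assumes "vs.subspace S" "S \<subseteq> sm_space V"
  shows "module.subspace (smul image) (\<Phi> ` S)"
proof -
  interpret I: vector_space "smul image" by (rule vector_space_image)
  show ?thesis
  proof (rule I.subspaceI)
    show "0 \<in> \<Phi> ` S" using \<Phi>_0 vs.subspace_0[OF assms(1)] by (metis image_eqI)
    show "x + y \<in> \<Phi> ` S" if xy: "x \<in> \<Phi> ` S" "y \<in> \<Phi> ` S" for x y
    proof -
      obtain u v where "u \<in> S" "v \<in> S" "x = \<Phi> u" "y = \<Phi> v" using xy by blast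
      then show ?thesis
        using assms(2) vs.subspace_add[OF assms(1)] \<Phi>_add[of u v] by (metis image_eqI subsetD)
    qed
    show "smul image c x \<in> \<Phi> ` S" if x: "x \<in> \<Phi> ` S" for c x
    proof -
      obtain u where "u \<in> S" "x = \<Phi> u" using x by blast
      then show ?thesis
        using assms(2) vs.subspace_scale[OF assms(1)] \<Phi>_smul[of u c] by (metis image_eqI subsetD)
    qed
  qed
qed

lemma is_supermodule_image: "is_supermodule n image"
  unfolding is_supermodule_def
proof (intro conjI allI ballI)
  show "vector_space (smul image)" by (rule vector_space_image)
  show "module.subspace (smul image) (part image a)" for a
    using subspace_image[OF part_subspace] part_subset by auto
  show "part image 0 \<inter> part image 1 = {0}"
  proof -
    have "w = 0" if "w \<in> part image 0" "w \<in> part image 1" for w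
    proof -
      obtain u v where uv: "u \<in> part V 0" "v \<in> part V 1" "w = \<Phi> u" "w = \<Phi> v"
        using \<open>w \<in> part image 0\<close> \<open>w \<in> part image 1\<close> by auto
      then have "u = v" using \<Phi>_inject[of u v] part_subset by metis
      then have "u = 0" using uv part_disjoint[of u 0] by simp
      then show ?thesis using uv \<Phi>_0 by simp
    qed
    moreover have "0 \<in> part image a" for a using \<Phi>_0 zero_in_part by (metis image_eqI image_simps(2))
    ultimately show ?thesis by blast
  qed
  fix x
  show "act image x v \<in> part image (a + b)" if "x \<in> queer_part n a" "v \<in> part image b" for a b v
    using that act_part part_subset by (auto simp: \<Psi>_\<Phi>)
  show "act image x (u + v) = act image x u + act image x v"
    if x: "x \<in> queer n" and uv: "u \<in> sm_space image" "v \<in> sm_space image" for u v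
  proof -
    obtain u' v' where "u = \<Phi> u'" "v = \<Phi> v'" "u' \<in> sm_space V" "v' \<in> sm_space V"
      using uv by (auto simp: sm_space_image)
    then show ?thesis using x by (simp add: \<Psi>_\<Phi> act_add space_add flip: \<Phi>_add)
  qed
  show "act image x (smul image c v) = smul image c (act image x v)"
    if x: "x \<in> queer n" and v: "v \<in> sm_space image" for c v
  proof -
    obtain v' where "v = \<Phi> v'" "v' \<in> sm_space V" using v by (auto simp: sm_space_image)
    then show ?thesis
      using x by (simp add: \<Psi>_\<Phi> act_scale space_scale flip: \<Phi>_scale)
  qed
  show "act image (x + y) v = act image x v + act image y v"
    if "x \<in> queer n" "y \<in> queer n" "v \<in> sm_space image" for y v
    using that by (auto simp: sm_space_image \<Psi>_\<Phi> act_add_mat \<Phi>_add)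
  show "act image (c \<cdot>\<^sub>m x) v = smul image c (act image x v)"
    if "x \<in> queer n" "v \<in> sm_space image" for c v
    using that by (auto simp: sm_space_image \<Psi>_\<Phi> act_smult_mat \<Phi>_scale)
  show "act image (super_bracket a b x y) v
      = act image x (act image y v) - smul image (koszul_sign a b) (act image y (act image x v))"
    if xy: "x \<in> queer_part n a" "y \<in> queer_part n b" and w: "v \<in> sm_space image" for a b y v
  proof -
    obtain v' where v: "v = \<Phi> v'" "v' \<in> sm_space V" using w by (auto simp: sm_space_image)
    have q: "x \<in> queer n" "y \<in> queer n" using xy queer_part_subset by auto
    show ?thesis
      using v q act_bracket[OF xy v(2)]
      by (simp add: \<Psi>_\<Phi> space_scale \<Phi>_diff flip: \<Phi>_scale)
  qed
qed

lemma \<Phi>_hom: "\<Phi> \<in> sm_hom n V image"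
  by (auto simp: sm_hom_def \<Phi>_add \<Phi>_scale \<Psi>_\<Phi>)

lemma \<Psi>_hom: "\<Psi> \<in> sm_hom n image V"
proof -
  have "\<Psi> (\<Phi> u + \<Phi> v) = \<Psi> (\<Phi> u) + \<Psi> (\<Phi> v)" if "u \<in> sm_space V" "v \<in> sm_space V" for u v
    using that by (simp add: \<Psi>_\<Phi> space_add flip: \<Phi>_add)
  moreover have "\<Psi> (smul image c (\<Phi> v)) = smul V c (\<Psi> (\<Phi> v))" if "v \<in> sm_space V" for c v
    using that by (simp add: \<Psi>_\<Phi> space_scale flip: \<Phi>_scale)
  ultimately show ?thesis
    by (auto simp: sm_hom_def sm_space_image \<Psi>_\<Phi> part_subset)
qed

lemma finite_dimensional_image:
  assumes "finite_dimensional V"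
  shows "finite_dimensional image"
proof -
  interpret I: vector_space "smul image" by (rule vector_space_image)
  obtain B where B: "finite B" "vs.span B = sm_space V"
    using assms by (auto simp: finite_dimensional_def)
  have "vs.span B \<subseteq> {v \<in> sm_space V. \<Phi> v \<in> I.span (\<Phi> ` B)}"
  proof (rule vs.span_minimal)
    show "vs.subspace {v \<in> sm_space V. \<Phi> v \<in> I.span (\<Phi> ` B)}"
      by (rule vs.subspaceI)
        (auto simp: \<Phi>_0 \<Phi>_add \<Phi>_smul I.span_zero I.span_add I.span_scale simp del: image_simps)
    show "B \<subseteq> {v \<in> sm_space V. \<Phi> v \<in> I.span (\<Phi> ` B)}"
      using B(2) vs.span_superset[of B] by (auto simp del: image_simps intro: I.span_base)
  qed
  moreover have "I.span (\<Phi> ` B) \<subseteq> \<Phi> ` sm_space V"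
    using vs.span_superset[of B] B(2) by (intro I.span_minimal subspace_image space_subspace) auto
  ultimately have "I.span (\<Phi> ` B) = sm_space image"
    unfolding B(2) sm_space_image by blast
  then show ?thesis using B(1) unfolding finite_dimensional_def by blast
qed

text \<open>Pull the invariant subspace back along \<Phi>, take a complement there and push it
  forward.\<close>

lemma semisimple_image:
  assumes "semisimple_over_even n V"
  shows "semisimple_over_even n image"
  unfolding semisimple_over_even_def
proof (intro allI impI)
  interpret I: supermod n image by unfold_locales (rule is_supermodule_image)
  fix W assume W: "even_invariant n image W"
  then have sub: "I.vs.subspace W" and sp: "W \<subseteq> \<Phi> ` sm_space V"
    and inv: "\<And>x w. x \<in> queer_part n 0 \<Longrightarrow> w \<in> W \<Longrightarrow> \<Phi> (act V x (\<Psi> w)) \<in> W"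
    unfolding invariant_subspace_def by (auto simp: sm_space_image)
  define U where "U = {v \<in> sm_space V. \<Phi> v \<in> W}"
  have WU: "W = \<Phi> ` U" using sp by (auto simp: U_def)
  have invU: "even_invariant n V U"
    unfolding invariant_subspace_def
  proof (intro conjI ballI vs.subspaceI)
    show "0 \<in> U" using I.vs.subspace_0[OF sub] by (simp add: U_def \<Phi>_0)
    show "x + y \<in> U" if "x \<in> U" "y \<in> U" for x y
      using that I.vs.subspace_add[OF sub] by (auto simp: U_def \<Phi>_add)
    show "smul V c x \<in> U" if "x \<in> U" for c x
      using that I.vs.subspace_scale[OF sub] by (auto simp: U_def \<Phi>_smul simp del: image_simps)
    show "act V x v \<in> U" if "x \<in> queer_part n 0" "v \<in> U" for x v
      using that inv[of x "\<Phi> v"] queer_part_subset[of n 0] by (auto simp: U_def \<Psi>_\<Phi>)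
  qed (auto simp: U_def)
  obtain U' where U': "even_invariant n V U'" "U \<inter> U' = {0}"
    "{w + w' |w w'. w \<in> U \<and> w' \<in> U'} = sm_space V"
    by (rule semisimple_over_evenE[OF assms invU])
  then have U's: "U' \<subseteq> sm_space V" "vs.subspace U'" by (auto simp: invariant_subspace_def)
  show "\<exists>W'. even_invariant n image W' \<and> W \<inter> W' = {0} \<and>
      {w + w' |w w'. w \<in> W \<and> w' \<in> W'} = sm_space image"
  proof (intro exI[of _ "\<Phi> ` U'"] conjI)
    show "even_invariant n image (\<Phi> ` U')"
      using U'(1) subspace_image[OF U's(2,1)] \<Psi>_\<Phi>
      by (auto simp: invariant_subspace_def sm_space_image subset_iff)
    show "W \<inter> \<Phi> ` U' = {0}"
    proof (intro equalityI subsetI)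
      fix w assume "w \<in> W \<inter> \<Phi> ` U'"
      then obtain u where u: "u \<in> U'" "w = \<Phi> u" "\<Phi> u \<in> W" by blast
      then have "u \<in> U \<inter> U'" using U's by (auto simp: U_def)
      then show "w \<in> {0}" using U'(2) u \<Phi>_0 by simp
    next
      fix w :: "nat \<Rightarrow> complex" assume "w \<in> {0}"
      then show "w \<in> W \<inter> \<Phi> ` U'"
        using I.vs.subspace_0[OF sub] vs.subspace_0[OF U's(2)] \<Phi>_0 by (auto intro!: image_eqI[of _ _ 0])
    qed
    show "{w + w' |w w'. w \<in> W \<and> w' \<in> \<Phi> ` U'} = sm_space image"
    proof (intro equalityI subsetI)
      fix z assume "z \<in> {w + w' |w w'. w \<in> W \<and> w' \<in> \<Phi> ` U'}"
      then obtain u u' where "u \<in> U" "u' \<in> U'" "z = \<Phi> u + \<Phi> u'" unfolding WU by blast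
      moreover from this have "u \<in> sm_space V" "u' \<in> sm_space V" using U's by (auto simp: U_def)
      ultimately show "z \<in> sm_space image" by (auto simp: sm_space_image simp flip: \<Phi>_add)
    next
      fix z assume "z \<in> sm_space image"
      then obtain v where v: "v \<in> sm_space V" "z = \<Phi> v" by (auto simp: sm_space_image)
      then obtain u u' where u: "u \<in> U" "u' \<in> U'" "v = u + u'" using U'(3) by blast
      then have "z = \<Phi> u + \<Phi> u'" using v U's by (auto simp: U_def \<Phi>_add)
      then show "z \<in> {w + w' |w w'. w \<in> W \<and> w' \<in> \<Phi> ` U'}" using u by (auto simp: WU)
    qed
  qed
qed

end

text \<open>Coordinates with respect to a finite basis, padded with zeros to a sequence.\<close>

lemma (in supermod) coordinates_exist:
  assumes "finite_dimensional V"
  shows "\<exists>\<Phi> \<Psi>. sm_transport n V \<Phi> \<Psi>"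
proof -
  obtain C where C: "finite C" "vs.span C = sm_space V"
    using assms by (auto simp: finite_dimensional_def)
  obtain B where B: "B \<subseteq> sm_space V" "vs.independent B" "sm_space V \<subseteq> vs.span B"
    using vs.maximal_independent_subset[of "sm_space V"] by blast
  have fin: "finite B" using vs.independent_span_bound[OF C(1) B(2)] B(1) C(2) by simp
  obtain b where b: "bij_betw b {0..<card B} B" using ex_bij_betw_nat_finite[OF fin] by blast
  define \<Phi> where "\<Phi> v k = (if k < card B then vs.representation B v (b k) else 0)" for v k
  define \<Psi> where "\<Psi> w = (\<Sum>k<card B. smul V (w k) (b k))" for w
  have "\<Psi> (\<Phi> v) = v" if v: "v \<in> sm_space V" for v
  proof -
    have "\<Psi> (\<Phi> v) = (\<Sum>k\<in>{0..<card B}. smul V (vs.representation B v (b k)) (b k))"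
      by (simp add: \<Psi>_def \<Phi>_def atLeast0LessThan)
    also have "\<dots> = (\<Sum>x\<in>B. smul V (vs.representation B v x) x)"
      by (rule sum.reindex_bij_betw[OF b])
    also have "\<dots> = v"
      using B v fin by (intro vs.sum_representation_eq) auto
    finally show ?thesis .
  qed
  then have "sm_transport n V \<Phi> \<Psi>"
    using B by unfold_locales
      (auto simp: \<Phi>_def fun_eq_iff vs.representation_add vs.representation_scale subset_iff)
  then show ?thesis by blast
qed

section \<open>Twisting the split extension by the odd trace\<close>

text \<open>For \<open>queer_mat A B\<close> this is the trace of \<open>B\<close>, read off the
  upper right block.\<close>

definition odd_trace :: "nat \<Rightarrow> complex mat \<Rightarrow> complex" where
  "odd_trace n x = (\<Sum>i<n. x $$ (i, n + i))"

lemma odd_trace_queer_mat: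
  "A \<in> carrier_mat n n \<Longrightarrow> B \<in> carrier_mat n n \<Longrightarrow> odd_trace n (queer_mat A B) = (\<Sum>i<n. B $$ (i, i))"
  unfolding odd_trace_def queer_mat_def by (rule sum.cong) auto

lemma odd_trace_even: "x \<in> queer_part n 0 \<Longrightarrow> odd_trace n x = 0"
  by (auto simp: queer_part_def odd_trace_queer_mat)

lemma odd_trace_add: "x \<in> queer n \<Longrightarrow> y \<in> queer n \<Longrightarrow> odd_trace n (x + y) = odd_trace n x + odd_trace n y"
  using queer_carrier[of x n] queer_carrier[of y n] unfolding odd_trace_def
  by (simp flip: sum.distrib)

lemma odd_trace_smult: "x \<in> queer n \<Longrightarrow> odd_trace n (c \<cdot>\<^sub>m x) = c * odd_trace n x"
  using queer_carrier[of x n] unfolding odd_trace_def by (simp add: sum_distrib_left)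

lemma odd_trace_qunit: "j < n \<Longrightarrow> odd_trace n (qunit n 1 j j) = 1"
  by (simp add: qunit_def odd_trace_queer_mat munit_def)

lemma sum_diag_mult_comm:
  assumes "A \<in> carrier_mat n n" "B \<in> carrier_mat n n"
  shows "(\<Sum>i<n. (A * B) $$ (i, i)) = (\<Sum>i<n. (B * A) $$ (i, i) :: complex)"
proof -
  have "(\<Sum>i<n. (A * B) $$ (i, i)) = (\<Sum>i<n. \<Sum>j<n. A $$ (i, j) * B $$ (j, i))"
    using assms by (simp add: scalar_prod_def lessThan_atLeast0)
  also have "\<dots> = (\<Sum>j<n. \<Sum>i<n. B $$ (j, i) * A $$ (i, j))"
    by (subst sum.swap) (simp add: mult.commute)
  also have "\<dots> = (\<Sum>i<n. (B * A) $$ (i, i))"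
    using assms by (simp add: scalar_prod_def lessThan_atLeast0)
  finally show ?thesis .
qed

text \<open>Symmetry of the trace settles a pair of different parities; a pair of equal parities has
  an even bracket, on which the odd trace is 0.\<close>

lemma odd_trace_bracket:
  assumes "x \<in> queer_part n a" "y \<in> queer_part n b"
  shows "odd_trace n (super_bracket a b x y) = 0"
proof -
  obtain A B where x: "x = queer_mat A B" "A \<in> carrier_mat n n" "B \<in> carrier_mat n n"
    "a = 0 \<Longrightarrow> B = 0\<^sub>m n n" "a = 1 \<Longrightarrow> A = 0\<^sub>m n n"
    using assms(1) by (cases a) (auto simp: queer_part_def)
  obtain C D where y: "y = queer_mat C D" "C \<in> carrier_mat n n" "D \<in> carrier_mat n n"
    "b = 0 \<Longrightarrow> D = 0\<^sub>m n n" "b = 1 \<Longrightarrow> C = 0\<^sub>m n n"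
    using assms(2) by (cases b) (auto simp: queer_part_def)
  have "odd_trace n (super_bracket a b x y)
      = odd_trace n (x * y) - koszul_sign a b * odd_trace n (y * x)"
    using x y unfolding super_bracket_def odd_trace_def
    by (simp add: queer_mat_mult[of _ n] queer_mat_def sum_subtractf sum_distrib_left)
  also have "odd_trace n (x * y) = (\<Sum>i<n. (A * D + B * C) $$ (i, i))"
    using x y by (simp add: queer_mat_mult[of _ n] odd_trace_queer_mat)
  also have "odd_trace n (y * x) = (\<Sum>i<n. (C * B + D * A) $$ (i, i))"
    using x y by (simp add: queer_mat_mult[of _ n] odd_trace_queer_mat)
  also have "(\<Sum>i<n. (C * B + D * A) $$ (i, i)) = (\<Sum>i<n. (A * D + B * C) $$ (i, i))"
    using x y sum_diag_mult_comm[of A n D] sum_diag_mult_comm[of B n C] by (simp add: sum.distrib)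
  also have "(\<Sum>i<n. (A * D + B * C) $$ (i, i)) - koszul_sign a b * (\<Sum>i<n. (A * D + B * C) $$ (i, i)) = 0"
    using x y by (cases a; cases b) auto
  finally show ?thesis .
qed

context simple_hw
begin

text \<open>The parity sign keeps parities in \<open>L\<close>, while an odd x has to change them;
  so a non-zero \<open>c\<close> fits the grading only if the second summand is shifted, p = 1. For
  c = 0 this is the direct sum, available for either p.\<close>

definition twisted_sum :: "bit \<Rightarrow> complex \<Rightarrow> ('v \<times> 'v) supermodule" where
  "twisted_sum p c = (pullback zero_map zero_map L (shift p L))
    \<lparr>act := \<lambda>x (u, v). (act L x u, act L x v + smul L (c * odd_trace n x) (parity_sign L u))\<rparr>"

context
  fixes p :: bit and c :: complex
  assumes pc: "p = 1 \<or> c = 0"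
begin

interpretation D: fibre_product n L "shift p L" zero_supermodule zero_map zero_map
  by (rule direct_sum[OF is_supermodule is_supermodule_shift[OF is_supermodule]])

abbreviation S where "S \<equiv> twisted_sum p c"

lemma twisted_sum_simps:
  "smul S b (u, v) = (smul L b u, smul L b v)"
  "(u, v) \<in> part S a \<longleftrightarrow> u \<in> part L a \<and> v \<in> part L (a + p)"
  "(u, v) \<in> sm_space S \<longleftrightarrow> u \<in> sm_space L \<and> v \<in> sm_space L"
  "act S x (u, v) = (act L x u, act L x v + smul L (c * odd_trace n x) (parity_sign L u))"
proof -
  have "sm_space S = sm_space D.P" by (simp add: sm_space_def twisted_sum_def)
  then show "(u, v) \<in> sm_space S \<longleftrightarrow> u \<in> sm_space L \<and> v \<in> sm_space L" by (simp add: D.P_space)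
qed (auto simp: twisted_sum_def D.P_part D.P_smul)

text \<open>Beyond the axioms for the two summands, the bracket relation asks for two things: the
  odd trace of a bracket is 0, and the mixed terms cancel.\<close>

lemma twisted_sum_supermodule: "is_supermodule n S"
  unfolding is_supermodule_def
proof (intro conjI allI ballI)
  have D: "smul S = smul D.P" "part S = part D.P" by (simp_all add: twisted_sum_def)
  show "vector_space (smul S)" unfolding D by (rule D.P_vector_space)
  show "module.subspace (smul S) (part S a)" for a unfolding D by (rule D.P.part_subspace)
  show "part S 0 \<inter> part S 1 = {0}"
    unfolding D using D.P_supermodule by (simp add: is_supermodule_def)
  fix x
  show "act S x w \<in> part S (a + b)" if x: "x \<in> queer_part n a" and wb: "w \<in> part S b" for a b w
  proof -
    obtain u v where w: "w = (u, v)" "u \<in> part L b" "v \<in> part L (b + p)"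
      using wb by (cases w) (auto simp: twisted_sum_simps)
    have "act L x v \<in> part L (a + b + p)" using act_part[OF x w(3)] by (simp add: add.assoc)
    moreover have "smul L (c * odd_trace n x) (parity_sign L u) \<in> part L (a + b + p)"
    proof (cases "a = 0 \<or> c = 0")
      case True
      then show ?thesis using x by (auto simp: odd_trace_even)
    next
      case False
      then have "a = 1" "p = 1" using pc by auto
      then have eq: "a + b + p = b" by (cases b) auto
      show ?thesis unfolding eq using w(2) by (intro part_scale parity_sign_in_part)
    qed
    ultimately show ?thesis
      using act_part[OF x w(2)] by (simp add: w(1) twisted_sum_simps part_add)
  qed
  show "act S x (w + z) = act S x w + act S x z"
    if "x \<in> queer n" "w \<in> sm_space S" "z \<in> sm_space S" for w z
    using that by (cases w; cases z)
      (simp add: twisted_sum_simps act_add parity_sign_add vs.scale_right_distrib)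
  show "act S x (smul S b w) = smul S b (act S x w)" if "x \<in> queer n" "w \<in> sm_space S" for b w
    using that by (cases w)
      (simp add: twisted_sum_simps act_scale parity_sign_scale vs.scale_right_distrib mult.commute)
  show "act S (x + y) w = act S x w + act S y w"
    if "x \<in> queer n" "y \<in> queer n" "w \<in> sm_space S" for y w
    using that by (cases w)
      (simp add: twisted_sum_simps act_add_mat odd_trace_add vs.scale_left_distrib distrib_left)
  show "act S (b \<cdot>\<^sub>m x) w = smul S b (act S x w)" if "x \<in> queer n" "w \<in> sm_space S" for b w
    using that by (cases w)
      (simp add: twisted_sum_simps act_smult_mat odd_trace_smult vs.scale_right_distrib mult.left_commute)
  show "act S (super_bracket a b x y) w
      = act S x (act S y w) - smul S (koszul_sign a b) (act S y (act S x w))"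
    if x: "x \<in> queer_part n a" and y: "y \<in> queer_part n b" and w: "w \<in> sm_space S" for a b y w
  proof -
    obtain u v where w: "w = (u, v)" "u \<in> sm_space L" "v \<in> sm_space L"
      using w by (cases w) (simp add: twisted_sum_simps)
    have q: "x \<in> queer n" "y \<in> queer n" using x y queer_part_subset by auto
    let ?d = "parity_sign L" and ?k = "koszul_sign a b"
    let ?tx = "c * odd_trace n x" and ?ty = "c * odd_trace n y"
    \<comment> \<open>The odd trace is 0 on even elements, and the parity sign anticommutes with odd
      ones. For two odd elements it is this sign that balances the Koszul sign; without it the mixed
      terms would add up.\<close>
    have cross: "smul L ?ty (act L x (?d u)) + smul L ?tx (?d (act L y u))
        = smul L ?k (smul L ?tx (act L y (?d u)) + smul L ?ty (?d (act L x u)))"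
      using x y w q by (cases a; cases b) (simp_all add: odd_trace_even parity_sign_act act_space)
    have "act L x (act L y v + smul L ?ty (?d u)) + smul L ?tx (?d (act L y u))
        - smul L ?k (act L y (act L x v + smul L ?tx (?d u)) + smul L ?ty (?d (act L x u)))
      = (act L x (act L y v) - smul L ?k (act L y (act L x v)))
        + (smul L ?ty (act L x (?d u)) + smul L ?tx (?d (act L y u))
        - smul L ?k (smul L ?tx (act L y (?d u)) + smul L ?ty (?d (act L x u))))"
      using w q by (simp add: act_add act_scale space_scale vs.scale_right_distrib)
    also have "\<dots> = act L (super_bracket a b x y) v"
      unfolding cross using act_bracket[OF x y w(3)] by simp
    finally show ?thesis
      using act_bracket[OF x y w(2)] odd_trace_bracket[OF x y] by (simp add: w(1) twisted_sum_simps)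
  qed
qed

lemma twisted_sum_finite_dimensional: "finite_dimensional S"
proof -
  have D: "smul S = smul D.P" by (simp add: twisted_sum_def)
  obtain B where B: "finite B" "vs.span B = sm_space L"
    using is_L by (auto simp: is_L_def finite_dimensional_def)
  let ?l = "\<lambda>b::'v. (b, 0::'v)" and ?r = "\<lambda>b::'v. (0::'v, b)"
  let ?C = "?l ` B \<union> ?r ` B"
  interpret l: module_hom "smul L" "smul D.P" ?l
    by unfold_locales (auto simp: D.P_smul)
  interpret r: module_hom "smul L" "smul D.P" ?r
    by unfold_locales (auto simp: D.P_smul)
  have "D.P.vs.span ?C = {a + b | a b. a \<in> ?l ` sm_space L \<and> b \<in> ?r ` sm_space L}"
    unfolding D.P.vs.span_Un l.span_image r.span_image B(2) ..
  also have "\<dots> = sm_space S"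
  proof (intro equalityI subsetI)
    fix w assume "w \<in> sm_space S"
    then have "w = ?l (fst w) + ?r (snd w)" "fst w \<in> sm_space L" "snd w \<in> sm_space L"
      by (cases w; simp add: twisted_sum_simps)+
    then show "w \<in> {a + b | a b. a \<in> ?l ` sm_space L \<and> b \<in> ?r ` sm_space L}" by blast
  qed (auto simp: twisted_sum_simps)
  finally have "D.P.vs.span ?C = sm_space S" .
  then show ?thesis
    unfolding finite_dimensional_def D using B(1) by (intro exI[of _ ?C]) auto
qed

text \<open>As a module over the even part this is \<open>L \<oplus> L\<close>. A complement of an invariant subspace \<open>W\<close> is the
  product of complements of its image under the first projection and of its fibre over 0.\<close>

lemma twisted_sum_semisimple: "semisimple_over_even n S"
  unfolding semisimple_over_even_def
proof (intro allI impI)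
  have ss: "semisimple_over_even n L"
    using obj by (simp add: queer_category_obj_def)
  interpret S: supermod n S by unfold_locales (rule twisted_sum_supermodule)
  have ev: "act S x (u, v) = (act L x u, act L x v)" if "x \<in> queer_part n 0" for x u v
    using that by (simp add: twisted_sum_simps odd_trace_even)
  fix W assume W: "even_invariant n S W"
  then have sub: "S.vs.subspace W" and sp: "W \<subseteq> sm_space S"
    and inv: "\<And>x w. x \<in> queer_part n 0 \<Longrightarrow> w \<in> W \<Longrightarrow> act S x w \<in> W"
    by (auto simp: invariant_subspace_def)
  have add: "(u + u', v + v') \<in> W" if "(u, v) \<in> W" "(u', v') \<in> W" for u u' v v'
    using S.vs.subspace_add[OF sub that] by simp
  have scale: "(smul L b u, smul L b v) \<in> W" if "(u, v) \<in> W" for b u v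
    using S.vs.subspace_scale[OF sub that, of b] by (simp add: twisted_sum_simps)
  have zero: "(0, 0) \<in> W" using S.vs.subspace_0[OF sub] by (simp add: zero_prod_def)
  have W2: "even_invariant n L {v. (0, v) \<in> W}"
    unfolding invariant_subspace_def
  proof (intro conjI ballI vs.subspaceI)
    show "x + y \<in> {v. (0, v) \<in> W}" if "x \<in> {v. (0, v) \<in> W}" "y \<in> {v. (0, v) \<in> W}" for x y
      using add[of 0 x 0 y] that by simp
    show "smul L b x \<in> {v. (0, v) \<in> W}" if "x \<in> {v. (0, v) \<in> W}" for b x
      using scale[of 0 x b] that by simp
    show "act L x v \<in> {v. (0, v) \<in> W}" if "x \<in> queer_part n 0" "v \<in> {v. (0, v) \<in> W}" for x v
    proof -
      have "act L x 0 = 0" using that(1) queer_part_subset by (intro act_0) auto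
      then show ?thesis using inv[of x "(0, v)"] ev[OF that(1)] that by simp
    qed
  qed (use zero sp in \<open>auto simp: twisted_sum_simps\<close>)
  have W1: "even_invariant n L (fst ` W)"
    unfolding invariant_subspace_def
  proof (intro conjI ballI vs.subspaceI)
    show "0 \<in> fst ` W" using zero by force
    show "x + y \<in> fst ` W" if "x \<in> fst ` W" "y \<in> fst ` W" for x y
      using add that by force
    show "smul L b x \<in> fst ` W" if "x \<in> fst ` W" for b x
      using scale that by force
    show "fst ` W \<subseteq> sm_space L" using sp by (auto simp: twisted_sum_simps)
    show "act L x v \<in> fst ` W" if "x \<in> queer_part n 0" "v \<in> fst ` W" for x v
      using inv[OF that(1)] ev[OF that(1)] that(2) by force
  qed
  obtain C1 where C1: "even_invariant n L C1" "fst ` W \<inter> C1 = {0}"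
    "{w + w' |w w'. w \<in> fst ` W \<and> w' \<in> C1} = sm_space L" by (rule semisimple_over_evenE[OF ss W1])
  obtain C2 where C2: "even_invariant n L C2" "{v. (0, v) \<in> W} \<inter> C2 = {0}"
    "{w + w' |w w'. w \<in> {v. (0, v) \<in> W} \<and> w' \<in> C2} = sm_space L" by (rule semisimple_over_evenE[OF ss W2])
  have C: "vs.subspace C1" "C1 \<subseteq> sm_space L" "vs.subspace C2" "C2 \<subseteq> sm_space L"
    using C1(1) C2(1) by (auto simp: invariant_subspace_def)
  show "\<exists>W'. even_invariant n S W' \<and> W \<inter> W' = {0} \<and>
      {w + w' |w w'. w \<in> W \<and> w' \<in> W'} = sm_space S"
  proof (intro exI[of _ "C1 \<times> C2"] conjI)
    show "even_invariant n S (C1 \<times> C2)"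
      unfolding invariant_subspace_def
    proof (intro conjI ballI S.vs.subspaceI)
      show "0 \<in> C1 \<times> C2" using C vs.subspace_0 by (simp add: zero_prod_def)
      show "x + y \<in> C1 \<times> C2" if "x \<in> C1 \<times> C2" "y \<in> C1 \<times> C2" for x y
        using that vs.subspace_add[OF C(1)] vs.subspace_add[OF C(3)] by auto
      show "smul S b x \<in> C1 \<times> C2" if "x \<in> C1 \<times> C2" for b x
        using that vs.subspace_scale[OF C(1)] vs.subspace_scale[OF C(3)] by (auto simp: twisted_sum_simps)
      show "C1 \<times> C2 \<subseteq> sm_space S" using C by (auto simp: twisted_sum_simps)
      show "act S x w \<in> C1 \<times> C2" if "x \<in> queer_part n 0" "w \<in> C1 \<times> C2" for x w
        using that C1(1) C2(1) ev[OF that(1)] by (auto simp: invariant_subspace_def)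
    qed
    show "W \<inter> (C1 \<times> C2) = {0}"
    proof (intro equalityI subsetI)
      fix w assume w: "w \<in> W \<inter> (C1 \<times> C2)"
      then obtain u v where uv: "w = (u, v)" "u \<in> C1" "v \<in> C2" "(u, v) \<in> W" by auto
      then have "u \<in> fst ` W \<inter> C1" by force
      then have u: "u = 0" unfolding C1(2) by simp
      then have "v \<in> {v. (0, v) \<in> W} \<inter> C2" using uv by simp
      then have "v = 0" unfolding C2(2) by simp
      then show "w \<in> {0}" using uv u by (simp add: zero_prod_def)
    next
      fix w :: "'v \<times> 'v" assume "w \<in> {0}"
      then show "w \<in> W \<inter> (C1 \<times> C2)" using zero C vs.subspace_0 by (auto simp: zero_prod_def)
    qed
    show "{w + w' |w w'. w \<in> W \<and> w' \<in> C1 \<times> C2} = sm_space S"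
    proof (intro equalityI subsetI)
      fix z assume "z \<in> {w + w' |w w'. w \<in> W \<and> w' \<in> C1 \<times> C2}"
      then obtain w w' where "z = w + w'" "w \<in> sm_space S" "w' \<in> sm_space S"
        using sp C by (fastforce simp: twisted_sum_simps)
      then show "z \<in> sm_space S" by auto
    next
      fix z assume "z \<in> sm_space S"
      then obtain x y where z: "z = (x, y)" "x \<in> sm_space L" "y \<in> sm_space L"
        by (cases z) (auto simp: twisted_sum_simps)
      then obtain w1 c1 where 1: "w1 \<in> fst ` W" "c1 \<in> C1" "x = w1 + c1" using C1(3) by blast
      \<comment> \<open>Any lift of \<open>w1\<close> to \<open>W\<close> will do: the error in the
        second coordinate is corrected by the fibre of \<open>W\<close> over 0 together with
        \<open>C2\<close>.\<close>
      then obtain t where t: "(w1, t) \<in> W" by auto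
      have "(w1, t) \<in> sm_space S" using t sp by auto
      then have "y - t \<in> sm_space L" using z(3) by (auto simp: twisted_sum_simps)
      then obtain w2 c2 where 2: "(0, w2) \<in> W" "c2 \<in> C2" "y - t = w2 + c2" using C2(3) by blast
      have "z = (w1, t + w2) + (c1, c2)" using z 1 2(3) by (simp add: algebra_simps)
      moreover have "(w1, t + w2) \<in> W" using add[OF t 2(1)] by simp
      ultimately show "z \<in> {w + w' |w w'. w \<in> W \<and> w' \<in> C1 \<times> C2}" using 1 2 by blast
    qed
  qed
qed

text \<open>On the weight space h_j acts by the twist alone, since it kills the weight space of
  \<open>L\<close>; its odd trace is 1, so the scalar is the prescribed \<open>c\<close>.\<close>

lemma extension_with_scalar:
  "\<exists>e\<in>extensions n L (shift p L). ext_scalar n lam L e c"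
proof -
  interpret S: supermod n S by unfold_locales (rule twisted_sum_supermodule)
  obtain \<Phi> \<Psi> where "sm_transport n S \<Phi> \<Psi>"
    using S.coordinates_exist twisted_sum_finite_dimensional by blast
  then interpret T: sm_transport n S \<Phi> \<Psi> .
  define e :: "('v, 'v) extension" where
    "e = \<lparr>mid = T.image, inc = \<lambda>y. \<Phi> (0, y), prj = \<lambda>w. fst (\<Psi> w)\<rparr>"
  have e: "mid e = T.image" "inc e = (\<lambda>y. \<Phi> (0, y))" "prj e = (\<lambda>w. fst (\<Psi> w))"
    by (simp_all add: e_def)
  have "(\<lambda>y. (0, y)) \<in> sm_hom n (shift p L) S"
    by (auto simp: sm_hom_def twisted_sum_simps parity_sign_def component_same)
  then have inc: "inc e \<in> sm_hom n (shift p L) (mid e)"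
    unfolding e
    by (rule sm_hom_comp[OF is_supermodule_shift[OF is_supermodule] S.is_supermodule
        T.is_supermodule_image _ T.\<Phi>_hom])
  have "fst \<in> sm_hom n S L"
    by (auto simp: sm_hom_def twisted_sum_simps)
  then have prj: "prj e \<in> sm_hom n (mid e) L"
    unfolding e
    by (rule sm_hom_comp[OF T.is_supermodule_image S.is_supermodule is_supermodule T.\<Psi>_hom])
  have obj: "queer_category_obj n (mid e)"
    unfolding queer_category_obj_def e
    using T.is_supermodule_image T.finite_dimensional_image[OF twisted_sum_finite_dimensional]
      T.semisimple_image[OF twisted_sum_semisimple] by blast
  have \<Psi>: "\<Psi> (\<Phi> (u, v)) = (u, v)" if "u \<in> sm_space L" "v \<in> sm_space L" for u v
    using that by (intro T.\<Psi>_\<Phi>) (simp add: twisted_sum_simps)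
  have mid: "w \<in> sm_space (mid e) \<longleftrightarrow> (\<exists>u\<in>sm_space L. \<exists>v\<in>sm_space L. w = \<Phi> (u, v))" for w
  proof
    assume "w \<in> sm_space (mid e)"
    then obtain z where z: "z \<in> sm_space S" "w = \<Phi> z" unfolding e T.sm_space_image by (rule imageE)
    obtain u v where uv: "z = (u, v)" by (rule prod.exhaust)
    have "u \<in> sm_space L \<and> v \<in> sm_space L" using z(1) unfolding uv twisted_sum_simps .
    then show "\<exists>u\<in>sm_space L. \<exists>v\<in>sm_space L. w = \<Phi> (u, v)" using z(2) uv by blast
  next
    assume "\<exists>u\<in>sm_space L. \<exists>v\<in>sm_space L. w = \<Phi> (u, v)"
    then obtain u v where uv: "u \<in> sm_space L" "v \<in> sm_space L" "w = \<Phi> (u, v)" by blast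
    have "(u, v) \<in> sm_space S" unfolding twisted_sum_simps using uv by simp
    then show "w \<in> sm_space (mid e)" unfolding e T.sm_space_image uv(3) by (rule imageI)
  qed
  have "inj_on (inc e) (sm_space (shift p L))"
  proof (rule inj_onI)
    fix x y assume xy: "x \<in> sm_space (shift p L)" "y \<in> sm_space (shift p L)" "inc e x = inc e y"
    have "\<Phi> (0, x) = \<Phi> (0, y)" using xy(3) unfolding e .
    then have "\<Psi> (\<Phi> (0, x)) = \<Psi> (\<Phi> (0, y))" by (rule arg_cong)
    then show "x = y" using xy(1,2) by (simp add: \<Psi>)
  qed
  moreover have "inc e ` sm_space (shift p L) = {v \<in> sm_space (mid e). prj e v = 0}"
  proof (intro equalityI subsetI)
    fix w assume "w \<in> inc e ` sm_space (shift p L)"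
    then obtain y where y: "y \<in> sm_space L" "w = \<Phi> (0, y)" by (auto simp: e)
    then have "w \<in> sm_space (mid e)" unfolding mid using space_zero by blast
    then show "w \<in> {v \<in> sm_space (mid e). prj e v = 0}" using y \<Psi>[of 0 y] by (simp add: e)
  next
    fix w assume w: "w \<in> {v \<in> sm_space (mid e). prj e v = 0}"
    then obtain u v where uv: "u \<in> sm_space L" "v \<in> sm_space L" "w = \<Phi> (u, v)"
      unfolding mem_Collect_eq mid by blast
    have "prj e w = 0" using w by simp
    then have "u = 0" using uv \<Psi>[of u v] by (simp add: e)
    then show "w \<in> inc e ` sm_space (shift p L)" using uv by (simp add: e)
  qed
  moreover have "prj e ` sm_space (mid e) = sm_space L"
  proof (intro equalityI subsetI)
    fix x assume "x \<in> prj e ` sm_space (mid e)"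
    then obtain w where w: "w \<in> sm_space (mid e)" "x = prj e w" by blast
    then obtain u v where "u \<in> sm_space L" "v \<in> sm_space L" "w = \<Phi> (u, v)" unfolding mid by blast
    then show "x \<in> sm_space L" using w(2) \<Psi>[of u v] by (simp add: e)
  next
    fix x assume x: "x \<in> sm_space L"
    then have "\<Phi> (x, 0) \<in> sm_space (mid e)" unfolding mid using space_zero by blast
    moreover have "x = prj e (\<Phi> (x, 0))" using \<Psi>[of x 0] x by (simp add: e)
    ultimately show "x \<in> prj e ` sm_space (mid e)" by blast
  qed
  ultimately have ext: "e \<in> extensions n L (shift p L)"
    using inc prj obj by (simp add: extensions_def)
  have "ext_scalar n lam L e c"
    unfolding ext_scalar_def
  proof (intro allI impI ballI)
    fix j v assume j: "j < n" "lam j = 0" and v: "v \<in> wspace n lam (mid e)"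
    then have "v \<in> wspace n lam T.image" by (simp add: e)
    have "v \<in> sm_space (mid e)" using v by (simp add: wspace_def)
    then obtain x y where xy: "v = \<Phi> (x, y)" "x \<in> sm_space L" "y \<in> sm_space L"
      unfolding mid by blast
    have "\<Psi> v \<in> wspace n lam S"
    proof -
      interpret Psi: sm_morphism n T.image S \<Psi>
        by (rule sm_morphismI[OF T.is_supermodule_image S.is_supermodule T.\<Psi>_hom])
      show ?thesis by (rule Psi.map_wspace) fact
    qed
    then have w: "(x, y) \<in> wspace n lam S" using xy \<Psi>[of x y] by simp
    \<comment> \<open>Weights are tested with even units, for which the twist is absent.\<close>
    have "x \<in> TL" "y \<in> TL"
      using w xy unfolding wspace_def by (simp_all add: twisted_sum_simps odd_trace_even[OF qunit_part])
    then have "unit_act n S 1 j j (x, y) = (0, smul L c (parity_sign L x))"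
      using odd_diag_zero[OF j] j(1) by (simp add: twisted_sum_simps odd_trace_qunit)
    then show "unit_act n (mid e) 1 j j v = inc e (smul L c (parity_sign L (prj e v)))"
      using \<Psi>[OF xy(2,3)] by (simp add: e xy(1))
  qed
  then show ?thesis using ext by blast
qed

end

end

section \<open>The extension groups\<close>

context simple_hw
begin

lemma ext_relI:
  assumes "e \<in> extensions n L (shift p L)" "e' \<in> extensions n L (shift p L)"
    and "ext_scalar n lam L e c" "ext_scalar n lam L e' c"
  shows "(e, e') \<in> ext_rel n L (shift p L)"
  using ext_morphism_exists[OF assms(1,3,2), of 1] assms
  by (auto simp: ext_rel_def)

text \<open>With a common scalar 0 all extensions are equivalent and all split, so the only class is
  the class of split extensions.\<close>

lemma Ext1_trivial:
  assumes zero: "\<And>e. e \<in> extensions n L (shift p L) \<Longrightarrow> ext_scalar n lam L e 0"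
  shows "carrier (Ext1 n L (shift p L)) = {\<zero>\<^bsub>Ext1 n L (shift p L)\<^esub>}"
proof -
  let ?E = "extensions n L (shift p L)"
  have "split_extensions n L (shift p L) = ?E"
  proof
    show "?E \<subseteq> split_extensions n L (shift p L)"
    proof
      fix e assume e: "e \<in> ?E"
      interpret self_extension n lam L p e by unfold_locales (rule e)
      show "e \<in> split_extensions n L (shift p L)" by (rule scalar_zero_splits[OF zero[OF e]])
    qed
  qed (auto simp: split_extensions_def)
  moreover have "ext_rel n L (shift p L) = ?E \<times> ?E"
    using ext_relI[OF _ _ zero zero] by (auto simp: ext_rel_def)
  \<comment> \<open>The quotient of an empty set would have no element at all; c = 0 is allowed for
    either p and gives the direct sum.\<close>
  moreover have "?E \<noteq> {}" using extension_with_scalar[of p 0] by auto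
  ultimately show ?thesis by (auto simp: Ext1_def quotient_def)
qed

text \<open>The zero coordinate \<open>j\<close> makes the scalar unique, so the classes are exactly
  the fibres \<open>cls c\<close> of the scalar, and the isomorphism is the inverse of
  \<open>cls\<close>.\<close>

lemma Ext1_line:
  assumes j: "j < n" "lam j = 0"
  shows "linear_isomorphic (Ext1 n L (shift 1 L)) complex_line"
proof -
  let ?N = "shift 1 L"
  let ?E = "extensions n L ?N"
  define cls where "cls c = {e \<in> ?E. ext_scalar n lam L e c}" for c
  have ex: "\<exists>c. ext_scalar n lam L e c" if e: "e \<in> ?E" for e
  proof -
    interpret self_extension n lam L 1 e by unfold_locales (rule e)
    show ?thesis by (rule scalar_exists) simp
  qed
  have unique: "c = d" if e: "e \<in> ?E" and cd: "ext_scalar n lam L e c" "ext_scalar n lam L e d" for e c d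
  proof -
    interpret self_extension n lam L 1 e by unfold_locales (rule e)
    show ?thesis by (rule scalar_unique[OF j cd])
  qed
  have ne: "\<exists>e. e \<in> cls c" for c
    using extension_with_scalar[of 1 c] by (auto simp: cls_def)
  have inj: "cls c = cls d \<longleftrightarrow> c = d" for c d
    using ne[of c] unique by (auto simp: cls_def)
  have rel: "ext_rel n L ?N `` {e} = cls c" if e: "e \<in> cls c" for e c
  proof (intro equalityI subsetI)
    fix e' assume "e' \<in> cls c"
    then show "e' \<in> ext_rel n L ?N `` {e}" using e by (auto simp: cls_def intro: ext_relI)
  next
    fix e' assume "e' \<in> ext_rel n L ?N `` {e}"
    then obtain f where e': "e' \<in> ?E" and f: "f \<in> sm_hom n (mid e) (mid e')"
      "\<forall>y\<in>sm_space L. f (inc e y) = inc e' y" "\<forall>v\<in>sm_space (mid e). prj e' (f v) = prj e v"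
      by (auto simp: ext_rel_def)
    obtain d where d: "ext_scalar n lam L e' d" using ex[OF e'] by blast
    \<comment> \<open>An equivalence is a morphism over multiplication by 1 on the kernel.\<close>
    have "d = 1 * c"
      by (rule ext_morphism_scalar[OF j _ _ e' d f(1) _ f(3)]) (use e f(2) in \<open>auto simp: cls_def\<close>)
    then show "e' \<in> cls c" using e' d by (simp add: cls_def)
  qed
  have carrier: "carrier (Ext1 n L ?N) = range cls"
  proof (intro equalityI subsetI)
    fix X assume "X \<in> carrier (Ext1 n L ?N)"
    then obtain e where e: "e \<in> ?E" "X = ext_rel n L ?N `` {e}"
      by (auto simp: Ext1_def quotient_def)
    obtain c where "ext_scalar n lam L e c" using ex[OF e(1)] by blast
    then show "X \<in> range cls" using rel[of e c] e by (auto simp: cls_def)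
  next
    fix X assume "X \<in> range cls"
    then obtain c e where c: "X = cls c" "e \<in> cls c" using ne by blast
    then have "e \<in> ?E" by (simp add: cls_def)
    then show "X \<in> carrier (Ext1 n L ?N)"
      using rel[OF c(2)] c(1) by (auto simp: Ext1_def quotient_def)
  qed
  \<comment> \<open>One inclusion builds a morphism out of the fibre product, the other reads the
    scalar off a given one; the next step does the same for scalar multiples.\<close>
  have add: "baer_sum n L ?N (cls a) (cls b) = cls (a + b)" for a b
  proof (intro equalityI subsetI)
    fix e assume "e \<in> cls (a + b)"
    then have e: "e \<in> ?E" "ext_scalar n lam L e (a + b)" by (auto simp: cls_def)
    obtain e1 e2 where e12: "e1 \<in> cls a" "e2 \<in> cls b" using ne by blast
    then have "e1 \<in> ?E" "ext_scalar n lam L e1 a" "e2 \<in> ?E" "ext_scalar n lam L e2 b"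
      by (auto simp: cls_def)
    from baer_morphism_exists[OF this e] show "e \<in> baer_sum n L ?N (cls a) (cls b)"
      unfolding baer_sum_def sm_space_shift using e(1) e12 by blast
  next
    fix e assume "e \<in> baer_sum n L ?N (cls a) (cls b)"
    then obtain e1 e2 f where e: "e \<in> ?E" and e1: "e1 \<in> ?E" "ext_scalar n lam L e1 a"
      and e2: "e2 \<in> ?E" "ext_scalar n lam L e2 b"
      and f: "f \<in> sm_hom n (pullback (prj e1) (prj e2) (mid e1) (mid e2)) (mid e)"
      "\<forall>y\<in>sm_space L. \<forall>z\<in>sm_space L. f (inc e1 y, inc e2 z) = inc e (y + z)"
      "\<forall>(v, w)\<in>sm_space (pullback (prj e1) (prj e2) (mid e1) (mid e2)). prj e (f (v, w)) = prj e1 v"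
      unfolding baer_sum_def sm_space_shift cls_def by blast
    obtain c where c: "ext_scalar n lam L e c" using ex[OF e] by blast
    have "c = a + b" by (rule baer_morphism_scalar[OF j e1 e2 e c f])
    then show "e \<in> cls (a + b)" using e c by (simp add: cls_def)
  qed
  have smult: "ext_smult n L ?N b (cls a) = cls (b * a)" for a b
  proof (intro equalityI subsetI)
    fix e assume "e \<in> cls (b * a)"
    then have e: "e \<in> ?E" "ext_scalar n lam L e (b * a)" by (auto simp: cls_def)
    obtain e1 where e1: "e1 \<in> cls a" using ne by blast
    then have "e1 \<in> ?E" "ext_scalar n lam L e1 a" by (auto simp: cls_def)
    from ext_morphism_exists[OF this e] show "e \<in> ext_smult n L ?N b (cls a)"
      unfolding ext_smult_def sm_space_shift shift_simps using e(1) e1 by blast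
  next
    fix e assume "e \<in> ext_smult n L ?N b (cls a)"
    then obtain e1 f where e: "e \<in> ?E" and e1: "e1 \<in> ?E" "ext_scalar n lam L e1 a"
      and f: "f \<in> sm_hom n (mid e1) (mid e)" "\<forall>y\<in>sm_space L. f (inc e1 y) = inc e (smul L b y)"
      "\<forall>v\<in>sm_space (mid e1). prj e (f v) = prj e1 v"
      unfolding ext_smult_def sm_space_shift shift_simps cls_def by blast
    obtain c where c: "ext_scalar n lam L e c" using ex[OF e] by blast
    have "c = b * a" by (rule ext_morphism_scalar[OF j e1 e c f])
    then show "e \<in> cls (b * a)" using e c by (simp add: cls_def)
  qed
  define \<phi> where "\<phi> X = (THE c. X = cls c)" for X
  have \<phi>: "\<phi> (cls c) = c" for c
    unfolding \<phi>_def by (simp add: inj)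
  have "bij_betw \<phi> (range cls) UNIV"
    by (rule bij_betwI[of _ _ _ cls]) (auto simp: \<phi>)
  then show ?thesis
    unfolding linear_isomorphic_def carrier
    by (intro exI[of _ \<phi>]) (auto simp: \<phi> complex_line_def Ext1_def add smult)
qed

end

theorem theorem4p1:
  fixes n k m :: nat
    and l :: "nat \<Rightarrow> real"
    and lam :: "nat \<Rightarrow> complex"
    and L :: "'v::ab_group_add supermodule"
  assumes "k + m \<le> n"
    and "\<And>i. i < n \<Longrightarrow> i < k \<or> k + m \<le> i \<Longrightarrow> l i > 0"
    and "\<And>i. i < k \<Longrightarrow> lam i = of_real (l i)"
    and "\<And>i. k \<le> i \<Longrightarrow> i < k + m \<Longrightarrow> lam i = 0"
    and "\<And>i. k + m \<le> i \<Longrightarrow> i < n \<Longrightarrow> lam i = - of_real (l i)"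
    and "lam \<in> dominant_weights n"
    and "queer_category_obj n L"
    and "is_L n lam L"
  shows "(m > 0 \<longrightarrow> linear_isomorphic (Ext1 n L (parity_change L)) complex_line) \<and>
         (m = 0 \<longrightarrow> carrier (Ext1 n L (parity_change L)) = {\<zero>\<^bsub>Ext1 n L (parity_change L)\<^esub>}) \<and>
         (\<not> sm_isomorphic n L (parity_change L) \<longrightarrow> carrier (Ext1 n L L) = {\<zero>\<^bsub>Ext1 n L L\<^esub>})"
proof (intro conjI impI)
  interpret simple_hw n lam L by unfold_locales (fact assms)+
  show "linear_isomorphic (Ext1 n L (parity_change L)) complex_line" if "m > 0"
    \<comment> \<open>For m > 0 the coordinate at index \<open>k\<close> is zero.\<close>
    unfolding parity_change_shift using that assms(1,4) by (intro Ext1_line[of k]) auto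
  show "carrier (Ext1 n L (parity_change L)) = {\<zero>\<^bsub>Ext1 n L (parity_change L)\<^esub>}" if "m = 0"
  proof -
    \<comment> \<open>Without zero coordinates the condition in \<open>ext_scalar\<close> is empty,
      so every extension has scalar 0.\<close>
    have "lam i \<noteq> 0" if "i < n" for i
      using assms(2,3,5)[of i] that \<open>m = 0\<close> by (cases "i < k") fastforce+
    then show ?thesis
      unfolding parity_change_shift by (intro Ext1_trivial) (auto simp: ext_scalar_def)
  qed
  show "carrier (Ext1 n L L) = {\<zero>\<^bsub>Ext1 n L L\<^esub>}" if niso: "\<not> sm_isomorphic n L (parity_change L)"
  proof -
    have "ext_scalar n lam L e 0" if e: "e \<in> extensions n L (shift 0 L)" for e
    proof -
      interpret self_extension n lam L 0 e by unfold_locales (rule e)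
      show ?thesis using niso by (intro scalar_zero) (simp_all add: parity_change_shift)
    qed
    then show ?thesis using Ext1_trivial[of 0] by simp
  qed
qed

end
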